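(* Let $\mathfrak e$ be a lower semicontinuous set-monotonic interaction functional on $\Omega\subset\mathbb R^d$, and let $\mathfrak t$ be a monotonic function such that $\lim_{u\to\infty}\mathfrak t(tu)/\mathfrak t(u)=\mathfrak w(t)$ for all $t>0$ from a set of positive Lebesgue measure, with $\mathfrak w$ strictly convex. Suppose that (a) for every cube $x+a\boldsymbol q_d\subset\Omega$ the limit $\mathfrak L_{\mathfrak e}(x+a\boldsymbol q_d)$ exists, satisfies $0<\mathfrak L_{\mathfrak e}(x+a\boldsymbol q_d)<+\infty$, and depends on $a$ but not on $x$; (b) $\mathfrak e$ has the short-range interaction property; (c) $\mathfrak e$ has the continuity property on cubes. Then: (A) $\mathfrak w(t)=t^{1+\sigma}$ for some $\sigma\in(-\infty,-1)\cup(0,\infty)$, where $\operatorname{sgn}\sigma\cdot\mathfrak t(N)$ is increasing; (B) $\mathfrak L_{\mathfrak e}(A)=\mathfrak L_{\mathfrak e}(\boldsymbol q_d)\cdot(\lambda_d(A))^{-\sigma}$ for every compact $A\subset\Omega$ (in particular the limit defining $\mathfrak L_{\mathfrak e}(A)$ exists); (C) for every compact $A\subset\Omega$ with $\lambda_d(A)>0$, the normalized counting measures $\frac1N\sum_{x\in\omega_N^*(A)}\delta_x$ of minimizers $\omega_N^*(A)$ converge weak$^*$, as $N\to\infty$, to the probability measure on $A$ proportional to the restriction of $\lambda_d$ to $A$.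
   Context: Fix a bounded open set $\Omega\subset\mathbb R^d$. $\lambda_d$ is Lebesgue measure, $\boldsymbol q_d=[-1/2,1/2]^d$, and a "cube" is a set $x+a\boldsymbol q_d$ with $a>0$; assume $\boldsymbol q_d\subset\Omega$. A configuration $\omega_N=\{x_1,\dots,x_N\}$ is a multiset of $N$ points. An interaction functional $\mathfrak e$ assigns to every configuration $\omega_N\subset\Omega$ with $N\ge N_0$ ($N_0$ fixed) and every compact $A\subset\Omega$ a value $\mathfrak e(\omega_N,A)\in[E_0,+\infty]$, where $E_0\in\mathbb R$ is a constant ($E_0=0$ if $\mathfrak e$ genuinely depends on $A$; it may be independent of $A$). Lower semicontinuous means that for every fixed $N$ and $A$, $\mathfrak e(\cdot,A)$ is lower semicontinuous on $\Omega^N$. $\omega_N^*(A)$ denotes any configuration in $A$ attaining $\mathfrak e(\omega_N^*(A)):=\min\{\mathfrak e(\omega_N,A):\omega_N\subset A\}$. The rate $\mathfrak t$ is a positive measurable function of a positive real variable. If the limit of $\mathfrak t(tu)/\mathfrak t(u)$ exists for $t$ in a set of positive measure then (Karamata) it exists for all $t>0$; $\mathfrak w$ denotes this limit function. Put $$\mathfrak L_{\mathfrak e}(A)=\lim_{N\to\infty}\frac{\mathfrak e(\omega_N^*(A))}{\mathfrak t(N)}$$ for compact $A$, when the limit exists. Set-monotonic: for a fixed constant $\varsigma\ne0$ associated with $\mathfrak e$, and all compact $A\subset B\subset\Omega$, $$\liminf_{N\to\infty}\operatorname{sgn}\varsigma\cdot\frac{\mathfrak e(\omega_N^*(A))}{\mathfrak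 t(N)}\ \ge\ \limsup_{N\to\infty}\operatorname{sgn}\varsigma\cdot\frac{\mathfrak e(\omega_N^*(B))}{\mathfrak t(N)} .$$ Short-range interaction property: for any finite union $\mathbf Q=\bigcup_{m=1}^MQ_m\subset\Omega$ of cubes with disjoint interiors and any compact $A\subset\Omega$, $$\lim_{N\to\infty}\frac{\sum_{m=1}^M\mathfrak e(\omega_N\cap Q_m,A\cap Q_m)}{\mathfrak e(\omega_N\cap\mathbf Q,A\cap\mathbf Q)}=1,$$ where the sequence $\omega_N$ has one of the two forms: (i) $\omega_N=\omega_N^*(A)$; (ii) $\omega_N=\bigcup_m\omega_{N_m}^*(A\cap Q_m)$ with $\sum_mN_m=N$, $N_m\to\infty$; when $\varsigma>0$, in (ii) the cubes $Q_m$ are additionally assumed to be a positive distance apart. Continuity property on cubes: for every $\epsilon\in(0,1)$ there is $\delta(\epsilon)>0$ such that for every cube $Q\subset\Omega$, $$\lim_{N\to\infty}\operatorname{sgn}\varsigma\cdot\frac{\mathfrak e(\omega_N^*(Q))}{\mathfrak t(N)}\ \ge\ \limsup_{N\to\infty}(\operatorname{sgn}\varsigma-\epsilon)\cdot\frac{\mathfrak e(\omega_N^*(D))}{\mathfrak t(N)}$$ whenever the compact $D\subset Q$ satisfies $\lambda_d(D)\ge(1-\delta(\epsilon))\lambda_d(Q)$. Convention: $0^{-\sigma}=+\infty$ if $\sigma>0$ and $0^{-\sigma}=0$ if $\sigma<-1$.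
   Formalization: Short-range property required only if A∩𝐐 (form i) or every A∩Q_m (form ii) has positive measure (for A in a common face of two cubes the quotient is never 1); pieces with fewer than N_0 points count 0; in (ii) ω_N∩Q_m means the component ω*_{N_m}(A∩Q_m). *)

theory Defs
  imports "HOL-Probability.Probability" "HOL-Library.Multiset"
begin

definition unit_cube :: "(real ^ 'd) set" where
  "unit_cube = cbox (\<chi> i. - 1 / 2) (\<chi> i. 1 / 2)"

definition cube :: "real ^ 'd \<Rightarrow> real \<Rightarrow> (real ^ 'd) set" where
  "cube x a = (\<lambda>y. x + a *\<^sub>R y) ` unit_cube"

definition is_cube :: "(real ^ 'd) set \<Rightarrow> bool" where
  "is_cube Q \<longleftrightarrow> (\<exists>x a. a > 0 \<and> Q = cube x a)"

definition strictly_convex_on :: "real set \<Rightarrow> (real \<Rightarrow> real) \<Rightarrow> bool" where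
  "strictly_convex_on S f \<longleftrightarrow> convex S \<and>
     (\<forall>x\<in>S. \<forall>y\<in>S. \<forall>c. x \<noteq> y \<longrightarrow> 0 < c \<longrightarrow> c < 1 \<longrightarrow>
        f ((1 - c) * x + c * y) < (1 - c) * f x + c * f y)"

definition lsc_on :: "'a::topological_space set \<Rightarrow> ('a \<Rightarrow> ereal) \<Rightarrow> bool" where
  "lsc_on S f \<longleftrightarrow> (\<forall>x\<in>S. f x \<le> Liminf (at x within S) f)"

text \<open>A configuration is a multiset of points.  The functional is a total function here, but its
  values matter only for configurations of at least \<open>N0\<close> points of \<open>\<Omega>\<close> and compact subsets
  of \<open>\<Omega>\<close>.\<close>

type_synonym 'd functional = "(real ^ 'd) multiset \<Rightarrow> (real ^ 'd) set \<Rightarrow> ereal"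

definition interaction_functional ::
    "(real ^ 'd) set \<Rightarrow> nat \<Rightarrow> real \<Rightarrow> 'd functional \<Rightarrow> bool" where
  "interaction_functional \<Omega> N0 E0 e \<longleftrightarrow>
     1 \<le> N0 \<and>
     (\<forall>\<omega> A. N0 \<le> size \<omega> \<longrightarrow> set_mset \<omega> \<subseteq> \<Omega> \<longrightarrow> compact A \<longrightarrow> A \<subseteq> \<Omega> \<longrightarrow> ereal E0 \<le> e \<omega> A) \<and>
     ((\<exists>\<omega> A B. N0 \<le> size \<omega> \<and> set_mset \<omega> \<subseteq> \<Omega> \<and> compact A \<and> A \<subseteq> \<Omega> \<and> compact B \<and> B \<subseteq> \<Omega> \<and>
         e \<omega> A \<noteq> e \<omega> B) \<longrightarrow> E0 = 0)"

text \<open>Configurations of \<open>N\<close> points are identified with \<open>N\<close>-tuples up to order; \<open>\<Omega>^N\<close> is the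
  extensional product \<open>PiE {..<N} (\<lambda>_. \<Omega>)\<close> with the subspace topology of the function space,
  which is the product topology.\<close>

definition lower_semicontinuous_functional ::
    "(real ^ 'd) set \<Rightarrow> nat \<Rightarrow> 'd functional \<Rightarrow> bool" where
  "lower_semicontinuous_functional \<Omega> N0 e \<longleftrightarrow>
     (\<forall>N A. N0 \<le> N \<longrightarrow> compact A \<longrightarrow> A \<subseteq> \<Omega> \<longrightarrow>
        lsc_on (PiE {..<N} (\<lambda>_. \<Omega>)) (\<lambda>x. e (image_mset x (mset_set {..<N})) A))"

definition is_minimizer ::
    "'d functional \<Rightarrow> (real ^ 'd) set \<Rightarrow> nat \<Rightarrow> (real ^ 'd) multiset \<Rightarrow> bool" where
  "is_minimizer e A N \<omega> \<longleftrightarrow> size \<omega> = N \<and> set_mset \<omega> \<subseteq> A \<and>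
     (\<forall>\<omega>'. size \<omega>' = N \<longrightarrow> set_mset \<omega>' \<subseteq> A \<longrightarrow> e \<omega> A \<le> e \<omega>' A)"

text \<open>For lower semicontinuous \<open>e\<close>, nonempty compact \<open>A\<close> and \<open>N \<ge> N0\<close> the infimum is a
  minimum.\<close>

definition min_energy :: "'d functional \<Rightarrow> (real ^ 'd) set \<Rightarrow> nat \<Rightarrow> ereal" where
  "min_energy e A N = (INF \<omega>\<in>{\<omega>. size \<omega> = N \<and> set_mset \<omega> \<subseteq> A}. e \<omega> A)"

definition scaled_energy ::
    "'d functional \<Rightarrow> (real \<Rightarrow> real) \<Rightarrow> (real ^ 'd) set \<Rightarrow> nat \<Rightarrow> ereal" where
  "scaled_energy e \<tau> A N = min_energy e A N / ereal (\<tau> (real N))"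

definition energy_limit :: "'d functional \<Rightarrow> (real \<Rightarrow> real) \<Rightarrow> (real ^ 'd) set \<Rightarrow> ereal" where
  "energy_limit e \<tau> A = lim (scaled_energy e \<tau> A)"

definition rate :: "(real \<Rightarrow> real) \<Rightarrow> bool" where
  "rate \<tau> \<longleftrightarrow> (\<forall>u>0. 0 < \<tau> u) \<and> set_borel_measurable lborel {0<..} \<tau>"

text \<open>The limit function of \<open>\<tau>\<close>; unspecified at those \<open>s\<close> where the limit does not exist.\<close>

definition rate_limit :: "(real \<Rightarrow> real) \<Rightarrow> real \<Rightarrow> real" where
  "rate_limit \<tau> s = Lim at_top (\<lambda>u. \<tau> (s * u) / \<tau> u)"

text \<open>The empty set carries no configurations and is excluded.\<close>

definition set_monotonic ::
    "(real ^ 'd) set \<Rightarrow> (real \<Rightarrow> real) \<Rightarrow> real \<Rightarrow> 'd functional \<Rightarrow> bool" where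
  "set_monotonic \<Omega> \<tau> \<zeta> e \<longleftrightarrow>
     (\<forall>A B. compact A \<longrightarrow> compact B \<longrightarrow> A \<noteq> {} \<longrightarrow> A \<subseteq> B \<longrightarrow> B \<subseteq> \<Omega> \<longrightarrow>
        limsup (\<lambda>N. ereal (sgn \<zeta>) * scaled_energy e \<tau> B N)
          \<le> liminf (\<lambda>N. ereal (sgn \<zeta>) * scaled_energy e \<tau> A N))"

text \<open>A piece of a configuration may have fewer than \<open>N0\<close> points (for instance when \<open>A \<inter> Q\<close> is
  empty), so that \<open>e\<close> has no value on it; such a piece contributes nothing.\<close>

definition energy0 ::
    "nat \<Rightarrow> 'd functional \<Rightarrow> (real ^ 'd) multiset \<Rightarrow> (real ^ 'd) set \<Rightarrow> ereal" where
  "energy0 N0 e \<omega> A = (if N0 \<le> size \<omega> then e \<omega> A else 0)"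

text \<open>In the quotients below the extended-real conventions make \<open>0 / 0\<close>, \<open>\<infinity> / \<infinity>\<close> and \<open>x / 0\<close>
  different from \<open>1\<close>.  Convergence to \<open>1\<close> therefore entails that the denominator is finite and
  nonzero for large \<open>N\<close>, and in particular that the configuration in it has at least \<open>N0\<close> points.

  Where \<open>A\<close> is Lebesgue null the quotient is typically \<open>0 / 0\<close> (quantization error) or
  \<open>\<infinity> / \<infinity>\<close> (hypersingular Riesz energy of a finite set), and for \<open>A\<close> inside the common face of two
  cubes every point is counted twice.  The property is therefore required when \<open>A \<inter> \<Union>QQ\<close>
  in the first form, and each of the sets \<open>A \<inter> Q\<close> in the second form, has positive measure.

  In the second form the part of the configuration belonging to \<open>Q\<close> is the minimizer \<open>\<eta> Q N\<close>
  on \<open>A \<inter> Q\<close>: a point on a face shared with another cube belongs to the cube it was placed in.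
  If the cubes are pairwise disjoint this part is the restriction of the configuration to \<open>Q\<close>.\<close>

definition short_range ::
    "(real ^ 'd) set \<Rightarrow> nat \<Rightarrow> real \<Rightarrow> 'd functional \<Rightarrow> bool" where
  "short_range \<Omega> N0 \<zeta> e \<longleftrightarrow>
     (\<forall>QQ A. finite QQ \<longrightarrow> QQ \<noteq> {} \<longrightarrow> (\<forall>Q\<in>QQ. is_cube Q) \<longrightarrow> \<Union>QQ \<subseteq> \<Omega> \<longrightarrow>
        pairwise (\<lambda>P Q. interior P \<inter> interior Q = {}) QQ \<longrightarrow> compact A \<longrightarrow> A \<subseteq> \<Omega> \<longrightarrow>
        (0 < measure lborel (A \<inter> \<Union>QQ) \<longrightarrow>
           (\<forall>\<omega>. (\<forall>\<^sub>F N in sequentially. is_minimizer e A N (\<omega> N)) \<longrightarrow>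
              (\<lambda>N. (\<Sum>Q\<in>QQ. energy0 N0 e (filter_mset (\<lambda>x. x \<in> Q) (\<omega> N)) (A \<inter> Q)) /
                   energy0 N0 e (filter_mset (\<lambda>x. x \<in> \<Union>QQ) (\<omega> N)) (A \<inter> \<Union>QQ))
              \<longlonglongrightarrow> 1)) \<and>
        ((\<forall>Q\<in>QQ. 0 < measure lborel (A \<inter> Q)) \<longrightarrow>
         (0 < \<zeta> \<longrightarrow> pairwise (\<lambda>P Q. 0 < setdist P Q) QQ) \<longrightarrow>
           (\<forall>n \<eta>. (\<forall>Q\<in>QQ. filterlim (n Q) at_top sequentially) \<longrightarrow>
              (\<forall>\<^sub>F N in sequentially. (\<Sum>Q\<in>QQ. n Q N) = N) \<longrightarrow>
              (\<forall>\<^sub>F N in sequentially. \<forall>Q\<in>QQ. is_minimizer e (A \<inter> Q) (n Q N) (\<eta> Q N)) \<longrightarrow>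
              (\<lambda>N. (\<Sum>Q\<in>QQ. energy0 N0 e (\<eta> Q N) (A \<inter> Q)) /
                   energy0 N0 e (\<Sum>Q\<in>QQ. \<eta> Q N) (A \<inter> \<Union>QQ))
              \<longlonglongrightarrow> 1)))"

definition continuity_on_cubes ::
    "(real ^ 'd) set \<Rightarrow> (real \<Rightarrow> real) \<Rightarrow> real \<Rightarrow> 'd functional \<Rightarrow> bool" where
  "continuity_on_cubes \<Omega> \<tau> \<zeta> e \<longleftrightarrow>
     (\<forall>\<epsilon>. 0 < \<epsilon> \<longrightarrow> \<epsilon> < 1 \<longrightarrow>
        (\<exists>\<delta>>0. \<forall>Q D. is_cube Q \<longrightarrow> Q \<subseteq> \<Omega> \<longrightarrow> compact D \<longrightarrow> D \<subseteq> Q \<longrightarrow>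
           (1 - \<delta>) * measure lborel Q \<le> measure lborel D \<longrightarrow>
           convergent (\<lambda>N. ereal (sgn \<zeta>) * scaled_energy e \<tau> Q N) \<and>
           limsup (\<lambda>N. ereal (sgn \<zeta> - \<epsilon>) * scaled_energy e \<tau> D N)
             \<le> lim (\<lambda>N. ereal (sgn \<zeta>) * scaled_energy e \<tau> Q N)))"

text \<open>\<open>v powr (- \<sigma>)\<close> with the conventions that \<open>0\<close> to the power \<open>- \<sigma>\<close> is \<open>\<infinity>\<close> for
  \<open>\<sigma> > 0\<close> and \<open>0\<close> for \<open>\<sigma> < -1\<close>.\<close>

definition neg_powr :: "real \<Rightarrow> real \<Rightarrow> ereal" where
  "neg_powr v \<sigma> = (if v = 0 then (if 0 < \<sigma> then \<infinity> else 0) else ereal (v powr (- \<sigma>)))"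

text \<open>Weak* convergence as functionals on the continuous functions on the compact set \<open>A\<close>.\<close>

definition weak_star_conv_on ::
    "'a::topological_space set \<Rightarrow> (nat \<Rightarrow> 'a measure) \<Rightarrow> 'a measure \<Rightarrow> bool" where
  "weak_star_conv_on A M \<mu> \<longleftrightarrow>
     (\<forall>f :: 'a \<Rightarrow> real. continuous_on A f \<longrightarrow>
        (\<lambda>N. set_lebesgue_integral (M N) A f) \<longlonglongrightarrow> set_lebesgue_integral \<mu> A f)"

end

theory Submission
  imports Defs
begin

text \<open>
  Write \<open>p = 1 + \<sigma>\<close>.  Strict convexity makes \<open>\<tau>\<close> regularly varying of index \<open>p < 0\<close> or \<open>p > 1\<close>.
  Suppose a minimizer puts the fraction \<open>\<beta> i\<close> of its points into the \<open>i\<close>-th of several pieces, whose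
  limit energies are \<open>l i\<close>.  By the short-range property its energy, relative to \<open>\<tau> N\<close>, is about
  \<open>\<Sum>i. l i * \<beta> i powr p\<close>, and for \<open>M\<close> equal cubes convexity gives \<open>M powr (1 - p) * l\<close>.  A point
  on a common face is counted several times, so \<open>\<Sum>i. \<beta> i \<ge> 1\<close> in general; this does no harm if
  \<open>p > 1\<close>, and if \<open>p < 0\<close> the pieces are taken disjoint.

  A compact set is covered by the cells of a fine grid, and most of it is filled by slightly shrunk
  cells in which it has nearly full density.  Set monotonicity and the continuity property then bound
  its energy from both sides by its measure to the power \<open>- \<sigma>\<close> times the energy density of small
  cubes.  Comparison with the unit cube identifies this density.  Inserting the resulting energies
  into the lower bound for two pieces, a neighbourhood of a compact set \<open>K\<close> and the rest, the
  equality case of convexity forces the minimizers to put the right mass near \<open>K\<close>.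
\<close>

section \<open>Regularly varying rates\<close>

text \<open>The fractions of points that a minimizer puts into given pieces vary with
  \<open>N\<close> and need not converge. Near the fraction \<open>0\<close> the convergence of
  \<open>\<tau> (y * u) / \<tau> u\<close> to \<open>y powr p\<close> need not be uniform, and for
  \<open>p < 0\<close> the power itself blows up there. Every lower bound is therefore run with a
  tangent of the power in place of the power. A tangent is bounded and Lipschitz on the unit
  interval, and monotonicity of \<open>\<tau>\<close> makes the resulting inequality uniform in the
  fraction.

  The point of tangency remains free. With tangents taken at the expected fractions, the sum is
  affine and depends on the actual fractions only through their total; this gives the optimal energy
  without knowing how the points are distributed. With one tangent moved to \<open>c\<close> times
  the expected fraction, where \<open>c < 1\<close>, any minimizer with fewer points than that would
  exceed the optimal energy by a fixed amount, the gap \<open>c powr p - 1 - p * (c - 1)\<close> of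
  strict convexity. This gives a lower bound for the mass near each compact set, and since all
  measures have total mass \<open>1\<close>, lower bounds suffice for convergence.\<close>

definition powr_tangent :: "real \<Rightarrow> real \<Rightarrow> real \<Rightarrow> real" where
  "powr_tangent p x y = x powr p + p * x powr (p - 1) * (y - x)"

lemma powr_tangent_le:
  fixes p x y :: real
  assumes "p < 0 \<or> 1 < p" "0 < x" "0 < y"
  shows "powr_tangent p x y \<le> y powr p"
proof -
  have "convex_on {0<..} (\<lambda>y::real. y powr p)"
  proof (rule f''_ge0_imp_convex)
    show "((\<lambda>y. y powr p) has_real_derivative p * z powr (p - 1)) (at z)"
      if "z \<in> {0<..}" for z :: real
      using that by (intro has_real_derivative_powr) auto
    show "((\<lambda>y. p * y powr (p - 1)) has_real_derivative p * (p - 1) * z powr (p - 2)) (at z)"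
      if "z \<in> {0<..}" for z :: real
      using that by (auto intro!: DERIV_cmult_Id derivative_eq_intros
          DERIV_cong[OF DERIV_cmult[OF has_real_derivative_powr[of z "p - 1"]]] simp: mult.assoc)
    show "0 \<le> p * (p - 1) * z powr (p - 2)" for z :: real
      using assms(1) by (intro mult_nonneg_nonneg[of "p * (p - 1)"]) (auto simp: zero_le_mult_iff)
  qed auto
  moreover have "((\<lambda>y. y powr p) has_real_derivative p * x powr (p - 1)) (at x)"
    using assms by (intro has_real_derivative_powr) auto
  ultimately have "p * x powr (p - 1) * (y - x) \<le> y powr p - x powr p"
    using assms by (intro convex_on_imp_above_tangent[where A = "{0<..}"])
      (auto simp: interior_open intro: has_field_derivative_at_within)
  then show ?thesis by (simp add: powr_tangent_def)
qed

text \<open>The bound holds for all fractions at once, so that a relative error in an energy can be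
  charged as an additive multiple of the rate.\<close>

lemma powr_tangent_bounded:
  assumes "0 < x"
  obtains B where "0 < B" "\<And>y. 0 \<le> y \<Longrightarrow> y \<le> 1 \<Longrightarrow> \<bar>powr_tangent p x y\<bar> \<le> B"
proof
  show "0 < x powr p + \<bar>p * x powr (p - 1)\<bar> * (1 + x)"
    using assms by (intro add_pos_nonneg) auto
  show "\<bar>powr_tangent p x y\<bar> \<le> x powr p + \<bar>p * x powr (p - 1)\<bar> * (1 + x)"
    if "0 \<le> y" "y \<le> 1" for y
  proof -
    have "\<bar>p * x powr (p - 1) * (y - x)\<bar> \<le> \<bar>p * x powr (p - 1)\<bar> * (1 + x)"
      unfolding abs_mult[of _ "y - x"] using that assms by (intro mult_left_mono) auto
    then show ?thesis unfolding powr_tangent_def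
      using powr_ge_zero[of x p] by linarith
  qed
qed

text \<open>The limit is used only at finitely many mesh points \<open>j / J\<close>. From any other
  \<open>y\<close> one moves to a neighbouring mesh point: the tangent changes little because it is
  Lipschitz, and the rate changes in the favourable direction if the neighbour is chosen on the side
  where \<open>\<tau>\<close> is smaller.\<close>

lemma mono_rate_above_tangent:
  fixes \<tau> :: "real \<Rightarrow> real"
  assumes pos: "\<And>u. 0 < u \<Longrightarrow> 0 < \<tau> u"
    and lim: "\<And>s. 0 < s \<Longrightarrow> ((\<lambda>u. \<tau> (s * u) / \<tau> u) \<longlongrightarrow> s powr p) at_top"
    and mono: "(p < 0 \<and> antimono_on {0<..} \<tau>) \<or> (1 < p \<and> mono_on {0<..} \<tau>)"
    and x: "0 < x" and "0 < \<epsilon>"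
  shows "\<forall>\<^sub>F u in at_top. \<forall>y\<in>{0<..1}. powr_tangent p x y - \<epsilon> \<le> \<tau> (y * u) / \<tau> u"
proof -
  have p: "p < 0 \<or> 1 < p" using mono by blast
  define sl where "sl = \<bar>p * x powr (p - 1)\<bar>"
  \<comment> \<open>The mesh is so fine that the tangent, whose slope has absolute value
    \<open>sl\<close>, changes by at most \<open>\<epsilon> / 2\<close> between neighbours; the
    other half pays for the convergence at the mesh points.\<close>
  obtain J0 :: nat where J0: "sl / (\<epsilon>/2) < real J0" using reals_Archimedean2 by blast
  define J where "J = Suc J0"
  have J: "0 < real J" "sl / real J \<le> \<epsilon> / 2"
    using J0 \<open>0 < \<epsilon>\<close> by (auto simp: J_def field_simps)
  have lip: "\<bar>powr_tangent p x y - powr_tangent p x z\<bar> \<le> \<epsilon>/2" if "\<bar>y - z\<bar> \<le> 1 / real J" for y z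
  proof -
    have "\<bar>powr_tangent p x y - powr_tangent p x z\<bar> = sl * \<bar>y - z\<bar>"
      unfolding powr_tangent_def sl_def abs_mult[symmetric] by (simp add: algebra_simps)
    also have "\<dots> \<le> sl * (1 / real J)" using that by (intro mult_left_mono) (auto simp: sl_def)
    also have "\<dots> \<le> \<epsilon>/2" using J by simp
    finally show ?thesis .
  qed
  have "\<forall>\<^sub>F u in at_top. \<forall>j\<in>{1..J}. real j / real J > 0 \<longrightarrow>
      dist (\<tau> (real j / real J * u) / \<tau> u) ((real j / real J) powr p) < \<epsilon> / 2"
  proof (intro eventually_ball_finite ballI)
    fix j assume "j \<in> {1..J}"
    then have "0 < real j / real J" using J by simp
    from tendstoD[OF lim[OF this], of "\<epsilon>/2"] \<open>0 < \<epsilon>\<close>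
    show "\<forall>\<^sub>F u in at_top. real j / real J > 0 \<longrightarrow>
      dist (\<tau> (real j / real J * u) / \<tau> u) ((real j / real J) powr p) < \<epsilon> / 2"
      by (auto elim: eventually_mono)
  qed auto
  then show ?thesis using eventually_gt_at_top[of 0]
  proof eventually_elim
    case (elim u)
    show ?case
    proof
      fix y :: real assume y: "y \<in> {0<..1}"
      have tu: "0 < \<tau> u" "0 < \<tau> (y * u)" using pos elim y by auto
      have main: "powr_tangent p x y - \<epsilon> \<le> \<tau> (y * u) / \<tau> u"
        if j: "j \<in> {1..J}" "\<bar>y - real j / real J\<bar> \<le> 1 / real J"
          and le: "\<tau> (real j / real J * u) \<le> \<tau> (y * u)" for j
      proof -
        have jp: "0 < real j / real J" using j J by simp
        have "powr_tangent p x y \<le> powr_tangent p x (real j / real J) + \<epsilon>/2"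
          using lip[OF j(2)] by linarith
        also have "\<dots> \<le> (real j / real J) powr p + \<epsilon>/2"
          using powr_tangent_le[OF p x jp] by simp
        also have "\<dots> \<le> \<tau> (real j / real J * u) / \<tau> u + \<epsilon>/2 + \<epsilon>/2"
        proof -
          have "dist (\<tau> (real j / real J * u) / \<tau> u) ((real j / real J) powr p) < \<epsilon> / 2"
            using elim j jp by blast
          then show ?thesis unfolding dist_real_def by linarith
        qed
        also have "\<dots> \<le> \<tau> (y * u) / \<tau> u + \<epsilon>" using le tu by (simp add: divide_right_mono)
        finally show ?thesis by simp
      qed
      show "powr_tangent p x y - \<epsilon> \<le> \<tau> (y * u) / \<tau> u"
      proof (cases "p < 0")
        case True
        \<comment> \<open>Here \<open>\<tau>\<close> decreases, so the mesh point must not lie below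
          \<open>y\<close>; rounding up also keeps it away from \<open>0\<close>.\<close>
        define j where "j = nat \<lceil>y * J\<rceil>"
        have jr: "real j = of_int \<lceil>y * J\<rceil>" using y J by (simp add: j_def)
        have b: "y * J \<le> real j" "real j < y * J + 1" unfolding jr by linarith+
        have "y * J \<le> J" using y J by simp
        then have "\<lceil>y * J\<rceil> \<le> int J" by (simp add: ceiling_le_iff)
        then have j: "j \<in> {1..J}" using b y J unfolding j_def
          by (auto simp: Suc_le_eq)
        have "\<bar>y - real j / real J\<bar> = \<bar>y * J - real j\<bar> / real J"
          using J by (simp add: abs_div_pos diff_divide_distrib del: abs_divide)
        also have "\<dots> \<le> 1 / real J" using b J by (intro divide_right_mono) auto
        finally have "\<bar>y - real j / real J\<bar> \<le> 1 / real J" .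
        moreover have "y * u \<le> real j / real J * u" using b J elim by (auto simp: field_simps)
        then have "\<tau> (real j / real J * u) \<le> \<tau> (y * u)"
          using mono True y elim j J by (auto simp: monotone_on_def)
        ultimately show ?thesis using main[OF j] by blast
      next
        case False
        then have p1: "1 < p" "mono_on {0<..} \<tau>" using mono by auto
        define j where "j = nat \<lfloor>y * J\<rfloor>"
        have jr: "real j = of_int \<lfloor>y * J\<rfloor>" using y J by (simp add: j_def)
        have b: "real j \<le> y * J" "y * J < real j + 1" unfolding jr by linarith+
        have "\<bar>y - real j / real J\<bar> = \<bar>y * J - real j\<bar> / real J"
          using J by (simp add: abs_div_pos diff_divide_distrib del: abs_divide)
        also have "\<dots> \<le> 1 / real J" using b J by (intro divide_right_mono) auto
        finally have d: "\<bar>y - real j / real J\<bar> \<le> 1 / real J" .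
        show ?thesis
        \<comment> \<open>Rounding down, which an increasing \<open>\<tau>\<close> calls for, may
          end at \<open>0\<close>, where no limit is available. The tangent is nonpositive there
          because \<open>p > 1\<close>, and positivity of \<open>\<tau>\<close> finishes this
          case.\<close>
        proof (cases "j = 0")
          case True
          have "powr_tangent p x 0 = (1 - p) * x powr p" using x
            by (simp add: powr_tangent_def powr_diff field_simps)
          also have "\<dots> \<le> 0" using p1 by (simp add: mult_nonpos_nonneg)
          finally have "powr_tangent p x 0 \<le> 0" .
          moreover have "\<bar>powr_tangent p x y - powr_tangent p x 0\<bar> \<le> \<epsilon>/2"
            using d True by (intro lip) simp
          ultimately have "powr_tangent p x y \<le> \<epsilon>/2" by linarith
          then have "powr_tangent p x y - \<epsilon> \<le> 0" using \<open>0 < \<epsilon>\<close> by simp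
          also have "0 \<le> \<tau> (y * u) / \<tau> u" using tu by simp
          finally show ?thesis .
        next
          case False
          have "real j \<le> J" using b y J by (meson greaterThanAtMost_iff mult_left_le_one_le nless_le order_trans)
          then have j: "j \<in> {1..J}" using False by auto
          have "real j / real J * u \<le> y * u" using b J elim by (auto simp: field_simps)
          then have "\<tau> (real j / real J * u) \<le> \<tau> (y * u)"
            using p1 y elim j J by (auto simp: monotone_on_def)
          then show ?thesis using main[OF j d] by blast
        qed
      qed
    qed
  qed
qed

section \<open>Existence and shape of the limit function of the rate\<close>

lemma strictly_convex_onD:
  assumes "strictly_convex_on S f" "x \<in> S" "y \<in> S" "x \<noteq> y" "0 < c" "c < 1"
  shows "f ((1 - c) * x + c * y) < (1 - c) * f x + c * f y"
  using assms unfolding strictly_convex_on_def by blast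

lemma strictly_convex_on_midpoint:
  assumes "strictly_convex_on S f" "x \<in> S" "y \<in> S" "x \<noteq> y"
  shows "f ((x + y) / 2) < (f x + f y) / 2"
proof -
  have "(1 - 1/2) * x + 1/2 * y = (x + y) / 2" by (simp add: field_simps)
  with strictly_convex_onD[OF assms, of "1/2"] show ?thesis by (simp add: field_simps)
qed

text \<open>Of three points on one level, the middle one would lie strictly below that
  level.\<close>

lemma strictly_convex_level_finite:
  assumes "strictly_convex_on S f"
  shows "finite {s\<in>S. f s = c}"
proof (rule ccontr)
  assume inf: "infinite {s\<in>S. f s = c}"
  obtain T where T: "T \<subseteq> {s\<in>S. f s = c}" "card T = 3" "finite T"
    using infinite_arbitrarily_large[OF inf, of 3] by auto
  then obtain x y z where xyz: "T = {x, y, z}" "x < y" "y < z"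
  proof -
    have "sorted_list_of_set T \<noteq> []" using T by auto
    obtain l where l: "sorted_list_of_set T = l" by blast
    have "length l = 3" "sorted_wrt (<) l" "set l = T" using T l by auto
    then obtain x y z where "l = [x, y, z]" by (auto simp: length_Suc_conv numeral_3_eq_3)
    with \<open>sorted_wrt (<) l\<close> \<open>set l = T\<close> that[of x y z] show thesis by auto
  qed
  define k where "k = (y - x) / (z - x)"
  have k: "0 < k" "k < 1" using xyz by (auto simp: k_def)
  have "k * (z - x) = y - x" using xyz by (simp add: k_def)
  then have "y = (1 - k) * x + k * z" by (simp add: algebra_simps)
  moreover have "f ((1 - k) * x + k * z) < (1 - k) * f x + k * f z"
    using T xyz k by (intro strictly_convex_onD[OF assms]) auto
  moreover have "f x = c" "f y = c" "f z = c" using T xyz by auto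
  ultimately have "c < (1 - k) * c + k * c" by simp
  then show False by (simp add: algebra_simps)
qed

lemma rate_limit_eq:
  assumes "((\<lambda>u. \<tau> (s * u) / \<tau> u) \<longlongrightarrow> l) at_top"
  shows "rate_limit \<tau> s = l"
  using assms unfolding rate_limit_def by (intro tendsto_Lim) auto

text \<open>Where the limit does not exist, \<^const>\<open>rate_limit\<close> has the constant junk value
  \<open>THE l. False\<close>, so a strictly convex \<^const>\<open>rate_limit\<close> leaves room for at most two such points
  and at most two zeros. The remaining points form a multiplicative subgroup of the positive reals,
  whose complement, being a union of cosets, is empty as soon as it is finite.\<close>

lemma strictly_convex_rate_limit_exists:
  assumes pos: "\<And>u. 0 < u \<Longrightarrow> 0 < \<tau> u"
    and conv: "strictly_convex_on {0<..} (rate_limit \<tau>)" and "0 < s"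
  shows "\<exists>l>0. ((\<lambda>u. \<tau> (s * u) / \<tau> u) \<longlongrightarrow> l) at_top"
proof -
  define G where "G = {s. 0 < s \<and> (\<exists>l>0. ((\<lambda>u. \<tau> (s * u) / \<tau> u) \<longlongrightarrow> l) at_top)}"
  have nonex: "rate_limit \<tau> s = (THE l::real. False)"
    if "\<nexists>l. ((\<lambda>u. \<tau> (s * u) / \<tau> u) \<longlongrightarrow> l) at_top" for s
    using that unfolding rate_limit_def Topological_Spaces.Lim_def by simp
  have "{0<..} - G \<subseteq> {s\<in>{0<..}. rate_limit \<tau> s = (THE l. False)} \<union> {s\<in>{0<..}. rate_limit \<tau> s = 0}"
  proof
    fix s assume s: "s \<in> {0<..} - G"
    show "s \<in> {s\<in>{0<..}. rate_limit \<tau> s = (THE l. False)} \<union> {s\<in>{0<..}. rate_limit \<tau> s = 0}"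
    proof (cases "\<exists>l. ((\<lambda>u. \<tau> (s * u) / \<tau> u) \<longlongrightarrow> l) at_top")
      case True
      then obtain l where l: "((\<lambda>u. \<tau> (s * u) / \<tau> u) \<longlongrightarrow> l) at_top" by blast
      have "\<forall>\<^sub>F u in at_top. 0 \<le> \<tau> (s * u) / \<tau> u"
        using eventually_gt_at_top[of 0] by eventually_elim (use s pos in \<open>simp add: less_imp_le\<close>)
      with l have "0 \<le> l" by (rule tendsto_lowerbound) auto
      moreover have "\<not> 0 < l" using l s by (auto simp: G_def)
      ultimately have "l = 0" by simp
      with rate_limit_eq[OF l] s show ?thesis by auto
    qed (use nonex s in auto)
  qed
  then have fin: "finite ({0<..} - G)"
    using strictly_convex_level_finite[OF conv] by (meson finite_Un finite_subset)
  have inv: "inverse t \<in> G" if "t \<in> G" for t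
  proof -
    from that obtain l where l: "l > 0" "((\<lambda>u. \<tau> (t * u) / \<tau> u) \<longlongrightarrow> l) at_top" and t: "0 < t"
      by (auto simp: G_def)
    have "filterlim (\<lambda>u. inverse t * u) at_top at_top"
      using t by (intro filterlim_tendsto_pos_mult_at_top[where c = "inverse t"] filterlim_ident) auto
    from tendsto_inverse[OF filterlim_compose[OF l(2) this]] l t
    have "((\<lambda>u. \<tau> (inverse t * u) / \<tau> u) \<longlongrightarrow> inverse l) at_top"
      by (simp add: field_simps)
    then show ?thesis using t l by (auto simp: G_def intro!: exI[of _ "inverse l"])
  qed
  have mult: "t * s \<in> G" if "t \<in> G" "s \<in> G" for t s
  proof -
    from that obtain l m where l: "l > 0" "((\<lambda>u. \<tau> (t * u) / \<tau> u) \<longlongrightarrow> l) at_top" and t: "0 < t"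
      and m: "m > 0" "((\<lambda>u. \<tau> (s * u) / \<tau> u) \<longlongrightarrow> m) at_top" and s: "0 < s"
      by (auto simp: G_def)
    have "filterlim (\<lambda>u. s * u) at_top at_top"
      using s by (intro filterlim_tendsto_pos_mult_at_top[where c = s] filterlim_ident) auto
    from tendsto_mult[OF filterlim_compose[OF l(2) this] m(2)]
    have "((\<lambda>u. \<tau> (t * (s * u)) / \<tau> (s * u) * (\<tau> (s * u) / \<tau> u)) \<longlongrightarrow> l * m) at_top" .
    moreover have "\<forall>\<^sub>F u in at_top. \<tau> (t * (s * u)) / \<tau> (s * u) * (\<tau> (s * u) / \<tau> u) = \<tau> (t * s * u) / \<tau> u"
      using eventually_gt_at_top[of 0]
    proof eventually_elim
      case (elim u)
      then have "\<tau> (s * u) \<noteq> 0" using pos[of "s * u"] s by simp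
      then show ?case by (simp add: mult.assoc)
    qed
    ultimately have "((\<lambda>u. \<tau> (t * s * u) / \<tau> u) \<longlongrightarrow> l * m) at_top"
      by (rule Lim_transform_eventually)
    then show ?thesis using t s l m by (auto simp: G_def intro!: exI[of _ "l * m"])
  qed
  have "s \<in> G"
  proof (rule ccontr)
    assume "s \<notin> G"
    have "infinite G"
    proof
      assume "finite G"
      then have "finite (G \<union> ({0<..} - G))" using fin by blast
      moreover have "G \<union> ({0<..} - G) = {0<..}" by (auto simp: G_def)
      ultimately show False using infinite_Ioi[of "0::real"] by simp
    qed
    moreover have "inj_on (\<lambda>t. t * s) G" using \<open>0 < s\<close> by (auto simp: inj_on_def)
    moreover have "(\<lambda>t. t * s) ` G \<subseteq> {0<..} - G"
    proof safe
      fix t assume "t \<in> G"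
      show "0 < t * s" using \<open>t \<in> G\<close> \<open>0 < s\<close> by (auto simp: G_def)
      assume "t * s \<in> G"
      with mult[OF inv[OF \<open>t \<in> G\<close>]] have "inverse t * (t * s) \<in> G" by blast
      moreover have "inverse t * (t * s) = s" using \<open>t \<in> G\<close> by (auto simp: G_def)
      ultimately show False using \<open>s \<notin> G\<close> by simp
    qed
    ultimately show False using fin finite_subset finite_imageD by metis
  qed
  then show ?thesis by (auto simp: G_def)
qed

text \<open>Each \<open>s ^ n\<close> lies between two consecutive integer powers of
  \<open>2\<close>, on which multiplicativity determines \<open>w\<close>. Monotonicity then pins
  \<open>log 2 (w s)\<close> to \<open>p * log 2 s\<close> up to an error \<open>p / n\<close>, for
  every \<open>n\<close>. A decreasing \<open>w\<close> is reduced to this case by taking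
  reciprocals.\<close>

lemma monotone_multiplicative_imp_powr:
  fixes w :: "real \<Rightarrow> real"
  assumes pos: "\<And>s. 0 < s \<Longrightarrow> 0 < w s"
    and mult: "\<And>s t. 0 < s \<Longrightarrow> 0 < t \<Longrightarrow> w (s * t) = w s * w t"
    and mono: "mono_on {0<..} w \<or> antimono_on {0<..} w"
  obtains p where "\<And>s. 0 < s \<Longrightarrow> w s = s powr p"
proof -
  have *: "\<exists>p. \<forall>s>0. w s = s powr p"
    if pos: "\<And>s. 0 < s \<Longrightarrow> 0 < w s"
    and mult: "\<And>s t. 0 < s \<Longrightarrow> 0 < t \<Longrightarrow> w (s * t) = w s * w t"
    and mono: "mono_on {0<..} w" for w :: "real \<Rightarrow> real"
  proof -
    have one: "w 1 = 1" using mult[of 1 1] pos[of 1] by simp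
    have pow: "w (s ^ n) = w s ^ n" if "0 < s" for s n
      using that by (induction n) (auto simp: one mult)
    define p where "p = log 2 (w 2)"
    have w2: "w 2 = 2 powr p" using pos[of 2] by (simp add: p_def)
    have "1 \<le> w 2" using monotone_onD[OF mono, of 1 2] one by simp
    then have p0: "0 \<le> p" by (simp add: p_def)
    have inv: "w (inverse s) = inverse (w s)" if "0 < s" for s
      using mult[of s "inverse s"] that one pos[of s] by (simp add: field_simps)
    have wpi: "w (2 powr of_int m) = 2 powr (p * of_int m)" for m :: int
    proof (cases "0 \<le> m")
      case True
      then have "w (2 powr of_int m) = w (2 ^ nat m)" by (simp add: powr_real_of_int)
      also have "\<dots> = (2 powr p) ^ nat m" by (simp add: pow w2)
      finally show ?thesis using True by (simp add: powr_powr powr_realpow[symmetric])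
    next
      case False
      then have "w (2 powr of_int m) = inverse (w (2 ^ nat (- m)))" by (simp add: powr_real_of_int inv)
      also have "\<dots> = inverse ((2 powr p) ^ nat (- m))" by (simp add: pow w2)
      finally show ?thesis using False by (simp add: powr_powr powr_realpow[symmetric] powr_minus[symmetric])
    qed
    have "w s = s powr p" if s: "0 < s" for s
    proof -
      have bd: "\<bar>log 2 (w s) - p * log 2 s\<bar> \<le> p / real n" if n: "0 < n" for n :: nat
      proof -
        define m where "m = \<lfloor>real n * log 2 s\<rfloor>"
        have m: "of_int m \<le> real n * log 2 s" "real n * log 2 s \<le> of_int (m + 1)"
          unfolding m_def by linarith+
        have sn: "s ^ n = 2 powr (real n * log 2 s)"
          using s by (simp add: powr_powr[symmetric] mult.commute[of "real n"] powr_realpow[symmetric])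
        have "w (2 powr of_int m) \<le> w (s ^ n)" "w (s ^ n) \<le> w (2 powr of_int (m + 1))"
          using mono m s unfolding sn by (auto simp: monotone_on_def)
        then have "2 powr (p * of_int m) \<le> w s ^ n" "w s ^ n \<le> 2 powr (p * of_int (m + 1))"
          unfolding wpi pow[OF s] by auto
        then have "p * of_int m \<le> log 2 (w s ^ n)" "log 2 (w s ^ n) \<le> p * of_int (m + 1)"
          using pos[OF s] by (simp_all add: le_log_iff log_le_iff)
        then have le: "p * of_int m \<le> real n * log 2 (w s)" "real n * log 2 (w s) \<le> p * of_int (m + 1)"
          using pos[OF s] by (simp_all add: log_nat_power)
        have "p * of_int m \<le> p * (real n * log 2 s)" "p * (real n * log 2 s) \<le> p * of_int (m + 1)"
          using m p0 by (auto intro!: mult_left_mono)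
        with le have "\<bar>real n * log 2 (w s) - p * (real n * log 2 s)\<bar> \<le> p"
          by (simp add: algebra_simps abs_le_iff)
        then have "real n * \<bar>log 2 (w s) - p * log 2 s\<bar> \<le> p"
          by (simp add: abs_mult[of "real n", symmetric, simplified] algebra_simps)
        then show ?thesis using n by (simp add: field_simps)
      qed
      have "(\<lambda>n. p / real n) \<longlonglongrightarrow> 0" by (rule lim_const_over_n)
      then have "\<bar>log 2 (w s) - p * log 2 s\<bar> \<le> 0"
        by (rule tendsto_lowerbound) (auto intro!: eventually_sequentiallyI[of 1] bd)
      then have "2 powr (log 2 (w s)) = 2 powr (p * log 2 s)" by simp
      then have "w s = 2 powr (p * log 2 s)" using pos[OF s] by simp
      also have "\<dots> = s powr p" using s by (simp add: powr_powr[symmetric] mult.commute[of p])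
      finally show ?thesis .
    qed
    then show ?thesis by blast
  qed
  show thesis
  proof (cases "mono_on {0<..} w")
    case True
    from *[of w, OF pos mult True] that show thesis by blast
  next
    case False
    then have "mono_on {0<..} (\<lambda>s. inverse (w s))"
      using mono pos by (auto simp: monotone_on_def)
    from *[of "\<lambda>s. inverse (w s)", OF _ _ this] obtain p where "\<forall>s>0. inverse (w s) = s powr p"
      using pos mult by auto
    then have "w s = s powr (- p)" if "0 < s" for s
      using that by (metis inverse_inverse_eq powr_minus)
    then show thesis using that by blast
  qed
qed

text \<open>Midpoints refute the exponents in the unit interval: the points \<open>1\<close> and
  \<open>3\<close> do so for \<open>p = 0\<close> and \<open>p = 1\<close>, and two points placed
  symmetrically about \<open>1\<close> for the exponents in between.\<close>

lemma strictly_convex_powr_exponent: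
  assumes conv: "strictly_convex_on {0<..} f" and f: "\<And>s. 0 < s \<Longrightarrow> f s = s powr p"
  shows "p < 0 \<or> 1 < p"
proof (rule ccontr)
  assume "\<not> (p < 0 \<or> 1 < p)"
  then have p: "0 \<le> p" "p \<le> 1" by auto
  have mid: "((a + b) / 2) powr p < (a powr p + b powr p) / 2" if "0 < a" "0 < b" "a \<noteq> b" for a b
    using strictly_convex_on_midpoint[OF conv, of a b] that by (simp add: f)
  show False
  proof (cases "p = 0 \<or> p = 1")
    case True
    then show False using mid[of 1 3] by auto
  next
    case False
    then have p: "0 < p" "p < 1" using p by auto
    have "2 powr p < 2 powr 1" using p by (intro powr_less_mono) auto
    then have lt: "2 powr p < (2::real)" by simp
    \<comment> \<open>This \<open>y\<close> solves \<open>y powr p + 2 powr p = 2\<close>. Enlarging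
      \<open>2 - y\<close> to \<open>2\<close> thus makes the mean of the two values exactly
      \<open>1\<close>, which is the value at the midpoint of \<open>y\<close> and
      \<open>2 - y\<close>.\<close>
    define y where "y = (2 - 2 powr p) powr (1 / p)"
    have yp: "y powr p = 2 - 2 powr p" using p lt by (simp add: y_def powr_powr)
    have y0: "0 < y" using lt by (simp add: y_def)
    have "1 < 2 powr p" using p powr_less_mono[of 0 p 2] by simp
    then have "y powr p < 1 powr p" using yp by simp
    then have y1: "y < 1" using p y0 by (meson less_eq_real_def not_less powr_mono2 zero_less_one)
    have "1 < (y powr p + (2 - y) powr p) / 2" using mid[of y "2 - y"] y0 y1 by simp
    also have "\<dots> \<le> (y powr p + 2 powr p) / 2" using y0 y1 p by (auto intro!: powr_mono2)
    finally show False using yp by simp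
  qed
qed

text \<open>Multiplicativity and monotonicity hold for the limit of the quotients, so the limit is a
  power. As the exponent \<open>0\<close> is excluded by strict convexity, the sign of the exponent
  reveals the direction in which \<open>\<tau>\<close> is monotone.\<close>

lemma regularly_varying_rate:
  fixes \<tau> :: "real \<Rightarrow> real"
  assumes pos: "\<And>u. 0 < u \<Longrightarrow> 0 < \<tau> u"
    and mono: "mono_on {0<..} \<tau> \<or> antimono_on {0<..} \<tau>"
    and conv: "strictly_convex_on {0<..} (rate_limit \<tau>)"
  obtains p where "(p < 0 \<and> antimono_on {0<..} \<tau>) \<or> (1 < p \<and> mono_on {0<..} \<tau>)"
    "\<And>s. 0 < s \<Longrightarrow> rate_limit \<tau> s = s powr p"
    "\<And>s. 0 < s \<Longrightarrow> ((\<lambda>u. \<tau> (s * u) / \<tau> u) \<longlongrightarrow> s powr p) at_top"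
proof -
  define w where "w = rate_limit \<tau>"
  have ex: "0 < w s" "((\<lambda>u. \<tau> (s * u) / \<tau> u) \<longlongrightarrow> w s) at_top" if "0 < s" for s
    using strictly_convex_rate_limit_exists[of \<tau> s, OF pos conv that] rate_limit_eq[of \<tau> s] 
    unfolding w_def by auto
  have mult: "w (s * t) = w s * w t" if "0 < s" "0 < t" for s t
  proof -
    have "filterlim (\<lambda>u. t * u) at_top at_top"
      using that by (intro filterlim_tendsto_pos_mult_at_top[where c = t] filterlim_ident) auto
    from tendsto_mult[OF filterlim_compose[OF ex(2)[OF that(1)] this] ex(2)[OF that(2)]]
    have "((\<lambda>u. \<tau> (s * (t * u)) / \<tau> (t * u) * (\<tau> (t * u) / \<tau> u)) \<longlongrightarrow> w s * w t) at_top" .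
    moreover have "\<forall>\<^sub>F u in at_top. \<tau> (s * (t * u)) / \<tau> (t * u) * (\<tau> (t * u) / \<tau> u) = \<tau> (s * t * u) / \<tau> u"
      using eventually_gt_at_top[of 0]
    proof eventually_elim
      case (elim u)
      then have "\<tau> (t * u) \<noteq> 0" using pos[of "t * u"] that by simp
      then show ?case by (simp add: mult.assoc)
    qed
    ultimately have "((\<lambda>u. \<tau> (s * t * u) / \<tau> u) \<longlongrightarrow> w s * w t) at_top"
      by (rule Lim_transform_eventually)
    from tendsto_unique[OF _ this ex(2)] that show ?thesis by simp
  qed
  have le: "w s \<le> w t" if "mono_on {0<..} \<tau>" "0 < s" "s \<le> t" for s t
  proof (rule tendsto_le[OF _ ex(2)[of t] ex(2)[of s]])
    show "\<forall>\<^sub>F u in at_top. \<tau> (s * u) / \<tau> u \<le> \<tau> (t * u) / \<tau> u"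
      using eventually_gt_at_top[of 0]
    proof eventually_elim
      case (elim u)
      then have "\<tau> (s * u) \<le> \<tau> (t * u)" using that by (intro monotone_onD[OF that(1)]) auto
      then show ?case using pos[OF elim] by (simp add: divide_right_mono)
    qed
  qed (use that in auto)
  have ge: "w t \<le> w s" if "antimono_on {0<..} \<tau>" "0 < s" "s \<le> t" for s t
  proof (rule tendsto_le[OF _ ex(2)[of s] ex(2)[of t]])
    show "\<forall>\<^sub>F u in at_top. \<tau> (t * u) / \<tau> u \<le> \<tau> (s * u) / \<tau> u"
      using eventually_gt_at_top[of 0]
    proof eventually_elim
      case (elim u)
      then have "\<tau> (t * u) \<le> \<tau> (s * u)" using that by (intro monotone_onD[OF that(1)]) auto
      then show ?case using pos[OF elim] by (simp add: divide_right_mono)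
    qed
  qed (use that in auto)
  have "mono_on {0<..} w \<or> antimono_on {0<..} w"
    using mono le ge by (auto simp: monotone_on_def)
  from monotone_multiplicative_imp_powr[OF ex(1) mult this]
  obtain p where p: "\<And>s. 0 < s \<Longrightarrow> w s = s powr p" by metis
  have pr: "p < 0 \<or> 1 < p" using strictly_convex_powr_exponent[OF conv] p unfolding w_def by blast
  have "p < 0 \<and> antimono_on {0<..} \<tau> \<or> 1 < p \<and> mono_on {0<..} \<tau>"
  proof -
    have "\<not> p < 0" if "mono_on {0<..} \<tau>"
      using le[OF that, of 1 2] powr_less_mono[of p 0 2] by (auto simp: p)
    moreover have "\<not> 1 < p" if "antimono_on {0<..} \<tau>"
    proof
      assume "1 < p"
      then have "2 powr 0 < 2 powr p" by (intro powr_less_mono) auto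
      then show False using ge[OF that, of 1 2] by (simp add: p)
    qed
    ultimately show ?thesis using mono pr by blast
  qed
  moreover have "rate_limit \<tau> s = s powr p" if "0 < s" for s
    using p[OF that] by (simp add: w_def)
  moreover have "((\<lambda>u. \<tau> (s * u) / \<tau> u) \<longlongrightarrow> s powr p) at_top" if "0 < s" for s
    using p[OF that] ex(2)[OF that] by simp
  ultimately show thesis by (rule that)
qed

section \<open>Cubes and grids\<close>

lemma mem_cube:
  fixes x y :: "real ^ 'd"
  assumes "0 < a"
  shows "y \<in> cube x a \<longleftrightarrow> (\<forall>i. \<bar>y $ i - x $ i\<bar> \<le> a / 2)"
proof
  assume "y \<in> cube x a"
  then obtain u where u: "u \<in> unit_cube" "y = x + a *\<^sub>R u" by (auto simp: cube_def)
  have "\<bar>a * u $ i\<bar> \<le> a / 2" for i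
  proof -
    have "- 1/2 \<le> u $ i" "u $ i \<le> 1/2" using u by (auto simp: unit_cube_def mem_box_cart)
    then have "\<bar>u $ i\<bar> \<le> 1/2" by (simp add: abs_le_iff)
    then have "a * \<bar>u $ i\<bar> \<le> a * (1/2)" using assms by (intro mult_left_mono) auto
    then show ?thesis using assms by (simp add: abs_mult)
  qed
  then show "\<forall>i. \<bar>y $ i - x $ i\<bar> \<le> a / 2" using u by simp
next
  assume *: "\<forall>i. \<bar>y $ i - x $ i\<bar> \<le> a / 2"
  have "- 1/2 \<le> (y $ i - x $ i) / a \<and> (y $ i - x $ i) / a \<le> 1/2" for i
  proof -
    have "x $ i - a / 2 \<le> y $ i" "y $ i \<le> x $ i + a / 2" using *[rule_format, of i] by arith+
    then show ?thesis using assms by (auto simp: field_simps)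
  qed
  then have "(1 / a) *\<^sub>R (y - x) \<in> unit_cube" by (simp add: unit_cube_def mem_box_cart)
  moreover have "y = x + a *\<^sub>R ((1 / a) *\<^sub>R (y - x))" using assms by simp
  ultimately show "y \<in> cube x a" unfolding cube_def by blast
qed

lemma cube_eq_cbox:
  assumes "0 < a"
  shows "cube x a = cbox (x - (\<chi> i. a / 2)) (x + (\<chi> i. a / 2))"
proof -
  have "\<bar>y $ i - x $ i\<bar> \<le> a / 2 \<longleftrightarrow> x $ i - a / 2 \<le> y $ i \<and> y $ i \<le> x $ i + a / 2" for y :: "real ^ 'a" and i
    by arith
  then show ?thesis using assms by (auto simp: mem_cube mem_box_cart)
qed

lemma unit_cube_eq: "unit_cube = cube 0 1"
  by (simp add: cube_def)

lemma compact_cube [simp]: "0 < a \<Longrightarrow> compact (cube x a)"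
  by (simp add: cube_eq_cbox)

lemma mem_interior_cube:
  assumes "0 < a"
  shows "y \<in> interior (cube x a) \<longleftrightarrow> (\<forall>i. \<bar>y $ i - x $ i\<bar> < a / 2)"
proof -
  have "\<bar>y $ i - x $ i\<bar> < a / 2 \<longleftrightarrow> x $ i - a / 2 < y $ i \<and> y $ i < x $ i + a / 2" for i
    by arith
  then show ?thesis using assms by (auto simp: cube_eq_cbox interior_cbox mem_box_cart)
qed

lemma measure_cube:
  fixes x :: "real ^ 'd"
  assumes "0 < a"
  shows "measure lborel (cube x a) = a ^ CARD('d)"
proof -
  have "x $ i - a / 2 \<le> x $ i + a / 2" for i using assms by simp
  then have "cbox (x - (\<chi> i. a / 2)) (x + (\<chi> i. a / 2)) \<noteq> {}"
    using assms by (auto simp: interval_ne_empty_cart)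
  then show ?thesis using assms by (simp add: cube_eq_cbox content_cbox_cart)
qed

lemma center_in_cube: "0 < a \<Longrightarrow> x \<in> cube x a"
  by (simp add: mem_cube)

text \<open>The sum norm gives side times dimension instead of the exact diameter; all that matters
  is that small cubes have small diameter.\<close>

lemma dist_cube_le:
  fixes x :: "real ^ 'd"
  assumes "0 < a" "y \<in> cube x a" "z \<in> cube x a"
  shows "dist y z \<le> a * CARD('d)"
proof -
  have "dist y z \<le> (\<Sum>i\<in>UNIV. \<bar>(y - z) $ i\<bar>)" unfolding dist_norm by (rule norm_le_l1_cart)
  also have "\<dots> \<le> (\<Sum>i\<in>(UNIV :: 'd set). a)"
  proof (rule sum_mono)
    fix i
    have "\<bar>y $ i - x $ i\<bar> \<le> a / 2" "\<bar>z $ i - x $ i\<bar> \<le> a / 2" using assms by (auto simp: mem_cube)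
    then show "\<bar>(y - z) $ i\<bar> \<le> a" unfolding vector_minus_component by linarith
  qed
  finally show ?thesis by (simp add: mult.commute)
qed

lemma cube_subset_cube: "0 < b \<Longrightarrow> b \<le> a \<Longrightarrow> cube x b \<subseteq> cube x a"
  by (fastforce simp: mem_cube intro: order_trans)

lemma cube_subset_open:
  fixes x :: "real ^ 'd"
  assumes "open V" "x \<in> V"
  obtains r where "0 < r" "cube x r \<subseteq> V"
proof -
  obtain e where e: "0 < e" "ball x e \<subseteq> V" using assms open_contains_ball by blast
  define r where "r = e / (2 * CARD('d))"
  have r: "0 < r" "r * CARD('d) < e" using e by (auto simp: r_def)
  then have "cube x r \<subseteq> ball x e"
    using dist_cube_le[OF r(1) center_in_cube] by (fastforce intro: le_less_trans)
  with e r that show thesis by blast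
qed

lemma is_cube_cube [simp]: "0 < a \<Longrightarrow> is_cube (cube x a)"
  by (auto simp: is_cube_def)

lemma is_cube_compact: "is_cube Q \<Longrightarrow> compact Q"
  by (auto simp: is_cube_def)

lemma is_cube_sets [measurable]: "is_cube Q \<Longrightarrow> Q \<in> sets borel"
  by (simp add: is_cube_compact borel_compact)

lemma compact_measure_lebesgue: "compact S \<Longrightarrow> measure lebesgue S = measure lborel S"
  by (intro measure_completion) (simp add: borel_compact)

text \<open>A cube is the closure of its interior, so \<open>interior P\<close> misses all of
  \<open>Q\<close> and not only its interior. The overlap is therefore contained in the frontier of
  the convex set \<open>P\<close>.\<close>

lemma negligible_Int_cubes:
  assumes "is_cube P" "is_cube Q" "interior P \<inter> interior Q = {}"
  shows "negligible (P \<inter> Q)"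
proof -
  obtain x a where P: "0 < a" "P = cube x a" using assms by (auto simp: is_cube_def)
  obtain y b where Q: "0 < b" "Q = cube y b" using assms by (auto simp: is_cube_def)
  have "y \<in> interior Q" using Q by (simp add: mem_interior_cube)
  moreover have "convex Q" "closed Q" using Q by (auto simp: cube_eq_cbox)
  ultimately have "closure (interior Q) = Q"
    using convex_closure_interior[of Q] by (auto simp: closure_closed)
  then have "interior P \<inter> Q = {}" using assms(3) open_Int_closure_eq_empty[of "interior P" "interior Q"] by simp
  then have "P \<inter> Q \<subseteq> frontier P" using closure_subset[of P] by (auto simp: frontier_def)
  moreover have "negligible (frontier P)" using P by (intro negligible_convex_frontier) (simp add: cube_eq_cbox)
  ultimately show ?thesis using negligible_subset by blast
qed

lemma measure_Int_Union_cubes: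
  fixes A :: "(real ^ 'd) set"
  assumes "compact A" "finite QQ" "\<And>Q. Q \<in> QQ \<Longrightarrow> is_cube Q"
    and "pairwise (\<lambda>P Q. interior P \<inter> interior Q = {}) QQ"
  shows "measure lborel (A \<inter> \<Union>QQ) = (\<Sum>Q\<in>QQ. measure lborel (A \<inter> Q))"
proof -
  have comp: "compact (A \<inter> Q)" if "Q \<in> QQ" for Q
    using assms that is_cube_compact by (blast intro: compact_Int)
  have "measure lebesgue (\<Union>((\<inter>) A ` QQ)) = (\<Sum>Q\<in>QQ. measure lebesgue (A \<inter> Q))"
  proof (rule measure_negligible_finite_Union_image[OF \<open>finite QQ\<close>])
    show "A \<inter> Q \<in> lmeasurable" if "Q \<in> QQ" for Q using comp[OF that] by (rule lmeasurable_compact)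
    show "pairwise (\<lambda>P Q. negligible (A \<inter> P \<inter> (A \<inter> Q))) QQ"
      unfolding pairwise_def
    proof (intro ballI impI)
      fix P Q assume "P \<in> QQ" "Q \<in> QQ" "P \<noteq> Q"
      then have "negligible (P \<inter> Q)"
        using assms(3,4) by (intro negligible_Int_cubes) (auto simp: pairwise_def)
      then show "negligible (A \<inter> P \<inter> (A \<inter> Q))" by (rule negligible_subset) auto
    qed
  qed
  moreover have "compact (\<Union>((\<inter>) A ` QQ))" using comp \<open>finite QQ\<close> by (intro compact_Union) auto
  moreover have "\<Union>((\<inter>) A ` QQ) = A \<inter> \<Union>QQ" by auto
  ultimately show ?thesis using comp by (simp add: compact_measure_lebesgue)
qed

lemma compact_Union_cubes:
  "finite QQ \<Longrightarrow> (\<And>Q. Q \<in> QQ \<Longrightarrow> is_cube Q) \<Longrightarrow> compact (\<Union>QQ)"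
  by (intro compact_Union) (auto intro: is_cube_compact)

lemma measure_mono_compact:
  fixes A B :: "(real ^ 'd) set"
  assumes "compact B" "A \<subseteq> B" "A \<in> sets borel"
  shows "measure lborel A \<le> measure lborel B"
  using assms by (intro measure_mono_fmeasurable fmeasurable_compact)  auto

lemma negligible_iff_measure_lborel_0:
  fixes S :: "(real ^ 'd) set"
  assumes "compact S"
  shows "negligible S \<longleftrightarrow> measure lborel S = 0"
  using assms lmeasurable_compact[OF assms] compact_measure_lebesgue[OF assms]
  by (simp add: negligible_iff_measure)

text \<open>Iterating this produces \<open>2 ^ k\<close> disjoint subcubes that all meet
  \<open>A\<close> in positive measure, which is how the number of points of a minimizer in a cube
  is shown to be unbounded.\<close>

lemma two_disjoint_subcubes:
  fixes A :: "(real ^ 'd) set"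
  assumes "compact A" "is_cube Q" "0 < measure lborel (A \<inter> Q)"
  obtains P R where "is_cube P" "is_cube R" "P \<subseteq> Q" "R \<subseteq> Q" "P \<inter> R = {}"
    "0 < measure lborel (A \<inter> P)" "0 < measure lborel (A \<inter> R)"
proof -
  define S where "S = A \<inter> interior Q"
  have "\<not> negligible (A \<inter> Q)"
    using assms negligible_iff_measure_lborel_0[of "A \<inter> Q"] is_cube_compact[of Q] by (auto intro: compact_Int)
  moreover have "negligible (Q - interior Q)"
  proof -
    obtain x a where "0 < a" "Q = cube x a" using assms by (auto simp: is_cube_def)
    then show ?thesis by (simp add: cube_eq_cbox interior_cbox negligible_frontier_interval)
  qed
  moreover have "A \<inter> Q \<subseteq> S \<union> (Q - interior Q)" by (auto simp: S_def)
  ultimately have nS: "\<not> negligible S" using negligible_Un negligible_subset by metis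
  \<comment> \<open>A set that is null near each of its points is null. A non-null set thus has a
    point all of whose neighbourhoods meet it in a non-null set.\<close>
  have ex: "\<exists>y\<in>T. \<forall>V. open V \<longrightarrow> y \<in> V \<longrightarrow> \<not> negligible (T \<inter> V)" if "\<not> negligible T" for T :: "(real ^ 'd) set"
  proof (rule ccontr)
    assume *: "\<not> ?thesis"
    have "\<exists>U. openin (top_of_set T) U \<and> y \<in> U \<and> negligible U" if "y \<in> T" for y
    proof -
      from * that obtain V where "open V" "y \<in> V" "negligible (T \<inter> V)" by blast
      with that show ?thesis by (intro exI[of _ "T \<inter> V"]) (auto simp: openin_open)
    qed
    with that show False using locally_negligible_alt[of T] by blast
  qed
  obtain y where y: "y \<in> S" "\<And>V. open V \<Longrightarrow> y \<in> V \<Longrightarrow> \<not> negligible (S \<inter> V)"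
    using ex[OF nS] by blast
  \<comment> \<open>Deleting one point leaves the set non-null, so the argument applies again and
    yields a second such point, distinct from the first.\<close>
  have "\<not> negligible (S - {y})" using nS negligible_insert[of y "S - {y}"] y(1) by (simp add: insert_absorb)
  from ex[OF this] obtain z where z: "z \<in> S - {y}" "\<And>V. open V \<Longrightarrow> z \<in> V \<Longrightarrow> \<not> negligible ((S - {y}) \<inter> V)"
    by blast
  obtain U V where UV: "open U" "open V" "y \<in> U" "z \<in> V" "U \<inter> V = {}"
    using hausdorff[of y z] z by blast
  have "y \<in> interior Q" "z \<in> interior Q" using y z by (auto simp: S_def)
  with UV obtain r s where rs: "0 < r" "cube y r \<subseteq> U \<inter> interior Q" "0 < s" "cube z s \<subseteq> V \<inter> interior Q"
    by (metis IntI cube_subset_open open_Int open_interior)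
  have "\<not> negligible (A \<inter> cube y r)"
    using y(2)[of "interior (cube y r)"] rs(1) interior_subset[of "cube y r"]
    by (auto simp: mem_interior_cube S_def dest: negligible_subset[of _ "A \<inter> interior Q \<inter> interior (cube y r)"])
  moreover have "\<not> negligible (A \<inter> cube z s)"
    using z(2)[of "interior (cube z s)"] rs(3) interior_subset[of "cube z s"]
    by (auto simp: mem_interior_cube S_def dest: negligible_subset[of _ "(A \<inter> interior Q - {y}) \<inter> interior (cube z s)"])
  ultimately have "0 < measure lborel (A \<inter> cube y r)" "0 < measure lborel (A \<inter> cube z s)"
    using assms(1) rs negligible_iff_measure_lborel_0[of "A \<inter> cube y r"]
      negligible_iff_measure_lborel_0[of "A \<inter> cube z s"]
    by (auto simp: compact_Int zero_less_measure_iff less_le)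
  then show thesis
    using rs UV(5) interior_subset[of Q] by (intro that[of "cube y r" "cube z s"]) auto
qed

text \<open>Distance at least \<open>h\<close> in the maximum norm. Stated for the centres, it is
  inherited by subfamilies, it makes the interiors of the cubes of side \<open>h\<close> disjoint,
  and it makes cubes of any smaller side disjoint outright.\<close>

definition separated_by :: "real \<Rightarrow> (real ^ 'd) set \<Rightarrow> bool" where
  "separated_by h Z \<longleftrightarrow> pairwise (\<lambda>x y. \<exists>i. h \<le> \<bar>x $ i - y $ i\<bar>) Z"

lemma separated_by_subset: "separated_by h Z \<Longrightarrow> Y \<subseteq> Z \<Longrightarrow> separated_by h Y"
  unfolding separated_by_def by (rule pairwise_subset)

lemma inj_on_cube: "0 < a \<Longrightarrow> inj_on (\<lambda>z. cube z a) Z"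
proof (rule inj_onI)
  fix x y :: "real ^ 'd" assume a: "0 < a" and eq: "cube x a = cube y a"
  have "x - (\<chi> i. a / 2) = y - (\<chi> i. a / 2)"
    using eq a center_in_cube[of a x] by (auto simp: cube_eq_cbox eq_cbox)
  then show "x = y" by simp
qed

lemma separated_interiors_disjoint:
  assumes "separated_by h Z" "0 < h"
  shows "pairwise (\<lambda>P Q. interior P \<inter> interior Q = {}) ((\<lambda>z. cube z h) ` Z)"
proof (rule pairwise_imageI)
  fix x y assume "x \<in> Z" "y \<in> Z" "x \<noteq> y"
  then obtain i where "h \<le> \<bar>x $ i - y $ i\<bar>" using assms by (auto simp: separated_by_def pairwise_def)
  moreover have "\<bar>x $ i - y $ i\<bar> < h" if "u \<in> interior (cube x h) \<inter> interior (cube y h)" for u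
  proof -
    have "\<bar>u $ i - x $ i\<bar> < h / 2" "\<bar>u $ i - y $ i\<bar> < h / 2"
      using that assms(2) by (auto simp: mem_interior_cube)
    then show ?thesis by linarith
  qed
  ultimately show "interior (cube x h) \<inter> interior (cube y h) = {}" by fastforce
qed

lemma separated_shrunk_disjnt:
  assumes "separated_by h Z" "0 < b" "b < h" "x \<in> Z" "y \<in> Z" "x \<noteq> y"
  shows "disjnt (cube x b) (cube y b)"
proof -
  obtain i where "h \<le> \<bar>x $ i - y $ i\<bar>" using assms by (auto simp: separated_by_def pairwise_def)
  moreover have "\<bar>x $ i - y $ i\<bar> \<le> b" if "u \<in> cube x b \<inter> cube y b" for u
  proof -
    have "\<bar>u $ i - x $ i\<bar> \<le> b / 2" "\<bar>u $ i - y $ i\<bar> \<le> b / 2"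
      using that assms(2) by (auto simp: mem_cube)
    then show ?thesis by linarith
  qed
  ultimately show ?thesis using assms(3) by (fastforce simp: disjnt_def)
qed

lemma separated_shrunk_disjoint:
  assumes "separated_by h Z" "0 < b" "b < h"
  shows "pairwise disjnt ((\<lambda>z. cube z b) ` Z)"
  by (rule pairwise_imageI) (rule separated_shrunk_disjnt[OF assms])

text \<open>The family consists of the cells of the lattice with spacing \<open>h\<close> that meet
  \<open>A\<close>. It is asserted for all small \<open>h\<close> because the side has to tend to
  \<open>0\<close> while \<open>A\<close> and \<open>V\<close> stay fixed.\<close>

lemma grid_cover:
  fixes A V :: "(real ^ 'd) set"
  assumes "compact A" "open V" "A \<subseteq> V"
  obtains h0 where "0 < h0"
    "\<And>h. 0 < h \<Longrightarrow> h < h0 \<Longrightarrow> \<exists>Z. finite Z \<and> separated_by h Z \<and>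
       (\<forall>z\<in>Z. cube z h \<inter> A \<noteq> {} \<and> cube z h \<subseteq> V) \<and> A \<subseteq> (\<Union>z\<in>Z. cube z h)"
proof -
  obtain e where e: "0 < e" "(\<Union>x\<in>A. ball x e) \<subseteq> V"
    using compact_subset_open_imp_ball_epsilon_subset[OF assms] by blast
  show thesis
  proof (rule that[of "e / CARD('d)"])
    show "0 < e / CARD('d)" using e by simp
    fix h :: real assume h: "0 < h" "h < e / CARD('d)"
    define Z where "Z = {z. (\<forall>i. \<exists>k::int. z $ i = h * of_int k) \<and> cube z h \<inter> A \<noteq> {}}"
    have sep: "separated_by h Z" unfolding separated_by_def pairwise_def
    proof (intro ballI impI)
      fix x y assume "x \<in> Z" "y \<in> Z" "x \<noteq> y"
      then obtain i where i: "x $ i \<noteq> y $ i" by (auto simp: vec_eq_iff)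
      obtain k l :: int where kl: "x $ i = h * of_int k" "y $ i = h * of_int l"
        using \<open>x \<in> Z\<close> \<open>y \<in> Z\<close> unfolding Z_def by blast
      have "\<bar>x $ i - y $ i\<bar> = h * of_int \<bar>k - l\<bar>"
        using h by (simp add: kl abs_mult right_diff_distrib[symmetric])
      moreover have "1 \<le> \<bar>k - l\<bar>" using i kl by auto
      then have "h * 1 \<le> h * of_int \<bar>k - l\<bar>" using h by (intro mult_left_mono) linarith+
      ultimately show "\<exists>i. h \<le> \<bar>x $ i - y $ i\<bar>" by (intro exI[of _ i]) simp
    qed
    obtain R where R: "\<And>x. x \<in> A \<Longrightarrow> norm x \<le> R"
      using compact_imp_bounded[OF assms(1)] by (auto simp: bounded_iff)
    have "finite Z"
    proof -
      \<comment> \<open>The centre of a cell that meets \<open>A\<close> is within \<open>h\<close>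
        of a point of \<open>A\<close> in each coordinate, so its integer lattice coordinates are
        bounded by \<open>K\<close> in absolute value. The floor recovers exactly these
        integers.\<close>
      define K where "K = \<lceil>(R + h) / h\<rceil>"
      have "inj_on (\<lambda>z i. \<lfloor>z $ i / h\<rfloor>) Z"
      proof (rule inj_onI)
        fix x y assume xy: "x \<in> Z" "y \<in> Z" "(\<lambda>i. \<lfloor>x $ i / h\<rfloor>) = (\<lambda>i. \<lfloor>y $ i / h\<rfloor>)"
        have "x $ i = y $ i" for i
        proof -
          obtain k l :: int where kl: "x $ i = h * of_int k" "y $ i = h * of_int l"
            using xy unfolding Z_def by blast
          with fun_cong[OF xy(3), of i] h show ?thesis by simp
        qed
        then show "x = y" by (simp add: vec_eq_iff)
      qed
      moreover have "(\<lambda>z i. \<lfloor>z $ i / h\<rfloor>) ` Z \<subseteq> PiE UNIV (\<lambda>_. {-K-1..K})"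
      proof safe
        fix z i assume "z \<in> Z"
        then obtain u where u: "u \<in> A" "u \<in> cube z h" by (auto simp: Z_def)
        have "\<bar>u $ i - z $ i\<bar> \<le> h / 2" using u h by (auto simp: mem_cube)
        then have "\<bar>z $ i\<bar> \<le> \<bar>u $ i\<bar> + h" using h by arith
        also have "\<bar>u $ i\<bar> \<le> R" using R[OF u(1)] component_le_norm_cart[of u i] by linarith
        finally have "\<bar>z $ i\<bar> / h \<le> (R + h) / h" using h by (simp add: divide_right_mono)
        also have "\<dots> \<le> of_int K" by (simp add: K_def)
        finally have "\<bar>z $ i / h\<bar> \<le> of_int K" using h by simp
        then have "of_int (- K) \<le> z $ i / h" "z $ i / h \<le> of_int K" unfolding of_int_minus by arith+
        then show "\<lfloor>z $ i / h\<rfloor> \<in> {-K-1..K}" by (auto simp: le_floor_iff floor_le_iff)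
      qed auto
      moreover have "finite (PiE (UNIV :: 'd set) (\<lambda>_. {-K-1..K}))" by (intro finite_PiE) auto
      ultimately show ?thesis by (meson finite_imageD finite_subset)
    qed
    moreover have "cube z h \<subseteq> V" if "z \<in> Z" for z
    proof
      fix y assume y: "y \<in> cube z h"
      obtain u where u: "u \<in> A" "u \<in> cube z h" using \<open>z \<in> Z\<close> unfolding Z_def by blast
      have "dist u y \<le> h * CARD('d)" using dist_cube_le[OF h(1) u(2) y] .
      also have "\<dots> < e" using h by (simp add: field_simps)
      finally have "y \<in> ball u e" by simp
      then show "y \<in> V" using e(2) u(1) by blast
    qed
    moreover have "A \<subseteq> (\<Union>z\<in>Z. cube z h)"
    proof
      fix x assume x: "x \<in> A"
      \<comment> \<open>The lattice point nearest to \<open>x\<close>, found by rounding each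
        coordinate.\<close>
      define z :: "real ^ 'd" where "z = (\<chi> i. h * of_int (round (x $ i / h)))"
      have "\<bar>x $ i - z $ i\<bar> \<le> h / 2" for i
      proof -
        have "h * \<bar>of_int (round (x $ i / h)) - x $ i / h\<bar> \<le> h * (1/2)"
          using h of_int_round_abs_le[of "x $ i / h"] by (intro mult_left_mono) auto
        moreover have "h * \<bar>of_int (round (x $ i / h)) - x $ i / h\<bar> = \<bar>h * (of_int (round (x $ i / h)) - x $ i / h)\<bar>"
          using h by (simp add: abs_mult)
        moreover have "h * (of_int (round (x $ i / h)) - x $ i / h) = z $ i - x $ i"
          using h by (simp add: z_def field_simps)
        ultimately show ?thesis by (simp add: abs_minus_commute)
      qed
      then have "x \<in> cube z h" using h by (simp add: mem_cube)
      moreover have "z \<in> Z" using x calculation by (auto simp: Z_def z_def)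
      ultimately show "x \<in> (\<Union>z\<in>Z. cube z h)" by blast
    qed
    moreover have "cube z h \<inter> A \<noteq> {}" if "z \<in> Z" for z using that by (auto simp: Z_def)
    ultimately show "\<exists>Z. finite Z \<and> separated_by h Z \<and>
       (\<forall>z\<in>Z. cube z h \<inter> A \<noteq> {} \<and> cube z h \<subseteq> V) \<and> A \<subseteq> (\<Union>z\<in>Z. cube z h)"
      using sep by blast
  qed
qed

lemma measure_separated_cubes:
  fixes Z :: "(real ^ 'd) set"
  assumes "finite Z" "separated_by h Z" "0 < h"
  shows "measure lborel (\<Union>z\<in>Z. cube z h) = real (card Z) * h ^ CARD('d)"
proof -
  let ?QQ = "(\<lambda>z. cube z h) ` Z"
  have "compact (\<Union>?QQ)" using assms by (intro compact_Union_cubes) auto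
  then have "measure lborel (\<Union>?QQ \<inter> \<Union>?QQ) = (\<Sum>Q\<in>?QQ. measure lborel (\<Union>?QQ \<inter> Q))"
    using assms separated_interiors_disjoint[of h Z] by (intro measure_Int_Union_cubes) auto
  then have "measure lborel (\<Union>?QQ) = (\<Sum>Q\<in>?QQ. measure lborel (\<Union>?QQ \<inter> Q))" by simp
  also have "\<dots> = (\<Sum>Q\<in>?QQ. h ^ CARD('d))"
  proof (rule sum.cong[OF refl])
    fix Q assume Q: "Q \<in> ?QQ"
    then have "\<Union>?QQ \<inter> Q = Q" by blast
    then show "measure lborel (\<Union>?QQ \<inter> Q) = h ^ CARD('d)"
      using Q assms(3) by (auto simp: measure_cube)
  qed
  also have "\<dots> = real (card Z) * h ^ CARD('d)" using inj_on_cube[of h Z] assms by (simp add: card_image)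
  finally show ?thesis .
qed

lemma open_superset_measure_le:
  fixes A \<Omega> :: "(real ^ 'd) set"
  assumes "compact A" "A \<subseteq> \<Omega>" "open \<Omega>" "bounded \<Omega>" "0 < \<eta>"
  obtains V where "open V" "bounded V" "A \<subseteq> V" "V \<subseteq> \<Omega>" "measure lborel (V - A) \<le> \<eta>"
    "measure lborel V \<le> measure lborel A + \<eta>"
proof -
  have A: "A \<in> sets borel" using assms by (simp add: borel_compact)
  obtain U where U: "open U" "A \<subseteq> U" "emeasure lborel (U - A) \<le> \<eta>"
    using outer_regular_lborel_le[OF A \<open>0 < \<eta>\<close>] by blast
  have b: "bounded (U \<inter> \<Omega>)" using assms bounded_subset by blast
  have fV: "U \<inter> \<Omega> \<in> fmeasurable lborel"
    using U assms b emeasure_bounded_finite[of "U \<inter> \<Omega>"] by (intro fmeasurableI) auto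
  have "emeasure lborel (U \<inter> \<Omega> - A) \<le> emeasure lborel (U - A)"
    using U(1) A by (intro emeasure_mono) auto
  then have "emeasure lborel (U \<inter> \<Omega> - A) \<le> ennreal \<eta>" using U(3) by (rule order_trans)
  then have le: "measure lborel (U \<inter> \<Omega> - A) \<le> \<eta>"
    using \<open>0 < \<eta>\<close> by (metis enn2real_leI measure_def less_imp_le)
  have "measure lborel (U \<inter> \<Omega> - A) = measure lborel (U \<inter> \<Omega>) - measure lborel A"
    using fV A U assms by (intro measurable_measure_Diff) auto
  with le show thesis
    using U assms b by (intro that[of "U \<inter> \<Omega>"]) auto
qed

text \<open>This replaces a density theorem. A cell is bad if its shrunk copy misses more than the
  proportion \<open>\<delta>\<close> of \<open>A\<close>. The missing parts of the bad cells are
  disjoint and lie in \<open>V - A\<close>, whose measure is as small as desired, so bad cells have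
  small total volume and may be discarded.\<close>

lemma grid_pack:
  fixes A \<Omega> :: "(real ^ 'd) set"
  assumes A: "compact A" "A \<subseteq> \<Omega>" "open \<Omega>" "bounded \<Omega>"
    and "0 < \<kappa>" "0 < \<delta>" "0 < c" "c < 1"
  obtains h0 where "0 < h0"
    "\<And>h. 0 < h \<Longrightarrow> h < h0 \<Longrightarrow> \<exists>Z. finite Z \<and> separated_by h Z \<and>
       (\<forall>z\<in>Z. cube z h \<subseteq> \<Omega> \<and> (1 - \<delta>) * (c * h) ^ CARD('d) \<le> measure lborel (A \<inter> cube z (c * h))) \<and>
       measure lborel A - \<kappa> \<le> real (card Z) * h ^ CARD('d)"
proof -
  \<comment> \<open>Each bad cell wastes at least \<open>\<delta> * (c * h) ^ CARD('d)\<close> of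
    the measure of \<open>V - A\<close>; this value of \<open>\<eta>\<close> turns that into total
    volume at most \<open>\<kappa>\<close> for the full-size bad cells.\<close>
  define \<eta> where "\<eta> = \<kappa> * \<delta> * c ^ CARD('d)"
  have "0 < \<eta>" using assms by (simp add: \<eta>_def)
  obtain V where V: "open V" "bounded V" "A \<subseteq> V" "V \<subseteq> \<Omega>" "measure lborel (V - A) \<le> \<eta>"
    using open_superset_measure_le[OF A \<open>0 < \<eta>\<close>] by metis
  have A': "A \<in> sets borel" using assms by (simp add: borel_compact)
  have fVA: "V - A \<in> fmeasurable lborel"
    using V A' emeasure_bounded_finite[of "V - A"] bounded_subset[of V "V - A"] by (intro fmeasurableI) auto
  obtain h0 where h0: "0 < h0" "\<And>h. 0 < h \<Longrightarrow> h < h0 \<Longrightarrow> \<exists>Z. finite Z \<and> separated_by h Z \<and>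
       (\<forall>z\<in>Z. cube z h \<inter> A \<noteq> {} \<and> cube z h \<subseteq> V) \<and> A \<subseteq> (\<Union>z\<in>Z. cube z h)"
    using grid_cover[OF A(1) V(1) V(3)] by metis
  show thesis
  proof (rule that[OF h0(1)])
    fix h :: real assume h: "0 < h" "h < h0"
    obtain Z where Z: "finite Z" "separated_by h Z" "\<And>z. z \<in> Z \<Longrightarrow> cube z h \<subseteq> V" "A \<subseteq> (\<Union>z\<in>Z. cube z h)"
      using h0(2)[OF h] by blast
    have ch: "0 < c * h" "c * h < h" using assms h by auto
    define G where "G = {z\<in>Z. (1 - \<delta>) * (c * h) ^ CARD('d) \<le> measure lborel (A \<inter> cube z (c * h))}"
    define B where "B = Z - G"
    have "real (card B) * (\<delta> * (c * h) ^ CARD('d)) \<le> \<eta>"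
    proof -
      have "real (card B) * (\<delta> * (c * h) ^ CARD('d)) = (\<Sum>z\<in>B. \<delta> * (c * h) ^ CARD('d))" by simp
      also have "\<dots> \<le> (\<Sum>z\<in>B. measure lborel (cube z (c * h) - A))"
      proof (rule sum_mono)
        fix z assume "z \<in> B"
        then have "measure lborel (A \<inter> cube z (c * h)) < (1 - \<delta>) * (c * h) ^ CARD('d)" by (auto simp: B_def G_def)
        moreover have "measure lborel (cube z (c * h) - A \<inter> cube z (c * h)) =
            measure lborel (cube z (c * h)) - measure lborel (A \<inter> cube z (c * h))"
          using ch A A' by (intro measurable_measure_Diff fmeasurable_compact) (auto simp: borel_compact)
        moreover have "cube z (c * h) - A \<inter> cube z (c * h) = cube z (c * h) - A" by auto
        ultimately show "\<delta> * (c * h) ^ CARD('d) \<le> measure lborel (cube z (c * h) - A)"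
          using ch by (simp add: measure_cube algebra_simps)
      qed
      also have "\<dots> = measure lborel (\<Union>z\<in>B. cube z (c * h) - A)"
      proof (rule measure_finite_Union[symmetric])
        show "finite B" using Z by (auto simp: B_def)
        show "(\<lambda>z. cube z (c * h) - A) ` B \<subseteq> sets lborel" using A' ch by (auto simp: borel_compact)
        show "disjoint_family_on (\<lambda>z. cube z (c * h) - A) B"
        proof -
          have "disjnt (cube x (c*h)) (cube y (c*h))" if "x \<in> B" "y \<in> B" "x \<noteq> y" for x y
            using that by (intro separated_shrunk_disjnt[OF Z(2) ch]) (auto simp: B_def)
          then show ?thesis by (fastforce simp: disjoint_family_on_def disjnt_def)
        qed
        show "emeasure lborel (cube z (c * h) - A) \<noteq> \<infinity>" for z
        proof -
          have "bounded (cube z (c * h) - A)" using ch by (intro bounded_subset[OF compact_imp_bounded[of "cube z (c * h)"]]) auto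
          from emeasure_bounded_finite[OF this] show ?thesis by simp
        qed
      qed
      also have "\<dots> \<le> measure lborel (V - A)"
      proof (rule measure_mono_fmeasurable[OF _ _ fVA])
        show "(\<Union>z\<in>B. cube z (c * h) - A) \<subseteq> V - A"
          using Z(3) cube_subset_cube[OF ch(1) less_imp_le[OF ch(2)]] by (fastforce simp: B_def)
        have "finite B" using Z by (auto simp: B_def)
        then show "(\<Union>z\<in>B. cube z (c * h) - A) \<in> sets lborel"
          using A' ch by (intro sets.finite_UN) (auto simp: borel_compact)
      qed
      finally show ?thesis using V(5) by simp
    qed
    then have "(\<delta> * c ^ CARD('d)) * (real (card B) * h ^ CARD('d)) \<le> (\<delta> * c ^ CARD('d)) * \<kappa>"
      by (simp add: \<eta>_def power_mult_distrib mult_ac)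
    then have bad: "real (card B) * h ^ CARD('d) \<le> \<kappa>" using assms by (subst (asm) mult_le_cancel_left_pos) auto
    have "measure lborel A \<le> measure lborel (\<Union>z\<in>Z. cube z h)"
      using Z A' h by (intro measure_mono_compact compact_UN) auto
    also have "\<dots> = real (card Z) * h ^ CARD('d)" by (rule measure_separated_cubes[OF Z(1,2) h(1)])
    also have "card Z = card G + card B"
      using Z by (auto simp: B_def G_def card_Diff_subset card_mono)
    finally have "measure lborel A - \<kappa> \<le> real (card G) * h ^ CARD('d)" using bad by (simp add: algebra_simps)
    moreover have "finite G" "separated_by h G" using Z by (auto simp: G_def intro: separated_by_subset)
    moreover have "\<forall>z\<in>G. cube z h \<subseteq> \<Omega>" using Z(3) V(4) by (force simp: G_def)
    ultimately show "\<exists>Z. finite Z \<and> separated_by h Z \<and>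
       (\<forall>z\<in>Z. cube z h \<subseteq> \<Omega> \<and> (1 - \<delta>) * (c * h) ^ CARD('d) \<le> measure lborel (A \<inter> cube z (c * h))) \<and>
       measure lborel A - \<kappa> \<le> real (card Z) * h ^ CARD('d)"
      by (intro exI[of _ G]) (auto simp: G_def)
  qed
qed

section \<open>Minimizers and ratios of energies\<close>

lemma lsc_on_attains_inf:
  fixes f :: "'a::topological_space \<Rightarrow> ereal"
  assumes "compact K" "K \<noteq> {}" "K \<subseteq> S" "lsc_on S f"
  shows "\<exists>x\<in>K. \<forall>y\<in>K. f x \<le> f y"
proof (rule ccontr)
  assume "\<not> ?thesis"
  then have lt: "\<exists>y\<in>K. f y < f x" if "x \<in> K" for x using that by (auto simp: not_le)
  define m where "m = (INF x\<in>K. f x)"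
  \<comment> \<open>Near each point the values stay above a level exceeding the infimum
    \<open>m\<close>. Finitely many such neighbourhoods cover \<open>K\<close>, and the least of
    their levels would be a lower bound larger than \<open>m\<close>.\<close>
  have "\<exists>c U. open U \<and> x \<in> U \<and> m < c \<and> (\<forall>z\<in>U \<inter> K. c < f z)" if x: "x \<in> K" for x
  proof -
    have "m < f x" using lt[OF x] unfolding m_def by (meson INF_lower le_less_trans)
    then obtain c where c: "m < c" "c < f x" using dense by blast
    have "\<forall>\<^sub>F z in at x within S. c < f z"
      using assms(3,4) x c unfolding lsc_on_def le_Liminf_iff by blast
    then obtain U where "open U" "x \<in> U" "\<forall>z\<in>U. z \<noteq> x \<longrightarrow> z \<in> S \<longrightarrow> c < f z"
      unfolding eventually_at_topological by blast
    then show ?thesis using c assms(3) by (intro exI[of _ c] exI[of _ U]) auto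
  qed
  then obtain c U where cU: "\<And>x. x \<in> K \<Longrightarrow> open (U x)" "\<And>x. x \<in> K \<Longrightarrow> x \<in> U x"
    "\<And>x. x \<in> K \<Longrightarrow> m < c x" "\<And>x z. x \<in> K \<Longrightarrow> z \<in> U x \<inter> K \<Longrightarrow> c x < f z" by metis
  have "K \<subseteq> (\<Union>x\<in>K. U x)" using cU(2) by blast
  from compactE_image[OF assms(1) cU(1) this]
  obtain D where D: "D \<subseteq> K" "finite D" "K \<subseteq> (\<Union>x\<in>D. U x)" by metis
  have "D \<noteq> {}" using D assms(2) by auto
  have "Min (c ` D) \<le> f z" if "z \<in> K" for z
  proof -
    obtain x where x: "x \<in> D" "z \<in> U x" using D \<open>z \<in> K\<close> by blast
    then have "c x < f z" using cU(4)[of x z] D(1) \<open>z \<in> K\<close> by blast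
    moreover have "Min (c ` D) \<le> c x" using D x by simp
    ultimately show ?thesis by (meson le_less_trans less_imp_le)
  qed
  then have "Min (c ` D) \<le> m" unfolding m_def by (intro INF_greatest)
  moreover have "m < Min (c ` D)" using D \<open>D \<noteq> {}\<close> cU by (subst Min_gr_iff) auto
  ultimately show False by simp
qed

lemma ex_minimizer:
  assumes lsc: "lower_semicontinuous_functional \<Omega> N0 e"
    and "N0 \<le> N" "compact A" "A \<subseteq> \<Omega>" "A \<noteq> {}"
  shows "\<exists>\<omega>. is_minimizer e A N \<omega>"
proof -
  let ?K = "PiE {..<N} (\<lambda>_. A)" and ?M = "\<lambda>x. image_mset x (mset_set {..<N})"
  have "compact ?K"
  proof -
    \<comment> \<open>An extensional function takes the fixed value \<open>undefined\<close> outside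
      \<open>{..<N}\<close>, so the tuples form a product of compact sets over all indices, to which
      the theorem of Tychonoff applies.\<close>
    have "?K = PiE UNIV (\<lambda>i. if i < N then A else {undefined})"
    proof (intro set_eqI iffI)
      fix f assume "f \<in> PiE UNIV (\<lambda>i. if i < N then A else {undefined})"
      then have *: "f i \<in> (if i < N then A else {undefined})" for i by (rule PiE_mem) simp
      show "f \<in> ?K"
      proof (rule PiE_I)
        show "f i \<in> A" if "i \<in> {..<N}" for i using *[of i] that by simp
        show "f i = undefined" if "i \<notin> {..<N}" for i using *[of i] that by simp
      qed
    next
      fix f assume f: "f \<in> ?K"
      have "f i \<in> (if i < N then A else {undefined})" for i
        using PiE_mem[OF f, of i] PiE_arb[OF f, of i] by simp
      then show "f \<in> PiE UNIV (\<lambda>i. if i < N then A else {undefined})" by (auto simp: PiE_UNIV_domain)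
    qed
    moreover have "compactin (product_topology (\<lambda>_. euclidean) UNIV) \<dots>"
      unfolding compactin_PiE using assms by auto
    ultimately show ?thesis by (simp add: euclidean_product_topology)
  qed
  moreover have "?K \<noteq> {}" using assms by (simp add: PiE_eq_empty_iff)
  moreover have "?K \<subseteq> PiE {..<N} (\<lambda>_. \<Omega>)" using assms by (intro PiE_mono)
  moreover have "lsc_on (PiE {..<N} (\<lambda>_. \<Omega>)) (\<lambda>x. e (?M x) A)"
    using lsc assms unfolding lower_semicontinuous_functional_def by blast
  ultimately have "\<exists>x\<in>?K. \<forall>y\<in>?K. e (?M x) A \<le> e (?M y) A" by (rule lsc_on_attains_inf)
  then obtain x where x: "x \<in> ?K" "\<And>y. y \<in> ?K \<Longrightarrow> e (?M x) A \<le> e (?M y) A" by blast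
  show ?thesis
  proof (intro exI[of _ "?M x"], unfold is_minimizer_def, intro conjI allI impI)
    show "size (?M x) = N" by simp
    show "set_mset (?M x) \<subseteq> A" using x(1) by auto
    fix \<omega> :: "(real ^ 'a) multiset" assume \<omega>: "size \<omega> = N" "set_mset \<omega> \<subseteq> A"
    \<comment> \<open>Every listing of a multiset is a tuple that represents it, so a minimum over
      tuples is a minimum over configurations.\<close>
    obtain xs where xs: "mset xs = \<omega>" using ex_mset by blast
    define y where "y = restrict (\<lambda>i. xs ! i) {..<N}"
    have len: "length xs = N" using xs \<omega> by auto
    have "image_mset y (mset_set {..<N}) = image_mset (\<lambda>i. xs ! i) (mset_set {..<N})"
      by (intro image_mset_cong) (auto simp: y_def)
    also have "\<dots> = mset (map (\<lambda>i. xs ! i) [0..<N])"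
      by (simp add: atLeast0LessThan[symmetric])
    also have "\<dots> = \<omega>" using len xs map_nth[of xs] by simp
    finally have "?M y = \<omega>" .
    moreover have "xs ! i \<in> A" if "i < N" for i
      using \<omega>(2) nth_mem[of i xs] that len unfolding xs[symmetric] by auto
    then have "y \<in> ?K" by (auto simp: y_def)
    ultimately show "e (?M x) A \<le> e \<omega> A" using x(2)[of y] by simp
  qed
qed

text \<open>Degenerate quotients of extended reals are \<open>0\<close> or infinite, hence not near
  \<open>1\<close>. Convergence to \<open>1\<close> therefore yields real nonzero values on both
  sides, and all later estimates can be made in the reals.\<close>

lemma ereal_ratio_near_1:
  fixes a b :: "nat \<Rightarrow> ereal"
  assumes "(\<lambda>N. a N / b N) \<longlonglongrightarrow> 1" "0 < \<epsilon>"
  shows "\<forall>\<^sub>F N in sequentially. \<exists>x y. a N = ereal x \<and> b N = ereal y \<and> x \<noteq> 0 \<and> y \<noteq> 0 \<and> \<bar>x - y\<bar> \<le> \<epsilon> * \<bar>y\<bar>"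
proof -
  define \<eta> where "\<eta> = min \<epsilon> (1/2)"
  have \<eta>: "0 < \<eta>" "\<eta> \<le> 1/2" "\<eta> \<le> \<epsilon>" using assms by (auto simp: \<eta>_def)
  have "\<forall>\<^sub>F N in sequentially. ereal (1 - \<eta>) < a N / b N" "\<forall>\<^sub>F N in sequentially. a N / b N < ereal (1 + \<eta>)"
    using \<eta> by (auto intro!: order_tendstoD[OF assms(1)] simp: one_ereal_def)
  then show ?thesis
  proof eventually_elim
    case (elim N)
    obtain q where q: "a N / b N = ereal q" using elim by (cases "a N / b N") auto
    have q': "\<bar>q - 1\<bar> < \<eta>" "1/2 < q" using elim q \<eta> by auto
    obtain x y where xy: "a N = ereal x" "b N = ereal y" "y \<noteq> 0"
      using q q' by (cases "a N"; cases "b N"; cases "b N = 0") (auto simp: divide_ereal_def zero_ereal_def split: if_splits)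
    have "q = x / y" using q xy by simp
    then have "x - y = (q - 1) * y" using xy by (simp add: field_simps)
    then have "\<bar>x - y\<bar> \<le> \<epsilon> * \<bar>y\<bar>" using q' \<eta> by (simp add: abs_mult mult_right_mono)
    moreover have "x \<noteq> 0" using \<open>q = x / y\<close> q' by auto
    ultimately show ?case using xy by auto
  qed
qed

lemma ereal_ratio_swap:
  fixes a b :: "nat \<Rightarrow> ereal"
  assumes "(\<lambda>N. a N / b N) \<longlonglongrightarrow> 1"
  shows "(\<lambda>N. b N / a N) \<longlonglongrightarrow> 1"
proof -
  have "(\<lambda>N. 1 / (a N / b N)) \<longlonglongrightarrow> 1 / 1"
    by (rule tendsto_inverse_ereal[OF assms]) simp
  moreover have "\<forall>\<^sub>F N in sequentially. 1 / (a N / b N) = b N / a N"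
    using ereal_ratio_near_1[OF assms zero_less_one] by eventually_elim (auto simp: one_ereal_def)
  ultimately show ?thesis by (simp add: tendsto_cong one_ereal_def)
qed

text \<open>The quotient controls \<open>b\<close> up to a factor near \<open>1\<close>, and the
  bound on \<open>S\<close> turns this relative error into an additive one. The coefficient
  \<open>S N\<close> may vary with \<open>N\<close> and may be negative, since tangents can be
  negative.\<close>

lemma ereal_ratio_lower:
  fixes a b :: "nat \<Rightarrow> ereal"
  assumes ratio: "(\<lambda>N. a N / b N) \<longlonglongrightarrow> 1"
    and lower: "\<forall>\<^sub>F N in sequentially. ereal (S N * t N) \<le> a N"
    and t: "\<forall>\<^sub>F N in sequentially. 0 < t N"
    and B: "\<forall>\<^sub>F N in sequentially. \<bar>S N\<bar> \<le> B"
    and "0 < \<epsilon>"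
  shows "\<forall>\<^sub>F N in sequentially. ereal ((S N - \<epsilon>) * t N) \<le> b N"
proof -
  \<comment> \<open>Chosen so that \<open>2 * \<eta> * (\<bar>B\<bar> + 1) \<le> \<epsilon>\<close>.
    The factor \<open>2\<close> serves negative energies, where \<open>1 - \<eta>\<close> is undone
    by \<open>1 + 2 * \<eta>\<close>: the product of these is at least \<open>1\<close> as long as
    \<open>\<eta> \<le> 1/2\<close>.\<close>
  define \<eta> where "\<eta> = min (1/2) (\<epsilon> / (2 * (\<bar>B\<bar> + 1)))"
  have \<eta>: "0 < \<eta>" using assms by (auto simp: \<eta>_def)
  have \<eta>2: "\<eta> \<le> 1/2" unfolding \<eta>_def by (rule min.cobounded1)
  have "\<eta> * (2 * (\<bar>B\<bar> + 1)) \<le> \<epsilon> / (2 * (\<bar>B\<bar> + 1)) * (2 * (\<bar>B\<bar> + 1))"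
    by (intro mult_right_mono) (auto simp: \<eta>_def)
  then have \<eta>B: "2 * \<eta> * (\<bar>B\<bar> + 1) \<le> \<epsilon>" by (simp add: mult_ac)
  show ?thesis using ereal_ratio_near_1[OF ratio \<eta>] lower t B
  proof eventually_elim
    case (elim N)
    then obtain x y where xy: "a N = ereal x" "b N = ereal y" "y \<noteq> 0" "\<bar>x - y\<bar> \<le> \<eta> * \<bar>y\<bar>" by blast
    have S: "S N * t N \<le> x" using elim xy by simp
    have SB: "2 * \<eta> * \<bar>S N\<bar> \<le> \<epsilon>"
    proof -
      have "2 * \<eta> * \<bar>S N\<bar> \<le> 2 * \<eta> * (\<bar>B\<bar> + 1)" using elim \<eta> \<eta>2 by (intro mult_left_mono) auto
      with \<eta>B show ?thesis by linarith
    qed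
    have "\<eta> * \<bar>y\<bar> \<le> 1/2 * \<bar>y\<bar>" using \<eta>2 by (intro mult_right_mono) auto
    then have half: "\<bar>x - y\<bar> \<le> \<bar>y\<bar> / 2" using xy(4) by linarith
    have "(S N - \<epsilon>) * t N \<le> y"
    proof (cases "0 \<le> x")
      case True
      then have y: "0 < y" using half xy(3) by arith
      show ?thesis
      proof (cases "S N \<le> 0")
        case True
        then have "(S N - \<epsilon>) * t N \<le> 0" using elim \<open>0 < \<epsilon>\<close> by (intro mult_nonpos_nonneg) auto
        with y show ?thesis by linarith
      next
        case False
        have "x \<le> (1 + \<eta>) * y" using xy(4) y by (simp add: abs_le_iff algebra_simps)
        then have "(1 - \<eta>) * x \<le> (1 - \<eta>) * ((1 + \<eta>) * y)" using \<eta> \<eta>2 by (intro mult_left_mono) auto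
        also have "\<dots> \<le> y" using y \<eta> by (simp add: algebra_simps)
        finally have "(1 - \<eta>) * x \<le> y" .
        moreover have "(1 - \<eta>) * (S N * t N) \<le> (1 - \<eta>) * x" using S \<eta> \<eta>2 by (intro mult_left_mono) auto
        moreover have "(S N - \<epsilon>) * t N \<le> ((1 - \<eta>) * S N) * t N"
        proof (rule mult_right_mono)
          have "\<eta> * \<bar>S N\<bar> \<le> 2 * \<eta> * \<bar>S N\<bar>" using \<eta> \<eta>2 by (intro mult_right_mono) auto
          then show "S N - \<epsilon> \<le> (1 - \<eta>) * S N" using SB False by (simp add: algebra_simps)
        qed (use elim in auto)
        ultimately show ?thesis by (simp add: mult.assoc)
      qed
    next
      case False
      then have y: "y < 0" using half xy(3) by arith
      have Sn: "S N < 0" using S False elim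
        by (meson linorder_not_less mult_nonneg_nonneg order_trans less_imp_le)
      have "(1 - \<eta>) * (- y) \<le> - x" using xy(4) y by (simp add: abs_le_iff algebra_simps)
      then have "(1 + 2 * \<eta>) * ((1 - \<eta>) * (- y)) \<le> (1 + 2 * \<eta>) * (- x)" using \<eta> \<eta>2 by (intro mult_left_mono) auto
      moreover have "1 * (- y) \<le> ((1 + 2 * \<eta>) * (1 - \<eta>)) * (- y)"
      proof (rule mult_right_mono)
        have "0 \<le> \<eta> * (1 - 2 * \<eta>)" using \<eta> \<eta>2 by (intro mult_nonneg_nonneg) auto
        then show "1 \<le> (1 + 2 * \<eta>) * (1 - \<eta>)" by (simp add: algebra_simps)
      qed (use y in auto)
      ultimately have "(1 + 2 * \<eta>) * x \<le> y" by (simp add: mult.assoc)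
      moreover have "(1 + 2 * \<eta>) * (S N * t N) \<le> (1 + 2 * \<eta>) * x" using S \<eta> \<eta>2 by (intro mult_left_mono) auto
      moreover have "(S N - \<epsilon>) * t N \<le> ((1 + 2 * \<eta>) * S N) * t N"
        using SB Sn elim by (intro mult_right_mono) (auto simp: algebra_simps)
      ultimately show ?thesis by (simp add: mult.assoc)
    qed
    then show ?case using xy by simp
  qed
qed

text \<open>Negating numerator and denominator keeps the quotient and exchanges upper and lower
  bounds.\<close>

lemma ereal_ratio_upper:
  fixes a b :: "nat \<Rightarrow> ereal"
  assumes ratio: "(\<lambda>N. a N / b N) \<longlonglongrightarrow> 1"
    and upper: "\<forall>\<^sub>F N in sequentially. a N \<le> ereal (S * t N)"
    and t: "\<forall>\<^sub>F N in sequentially. 0 < t N"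
    and "0 < \<epsilon>"
  shows "\<forall>\<^sub>F N in sequentially. b N \<le> ereal ((S + \<epsilon>) * t N)"
proof -
  have "\<forall>\<^sub>F N in sequentially. a N / b N = - a N / - b N"
    using ereal_ratio_near_1[OF ratio zero_less_one] by eventually_elim auto
  with ratio have "(\<lambda>N. - a N / - b N) \<longlonglongrightarrow> 1" using tendsto_cong by fast
  moreover have "\<forall>\<^sub>F N in sequentially. ereal (- S * t N) \<le> - a N"
    using upper
  proof eventually_elim
    case (elim N)
    then have "- ereal (S * t N) \<le> - a N" by (simp only: ereal_minus_le_minus)
    then show ?case by (simp del: ereal_minus_le_minus)
  qed
  moreover have "\<forall>\<^sub>F N in sequentially. \<bar>- S\<bar> \<le> \<bar>S\<bar>" by simp
  ultimately have "\<forall>\<^sub>F N in sequentially. ereal ((- S - \<epsilon>) * t N) \<le> - b N"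
    by (rule ereal_ratio_lower[where S = "\<lambda>_. - S" and B = "\<bar>S\<bar>", OF _ _ t _ \<open>0 < \<epsilon>\<close>])
  then show ?thesis
  proof eventually_elim
    case (elim N)
    then have "- (- b N) \<le> - ereal ((- S - \<epsilon>) * t N)" by (simp only: ereal_minus_le_minus)
    then show ?case by (simp add: algebra_simps)
  qed
qed

section \<open>Energy bounds from below\<close>

text \<open>The setting of the theorem, with strict convexity of the limit function already
  converted into an exponent \<open>p\<close> and a matching direction of monotonicity of
  \<open>\<tau>\<close>.\<close>

locale short_range_functional =
  fixes \<Omega> :: "(real ^ 'd) set" and e :: "'d functional"
    and \<tau> :: "real \<Rightarrow> real" and \<zeta> E0 :: real and N0 :: nat and p :: real
  assumes open_dom: "open \<Omega>" and bounded_dom: "bounded \<Omega>" and unit_cube_dom: "unit_cube \<subseteq> \<Omega>"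
    and functional: "interaction_functional \<Omega> N0 E0 e"
    and lsc: "lower_semicontinuous_functional \<Omega> N0 e"
    and \<zeta>_nonzero: "\<zeta> \<noteq> 0"
    and set_mono: "set_monotonic \<Omega> \<tau> \<zeta> e"
    and \<tau>_pos: "\<And>u. 0 < u \<Longrightarrow> 0 < \<tau> u"
    and \<tau>_lim: "\<And>s. 0 < s \<Longrightarrow> ((\<lambda>u. \<tau> (s * u) / \<tau> u) \<longlongrightarrow> s powr p) at_top"
    and \<tau>_mono: "(p < 0 \<and> antimono_on {0<..} \<tau>) \<or> (1 < p \<and> mono_on {0<..} \<tau>)"
    and cube_limit: "\<And>x a. 0 < a \<Longrightarrow> cube x a \<subseteq> \<Omega> \<Longrightarrow> convergent (scaled_energy e \<tau> (cube x a)) \<and>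
           0 < energy_limit e \<tau> (cube x a) \<and> energy_limit e \<tau> (cube x a) < \<infinity>"
    and cube_limit_translate: "\<And>x y a. 0 < a \<Longrightarrow> cube x a \<subseteq> \<Omega> \<Longrightarrow> cube y a \<subseteq> \<Omega> \<Longrightarrow>
           energy_limit e \<tau> (cube x a) = energy_limit e \<tau> (cube y a)"
    and short_range: "short_range \<Omega> N0 \<zeta> e"
    and continuity: "continuity_on_cubes \<Omega> \<tau> \<zeta> e"
begin

section \<open>Scaled energies and eventual inequalities\<close>

lemma \<tau>_pos_sequentially: "\<forall>\<^sub>F N in sequentially. 0 < \<tau> (real N)"
  using eventually_gt_at_top[of 0] by eventually_elim (simp add: \<tau>_pos)

lemma p_cases: "p < 0 \<or> 1 < p"
  using \<tau>_mono by blast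

text \<open>This lemma and the next three exchange limits of extended real quotients for eventual
  inequalities with real multiples of \<open>\<tau> N\<close>, a form in which bounds for several
  pieces can be added.\<close>

lemma liminf_scaled_energyD:
  assumes "ereal l \<le> liminf (scaled_energy e \<tau> A)" "m < l"
  shows "\<forall>\<^sub>F N in sequentially. ereal (m * \<tau> (real N)) \<le> min_energy e A N"
proof -
  have "\<forall>\<^sub>F N in sequentially. ereal m < scaled_energy e \<tau> A N"
    using assms unfolding le_Liminf_iff by simp
  with \<tau>_pos_sequentially show ?thesis
  proof eventually_elim
    case (elim N)
    then have "ereal m * ereal (\<tau> (real N)) < min_energy e A N"
      unfolding scaled_energy_def by (subst (asm) ereal_less_divide_iff) auto
    then show ?case by simp
  qed
qed

lemma liminf_scaled_energyI:
  assumes "\<And>\<epsilon>. 0 < \<epsilon> \<Longrightarrow> \<forall>\<^sub>F N in sequentially. ereal ((l - \<epsilon>) * \<tau> (real N)) \<le> min_energy e A N"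
  shows "ereal l \<le> liminf (scaled_energy e \<tau> A)"
  unfolding le_Liminf_iff
proof (intro allI impI)
  fix y assume y: "y < ereal l"
  obtain m where m: "y < ereal m" "m < l" using ereal_dense2[OF y] by auto
  from assms[of "l - m"] \<tau>_pos_sequentially m(2)
  have "\<forall>\<^sub>F N in sequentially. ereal (m * \<tau> (real N)) \<le> min_energy e A N" by simp
  with \<tau>_pos_sequentially show "\<forall>\<^sub>F N in sequentially. y < scaled_energy e \<tau> A N"
  proof eventually_elim
    case (elim N)
    then have "ereal m \<le> scaled_energy e \<tau> A N"
      unfolding scaled_energy_def by (subst ereal_le_divide_pos) (auto simp: mult.commute)
    with m show ?case by simp
  qed
qed

lemma limsup_scaled_energyD:
  assumes "limsup (scaled_energy e \<tau> A) \<le> ereal u" "u < v"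
  shows "\<forall>\<^sub>F N in sequentially. min_energy e A N \<le> ereal (v * \<tau> (real N))"
proof -
  have "\<forall>\<^sub>F N in sequentially. scaled_energy e \<tau> A N < ereal v"
    using assms unfolding Limsup_le_iff by simp
  with \<tau>_pos_sequentially show ?thesis
  proof eventually_elim
    case (elim N)
    then have "min_energy e A N < ereal v * ereal (\<tau> (real N))"
      unfolding scaled_energy_def by (subst (asm) ereal_divide_less_iff) auto
    then show ?case by simp
  qed
qed

lemma limsup_scaled_energyI:
  assumes "\<And>\<epsilon>. 0 < \<epsilon> \<Longrightarrow> \<forall>\<^sub>F N in sequentially. min_energy e A N \<le> ereal ((u + \<epsilon>) * \<tau> (real N))"
  shows "limsup (scaled_energy e \<tau> A) \<le> ereal u"
  unfolding Limsup_le_iff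
proof (intro allI impI)
  fix y assume y: "y > ereal u"
  obtain m where m: "ereal m < y" "u < m" using ereal_dense2[OF y] by auto
  from assms[of "m - u"] m(2)
  have "\<forall>\<^sub>F N in sequentially. min_energy e A N \<le> ereal (m * \<tau> (real N))" by simp
  with \<tau>_pos_sequentially show "\<forall>\<^sub>F N in sequentially. scaled_energy e \<tau> A N < y"
  proof eventually_elim
    case (elim N)
    then have "scaled_energy e \<tau> A N \<le> ereal m"
      unfolding scaled_energy_def by (subst ereal_divide_le_pos) (auto simp: mult.commute)
    with m show ?case by simp
  qed
qed

lemma min_energy_le: "size \<omega> = N \<Longrightarrow> set_mset \<omega> \<subseteq> A \<Longrightarrow> min_energy e A N \<le> e \<omega> A"
  unfolding min_energy_def by (intro INF_lower) simp

lemma minimizer_energy: "is_minimizer e A N \<omega> \<Longrightarrow> e \<omega> A = min_energy e A N"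
  unfolding min_energy_def is_minimizer_def by (intro antisym INF_greatest INF_lower) auto

lemma minimizer_exists:
  "N0 \<le> N \<Longrightarrow> compact A \<Longrightarrow> A \<subseteq> \<Omega> \<Longrightarrow> A \<noteq> {} \<Longrightarrow> \<exists>\<omega>. is_minimizer e A N \<omega>"
  by (rule ex_minimizer[OF lsc])

lemma N0_pos: "1 \<le> N0"
  using functional by (simp add: interaction_functional_def)

lemma energy_lower_bound:
  "N0 \<le> size \<omega> \<Longrightarrow> set_mset \<omega> \<subseteq> \<Omega> \<Longrightarrow> compact A \<Longrightarrow> A \<subseteq> \<Omega> \<Longrightarrow> ereal E0 \<le> e \<omega> A"
  using functional by (simp add: interaction_functional_def)

lemma short_range_minimizers:
  assumes "finite QQ" "QQ \<noteq> {}" "\<And>Q. Q \<in> QQ \<Longrightarrow> is_cube Q" "\<Union>QQ \<subseteq> \<Omega>"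
    "pairwise (\<lambda>P Q. interior P \<inter> interior Q = {}) QQ" "compact A" "A \<subseteq> \<Omega>"
    "0 < measure lborel (A \<inter> \<Union>QQ)" "\<forall>\<^sub>F N in sequentially. is_minimizer e A N (\<omega> N)"
  shows "(\<lambda>N. (\<Sum>Q\<in>QQ. energy0 N0 e (filter_mset (\<lambda>x. x \<in> Q) (\<omega> N)) (A \<inter> Q)) /
                   energy0 N0 e (filter_mset (\<lambda>x. x \<in> \<Union>QQ) (\<omega> N)) (A \<inter> \<Union>QQ)) \<longlonglongrightarrow> 1"
  using short_range assms unfolding short_range_def by blast

lemma short_range_unions:
  assumes "finite QQ" "QQ \<noteq> {}" "\<And>Q. Q \<in> QQ \<Longrightarrow> is_cube Q" "\<Union>QQ \<subseteq> \<Omega>"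
    "pairwise (\<lambda>P Q. interior P \<inter> interior Q = {}) QQ" "compact A" "A \<subseteq> \<Omega>"
    "\<And>Q. Q \<in> QQ \<Longrightarrow> 0 < measure lborel (A \<inter> Q)"
    "0 < \<zeta> \<Longrightarrow> pairwise (\<lambda>P Q. 0 < setdist P Q) QQ"
    "\<And>Q. Q \<in> QQ \<Longrightarrow> filterlim (n Q) at_top sequentially"
    "\<forall>\<^sub>F N in sequentially. (\<Sum>Q\<in>QQ. n Q N) = N"
    "\<forall>\<^sub>F N in sequentially. \<forall>Q\<in>QQ. is_minimizer e (A \<inter> Q) (n Q N) (\<eta> Q N)"
  shows "(\<lambda>N. (\<Sum>Q\<in>QQ. energy0 N0 e (\<eta> Q N) (A \<inter> Q)) /
                   energy0 N0 e (\<Sum>Q\<in>QQ. \<eta> Q N) (A \<inter> \<Union>QQ)) \<longlonglongrightarrow> 1"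
proof -
  have "(\<forall>Q\<in>QQ. 0 < measure lborel (A \<inter> Q)) \<longrightarrow>
         (0 < \<zeta> \<longrightarrow> pairwise (\<lambda>P Q. 0 < setdist P Q) QQ) \<longrightarrow>
           (\<forall>n \<eta>. (\<forall>Q\<in>QQ. filterlim (n Q) at_top sequentially) \<longrightarrow>
              (\<forall>\<^sub>F N in sequentially. (\<Sum>Q\<in>QQ. n Q N) = N) \<longrightarrow>
              (\<forall>\<^sub>F N in sequentially. \<forall>Q\<in>QQ. is_minimizer e (A \<inter> Q) (n Q N) (\<eta> Q N)) \<longrightarrow>
              (\<lambda>N. (\<Sum>Q\<in>QQ. energy0 N0 e (\<eta> Q N) (A \<inter> Q)) /
                   energy0 N0 e (\<Sum>Q\<in>QQ. \<eta> Q N) (A \<inter> \<Union>QQ))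
              \<longlonglongrightarrow> 1)"
    using short_range assms(1-7) unfolding short_range_def by blast
  then show ?thesis using assms(8-12) by blast
qed

text \<open>The energy of \<open>n N\<close> points is measured against the rate at
  \<open>N\<close>, not at \<open>n N\<close>. No convergence of \<open>n N / N\<close> is assumed,
  which is why the uniform tangent bound for the rate is used.\<close>

lemma min_energy_above_tangent:
  assumes "filterlim n at_top sequentially" "\<And>N. n N \<le> N"
    and "0 < l" "ereal l \<le> liminf (scaled_energy e \<tau> A)" "0 < x" "0 < \<epsilon>"
  shows "\<forall>\<^sub>F N in sequentially.
     ereal ((l * powr_tangent p x (n N / N) - \<epsilon>) * \<tau> (real N)) \<le> min_energy e A (n N)"
proof -
  obtain B where B: "0 < B" "\<And>y. 0 \<le> y \<Longrightarrow> y \<le> 1 \<Longrightarrow> \<bar>powr_tangent p x y\<bar> \<le> B"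
    using powr_tangent_bounded[OF \<open>0 < x\<close>] by metis
  \<comment> \<open>The liminf costs a factor \<open>1 - \<eta>\<close> and the rate an additive
    \<open>\<eta>\<close>. Together they lose at most \<open>l * \<eta> * (1 + B)\<close>, which
    this choice keeps below \<open>\<epsilon>\<close>.\<close>
  define \<eta> where "\<eta> = min (1/2) (\<epsilon> / (l * (1 + B)))"
  have \<eta>: "0 < \<eta>" using assms B by (auto simp: \<eta>_def)
  have \<eta>1: "\<eta> \<le> 1/2" unfolding \<eta>_def by (rule min.cobounded1)
  have \<eta>2: "l * \<eta> * (1 + B) \<le> \<epsilon>"
  proof -
    have "\<eta> \<le> \<epsilon> / (l * (1 + B))" unfolding \<eta>_def by (rule min.cobounded2)
    moreover have "0 < l * (1 + B)" using assms B by simp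
    ultimately have "\<eta> * (l * (1 + B)) \<le> \<epsilon>" by (simp only: pos_le_divide_eq)
    then show ?thesis by (simp add: mult_ac)
  qed
  have "\<forall>\<^sub>F N in sequentially. ereal (l * (1 - \<eta>) * \<tau> (real (n N))) \<le> min_energy e A (n N)"
    using eventually_compose_filterlim[OF liminf_scaled_energyD[OF assms(4), of "l * (1 - \<eta>)"] assms(1)]
      \<open>0 < l\<close> \<eta> by (simp add: mult_less_cancel_left_pos[of l "1 - \<eta>" 1, simplified])
  moreover have "\<forall>\<^sub>F N in sequentially. \<forall>y\<in>{0<..1}. powr_tangent p x y - \<eta> \<le> \<tau> (y * real N) / \<tau> (real N)"
    using eventually_compose_filterlim[OF mono_rate_above_tangent[OF \<tau>_pos \<tau>_lim \<tau>_mono \<open>0 < x\<close> \<eta>]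
        filterlim_real_sequentially] .
  moreover have "\<forall>\<^sub>F N in sequentially. 0 < n N"
    using assms(1) by (rule eventually_compose_filterlim[OF eventually_gt_at_top])
  ultimately show ?thesis using eventually_gt_at_top[of 0]
  proof eventually_elim
    case (elim N)
    define y where "y = real (n N) / real N"
    have y: "0 < y" "y \<le> 1" "y * real N = real (n N)" using elim assms(2)[of N] by (auto simp: y_def)
    have t: "0 < \<tau> (real N)" "0 < \<tau> (real (n N))" using elim \<tau>_pos by auto
    have "powr_tangent p x y - \<eta> \<le> \<tau> (real (n N)) / \<tau> (real N)" using elim y by (metis greaterThanAtMost_iff)
    then have low: "(powr_tangent p x y - \<eta>) * \<tau> (real N) \<le> \<tau> (real (n N))" using t by (simp add: field_simps)
    have "(l * powr_tangent p x y - \<epsilon>) * \<tau> (real N) \<le> l * (1 - \<eta>) * \<tau> (real (n N))"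
    proof (cases "0 \<le> powr_tangent p x y - \<eta>")
      case True
      have "l * \<eta> * (1 + powr_tangent p x y) \<le> l * \<eta> * (1 + B)"
        using assms \<eta> B(2)[of y] y by (intro mult_left_mono) auto
      then have "l * powr_tangent p x y - \<epsilon> \<le> l * (1 - \<eta>) * (powr_tangent p x y - \<eta>) - l * \<eta> * \<eta>"
        using \<eta>2 by (simp add: algebra_simps)
      also have "\<dots> \<le> l * (1 - \<eta>) * (powr_tangent p x y - \<eta>)" using assms \<eta> by simp
      finally have "(l * powr_tangent p x y - \<epsilon>) * \<tau> (real N) \<le>
          l * (1 - \<eta>) * (powr_tangent p x y - \<eta>) * \<tau> (real N)"
        using t by (intro mult_right_mono) auto
      also have "\<dots> \<le> l * (1 - \<eta>) * \<tau> (real (n N))"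
        using low assms \<eta> \<eta>1 unfolding mult.assoc[of "l * (1 - \<eta>)"] by (intro mult_left_mono) auto
      finally show ?thesis .
    next
      case False
      \<comment> \<open>For a negative lower estimate the factor \<open>1 - \<eta>\<close> would act
        in the wrong direction, but then the left side of the claim is nonpositive and the right
        side is nonnegative.\<close>
      then have "l * powr_tangent p x y \<le> l * \<eta>" using assms by (intro mult_left_mono) auto
      also have "\<dots> \<le> l * \<eta> * (1 + B)" using assms \<eta> B by simp
      finally have "l * powr_tangent p x y - \<epsilon> \<le> 0" using \<eta>2 by linarith
      then have "(l * powr_tangent p x y - \<epsilon>) * \<tau> (real N) \<le> 0" using t by (intro mult_nonpos_nonneg) auto
      also have "0 \<le> l * (1 - \<eta>) * \<tau> (real (n N))" using assms \<eta>1 t by (intro mult_nonneg_nonneg) auto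
      finally show ?thesis .
    qed
    then show ?case using elim(1) unfolding y_def by (meson ereal_less_eq(3) order_trans)
  qed
qed

text \<open>Short-range interaction forces points into every cube that meets \<open>A\<close> in
  positive measure: with fewer than \<open>N0\<close> points in it, the quotient for this single
  cube would be \<open>0 / 0\<close>. Splitting off two disjoint subcubes of the same kind doubles
  the guaranteed number of points.\<close>

lemma minimizer_count_at_top:
  assumes "compact A" "A \<subseteq> \<Omega>" "\<forall>\<^sub>F N in sequentially. is_minimizer e A N (\<omega> N)"
    and "is_cube Q" "Q \<subseteq> \<Omega>" "0 < measure lborel (A \<inter> Q)"
  shows "filterlim (\<lambda>N. size (filter_mset (\<lambda>x. x \<in> Q) (\<omega> N))) at_top sequentially"
proof -
  have *: "\<forall>\<^sub>F N in sequentially. 2 ^ k \<le> size (filter_mset (\<lambda>x. x \<in> Q) (\<omega> N))"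
    if "is_cube Q" "Q \<subseteq> \<Omega>" "0 < measure lborel (A \<inter> Q)" for k Q
    using that
  proof (induction k arbitrary: Q)
    case 0
    \<comment> \<open>For a single cube, numerator and denominator coincide; that the quotient tends
      to \<open>1\<close> says precisely that this energy is eventually real and nonzero.\<close>
    have "(\<lambda>N. (\<Sum>Q\<in>{Q}. energy0 N0 e (filter_mset (\<lambda>x. x \<in> Q) (\<omega> N)) (A \<inter> Q)) /
               energy0 N0 e (filter_mset (\<lambda>x. x \<in> \<Union>{Q}) (\<omega> N)) (A \<inter> \<Union>{Q})) \<longlonglongrightarrow> 1"
      using 0 assms by (intro short_range_minimizers) auto
    from ereal_ratio_near_1[OF this zero_less_one]
    show ?case
    proof eventually_elim
      case (elim N)
      then have "energy0 N0 e (filter_mset (\<lambda>x. x \<in> Q) (\<omega> N)) (A \<inter> Q) \<noteq> 0" by (auto simp: zero_ereal_def)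
      then have "N0 \<le> size (filter_mset (\<lambda>x. x \<in> Q) (\<omega> N))" by (auto simp: energy0_def split: if_splits)
      with N0_pos show ?case by simp
    qed
  next
    case (Suc k)
    obtain P R where PR: "is_cube P" "is_cube R" "P \<subseteq> Q" "R \<subseteq> Q" "P \<inter> R = {}"
      "0 < measure lborel (A \<inter> P)" "0 < measure lborel (A \<inter> R)"
      using two_disjoint_subcubes[OF assms(1) Suc.prems(1,3)] by metis
    have "\<forall>\<^sub>F N in sequentially. 2 ^ k \<le> size (filter_mset (\<lambda>x. x \<in> P) (\<omega> N))"
      "\<forall>\<^sub>F N in sequentially. 2 ^ k \<le> size (filter_mset (\<lambda>x. x \<in> R) (\<omega> N))"
      using PR Suc.prems by (auto intro!: Suc.IH)
    then show ?case
    proof eventually_elim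
      case (elim N)
      have "filter_mset (\<lambda>x. x \<in> P) (\<omega> N) + filter_mset (\<lambda>x. x \<in> R) (\<omega> N) \<subseteq># filter_mset (\<lambda>x. x \<in> Q) (\<omega> N)"
        using PR by (auto simp: subseteq_mset_def)
      from size_mset_mono[OF this] elim show ?case by simp
    qed
  qed
  show ?thesis unfolding filterlim_at_top
  proof
    fix Z :: nat
    have "Z \<le> 2 ^ Z" by (simp add: less_imp_le)
    show "\<forall>\<^sub>F N in sequentially. Z \<le> size (filter_mset (\<lambda>x. x \<in> Q) (\<omega> N))"
      using *[OF assms(4-6), of Z] by (rule eventually_mono) (rule order_trans[OF \<open>Z \<le> 2 ^ Z\<close>])
  qed
qed

text \<open>Since \<open>2 powr p > 2\<close>, doubling a large argument more than doubles the rate.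
  A constant lower bound of the energy is thus negligible against the rate.\<close>

lemma \<tau>_at_top:
  assumes "1 < p"
  shows "filterlim (\<lambda>N. \<tau> (real N)) at_top sequentially"
proof -
  have mono: "mono_on {0<..} \<tau>" using \<tau>_mono assms by auto
  have "2 powr 1 < 2 powr p" using assms by (intro powr_less_mono) auto
  then have "\<forall>\<^sub>F u in at_top. 2 < \<tau> (2 * u) / \<tau> u"
    by (intro order_tendstoD(1)[OF \<tau>_lim]) auto
  then obtain u0 where u0: "\<And>u. u0 \<le> u \<Longrightarrow> 2 < \<tau> (2 * u) / \<tau> u" unfolding eventually_at_top_linorder by blast
  define v where "v = max u0 1"
  have v: "0 < v" "u0 \<le> v" by (auto simp: v_def)
  have pow: "2 ^ k * \<tau> v \<le> \<tau> (2 ^ k * v)" for k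
  proof (induction k)
    case (Suc k)
    have "v \<le> 2 ^ k * v" using v by simp
    then have "2 < \<tau> (2 * (2 ^ k * v)) / \<tau> (2 ^ k * v)" using v by (intro u0) linarith
    moreover have "0 < \<tau> (2 ^ k * v)" using v by (intro \<tau>_pos) auto
    ultimately have "2 * \<tau> (2 ^ k * v) < \<tau> (2 * (2 ^ k * v))" by (simp add: field_simps)
    then show ?case using Suc by (simp add: mult.assoc)
  qed simp
  show ?thesis unfolding filterlim_at_top
  proof
    fix C :: real
    obtain k where "C / \<tau> v < 2 ^ k" using real_arch_pow[of 2] by auto
    then have k: "C \<le> 2 ^ k * \<tau> v" using \<tau>_pos[OF v(1)] by (simp add: field_simps)
    have "\<forall>\<^sub>F N in sequentially. 2 ^ k * v \<le> real N"
      using filterlim_real_sequentially by (auto simp: filterlim_at_top)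
    then show "\<forall>\<^sub>F N in sequentially. C \<le> \<tau> (real N)"
    proof eventually_elim
      case (elim N)
      have "0 < 2 ^ k * v" using v by simp
      then have "\<tau> (2 ^ k * v) \<le> \<tau> (real N)" using elim by (intro monotone_onD[OF mono]) auto
      with k pow[of k] show ?case by linarith
    qed
  qed
qed

text \<open>A piece without a useful estimate still cannot have very negative energy:
  \<open>E0\<close> is either negligible against a growing rate or zero. The minimum of
  \<open>0\<close> and \<open>E0\<close> appears because a piece with too few points counts as
  \<open>0\<close>.\<close>

lemma energy0_lower_bound:
  assumes "1 < p \<or> E0 = 0" "0 < \<delta>"
    and "\<forall>\<^sub>F N in sequentially. set_mset (\<omega> N) \<subseteq> \<Omega>" "compact A" "A \<subseteq> \<Omega>"
  shows "\<forall>\<^sub>F N in sequentially. ereal (- \<delta> * \<tau> (real N)) \<le> energy0 N0 e (\<omega> N) A"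
proof -
  have "\<forall>\<^sub>F N in sequentially. - \<delta> * \<tau> (real N) \<le> min 0 E0"
    using assms(1)
  proof
    assume "1 < p"
    then have "\<forall>\<^sub>F N in sequentially. \<bar>E0\<bar> / \<delta> \<le> \<tau> (real N)"
      using \<tau>_at_top by (auto simp: filterlim_at_top)
    then show ?thesis
    proof eventually_elim
      case (elim N)
      then have "\<bar>E0\<bar> \<le> \<delta> * \<tau> (real N)" using \<open>0 < \<delta>\<close> by (simp add: field_simps)
      then show ?case by arith
    qed
  next
    assume "E0 = 0"
    then show ?thesis using \<tau>_pos_sequentially \<open>0 < \<delta>\<close> by (auto elim: eventually_mono)
  qed
  with assms(3) show ?thesis
  proof eventually_elim
    case (elim N)
    have "ereal (min 0 E0) \<le> energy0 N0 e (\<omega> N) A"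
    proof (cases "N0 \<le> size (\<omega> N)")
      case True
      then have "ereal E0 \<le> energy0 N0 e (\<omega> N) A"
        using energy_lower_bound elim assms(4,5) by (simp add: energy0_def)
      then show ?thesis by (meson ereal_less_eq(3) min.cobounded2 order_trans)
    next
      case False
      have "ereal (min 0 E0) \<le> ereal 0" by (simp only: ereal_less_eq min.cobounded1)
      then show ?thesis using False by (simp add: energy0_def zero_ereal_def del: ereal_min)
    qed
    moreover have "ereal (- \<delta> * \<tau> (real N)) \<le> ereal (min 0 E0)" using elim by simp
    ultimately show ?case by (rule order_trans[rotated])
  qed
qed

text \<open>Linear minorants of \<open>s \<mapsto> s powr p\<close> replace the
  passage to subsequences along which the fractions of points converge.\<close>

lemma min_energy_lower_bound:
  fixes G :: "'i \<Rightarrow> (real ^ 'd) set set"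
  assumes A: "compact A" "A \<subseteq> \<Omega>" "\<forall>\<^sub>F N in sequentially. is_minimizer e A N (\<omega> N)"
    and QQ: "finite QQ" "\<And>Q. Q \<in> QQ \<Longrightarrow> is_cube Q" "\<Union>QQ \<subseteq> \<Omega>"
      "pairwise (\<lambda>P Q. interior P \<inter> interior Q = {}) QQ" "A \<subseteq> \<Union>QQ"
    and I: "finite I" "I \<noteq> {}" "\<And>i. i \<in> I \<Longrightarrow> G i \<subseteq> QQ" "disjoint_family_on G I"
    and pos: "\<And>i. i \<in> I \<Longrightarrow> 0 < measure lborel (A \<inter> \<Union>(G i))"
    and l: "\<And>i. i \<in> I \<Longrightarrow> 0 < l i" "\<And>i. i \<in> I \<Longrightarrow> ereal (l i) \<le> liminf (scaled_energy e \<tau> (A \<inter> \<Union>(G i)))"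
    and x: "\<And>i. i \<in> I \<Longrightarrow> 0 < x i"
    and rest: "(\<Union>i\<in>I. G i) = QQ \<or> 1 < p \<or> E0 = 0"
    and "0 < \<epsilon>"
  shows "\<forall>\<^sub>F N in sequentially.
    ereal (((\<Sum>i\<in>I. l i * powr_tangent p (x i) (size (filter_mset (\<lambda>x. x \<in> \<Union>(G i)) (\<omega> N)) / N)) - \<epsilon>) * \<tau> (real N))
      \<le> min_energy e A N"
proof -
  define U where "U i = \<Union>(G i)" for i
  \<comment> \<open>For finitely many \<open>N\<close> the configuration need not be a minimizer and
    could be too large; the truncation keeps the fraction in the unit interval for every
    \<open>N\<close>.\<close>
  define n where "n i N = min N (size (filter_mset (\<lambda>x. x \<in> U i) (\<omega> N)))" for i N
  define a where "a Q N = energy0 N0 e (filter_mset (\<lambda>x. x \<in> Q) (\<omega> N)) (A \<inter> Q)" for Q N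
  define b where "b i N = energy0 N0 e (filter_mset (\<lambda>x. x \<in> U i) (\<omega> N)) (A \<inter> U i)" for i N
  define S where "S i N = l i * powr_tangent p (x i) (n i N / N)" for i N
  have min_ev: "\<forall>\<^sub>F N in sequentially. size (\<omega> N) = N \<and> set_mset (\<omega> N) \<subseteq> A \<and> e (\<omega> N) A = min_energy e A N \<and> N0 \<le> N"
    using A(3) eventually_ge_at_top[of N0]
  proof eventually_elim
    case (elim N)
    then show ?case using minimizer_energy[of A N "\<omega> N"] by (auto simp: is_minimizer_def)
  qed
  have n_eq: "\<forall>\<^sub>F N in sequentially. \<forall>i. n i N = size (filter_mset (\<lambda>x. x \<in> U i) (\<omega> N))"
    using min_ev
  proof eventually_elim
    case (elim N)
    have "size (filter_mset (\<lambda>x. x \<in> U i) (\<omega> N)) \<le> N" for i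
      using elim size_filter_mset_lesseq[of _ "\<omega> N"] by metis
    then show ?case unfolding n_def by (intro allI min_absorb2)
  qed
  have compQ: "compact (A \<inter> Q)" "A \<inter> Q \<subseteq> \<Omega>" if "Q \<in> QQ" for Q
    using that QQ(2) A is_cube_compact by (auto intro: compact_Int)
  have finG: "finite (G i)" if "i \<in> I" for i using I QQ that finite_subset by metis
  have S_bdd: "\<exists>B. \<forall>N. \<bar>S i N\<bar> \<le> B" if i: "i \<in> I" for i
  proof -
    obtain B where B: "0 < B" "\<And>y. 0 \<le> y \<Longrightarrow> y \<le> 1 \<Longrightarrow> \<bar>powr_tangent p (x i) y\<bar> \<le> B"
      using powr_tangent_bounded[OF x[OF i]] by metis
    have "\<bar>S i N\<bar> \<le> l i * B" for N
    proof -
      have "real (n i N) / real N \<le> 1" by (cases "N = 0") (auto simp: n_def divide_le_eq_1)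
      then show ?thesis using B(2)[of "n i N / N"] l(1)[OF i] by (simp add: S_def abs_mult)
    qed
    then show ?thesis by blast
  qed
  \<comment> \<open>Half of \<open>\<epsilon>\<close> is distributed over the groups and the cubes
    outside all groups, with a loss of \<open>\<delta>\<close> for each; the other half pays for the
    last quotient.\<close>
  define \<delta> where "\<delta> = \<epsilon> / (2 * (real (card I) + real (card QQ) + 1))"
  have \<delta>: "0 < \<delta>" using \<open>0 < \<epsilon>\<close> by (auto simp: \<delta>_def)
  have group: "\<forall>\<^sub>F N in sequentially. ereal ((S i N - \<delta>) * \<tau> (real N)) \<le> (\<Sum>Q\<in>G i. a Q N)" if i: "i \<in> I" for i
  proof -
    have "A \<inter> \<Union>(G i) \<noteq> {}" using pos[OF i] by auto
    then have Gne: "G i \<noteq> {}" by auto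
    \<comment> \<open>Short-range interaction enters twice. Within one group it replaces the sum
      over its cubes by the energy on the union, for which a limit energy is known.\<close>
    have ratio: "(\<lambda>N. (\<Sum>Q\<in>G i. a Q N) / b i N) \<longlonglongrightarrow> 1"
      unfolding a_def b_def U_def
      using I(3)[OF i] QQ A pos[OF i] finG[OF i] Gne
      by (intro short_range_minimizers) (auto intro: pairwise_subset)
    have n_top: "filterlim (n i) at_top sequentially"
    proof -
      have "\<exists>Q\<in>G i. 0 < measure lborel (A \<inter> Q)"
      proof (rule ccontr)
        assume "\<not> ?thesis"
        then have "measure lborel (A \<inter> Q) = 0" if "Q \<in> G i" for Q
          using that by (metis measure_nonneg order_le_less)
        moreover have "measure lborel (A \<inter> \<Union>(G i)) = (\<Sum>Q\<in>G i. measure lborel (A \<inter> Q))"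
          using A(1) finG[OF i] QQ I(3)[OF i]
          by (intro measure_Int_Union_cubes) (auto intro: pairwise_subset)
        ultimately show False using pos[OF i] by simp
      qed
      then obtain Q where Q: "Q \<in> G i" "0 < measure lborel (A \<inter> Q)" by blast
      then have "Q \<in> QQ" using I(3)[OF i] by auto
      then have top: "filterlim (\<lambda>N. size (filter_mset (\<lambda>x. x \<in> Q) (\<omega> N))) at_top sequentially"
        using Q QQ A by (intro minimizer_count_at_top[OF A]) auto
      have "\<forall>\<^sub>F N in sequentially. size (filter_mset (\<lambda>x. x \<in> Q) (\<omega> N)) \<le> n i N"
        using n_eq
      proof eventually_elim
        case (elim N)
        have "filter_mset (\<lambda>x. x \<in> Q) (\<omega> N) \<subseteq># filter_mset (\<lambda>x. x \<in> U i) (\<omega> N)"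
          using Q(1) by (auto simp: U_def subseteq_mset_def)
        from size_mset_mono[OF this] elim show ?case by simp
      qed
      with top show ?thesis by (rule filterlim_at_top_mono)
    qed
    have "\<forall>\<^sub>F N in sequentially. ereal ((S i N - \<delta>/2) * \<tau> (real N)) \<le> min_energy e (A \<inter> U i) (n i N)"
      unfolding S_def using \<delta> l i x
      by (intro min_energy_above_tangent n_top) (auto simp: n_def U_def)
    moreover have "\<forall>\<^sub>F N in sequentially. N0 \<le> n i N" using n_top by (auto simp: filterlim_at_top)
    ultimately have "\<forall>\<^sub>F N in sequentially. ereal ((S i N - \<delta>/2) * \<tau> (real N)) \<le> b i N"
      using n_eq min_ev
    proof eventually_elim
      case (elim N)
      have "min_energy e (A \<inter> U i) (n i N) \<le> e (filter_mset (\<lambda>x. x \<in> U i) (\<omega> N)) (A \<inter> U i)"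
        using elim by (intro min_energy_le) auto
      moreover have "N0 \<le> size (filter_mset (\<lambda>x. x \<in> U i) (\<omega> N))" using elim by simp
      ultimately show ?case using elim(1) by (simp add: b_def energy0_def)
    qed
    moreover obtain B where B: "\<And>N. \<bar>S i N\<bar> \<le> B" using S_bdd[OF i] by blast
    have "\<bar>S i N - \<delta>/2\<bar> \<le> B + \<delta>" for N using B[of N] \<delta> by arith
    ultimately have "\<forall>\<^sub>F N in sequentially. ereal ((S i N - \<delta>/2 - \<delta>/2) * \<tau> (real N)) \<le> (\<Sum>Q\<in>G i. a Q N)"
      using \<delta> \<tau>_pos_sequentially by (intro ereal_ratio_lower[where B = "B + \<delta>", OF ereal_ratio_swap[OF ratio]]) auto
    then show ?thesis by simp
  qed
  \<comment> \<open>Cubes in no group contribute only the trivial lower bound.\<close>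
  define R where "R = QQ - (\<Union>i\<in>I. G i)"
  have resid: "\<forall>\<^sub>F N in sequentially. ereal (- \<delta> * \<tau> (real N)) \<le> a Q N" if "Q \<in> R" for Q
  proof -
    have "1 < p \<or> E0 = 0" using rest that by (auto simp: R_def)
    moreover have "Q \<in> QQ" using that by (simp add: R_def)
    moreover have "\<forall>\<^sub>F N in sequentially. set_mset (filter_mset (\<lambda>x. x \<in> Q) (\<omega> N)) \<subseteq> \<Omega>"
      using min_ev A(2) by (auto elim!: eventually_mono)
    ultimately show ?thesis unfolding a_def using \<delta> compQ by (intro energy0_lower_bound) auto
  qed
  have fR: "finite R" using QQ by (simp add: R_def)
  have sum_lower: "\<forall>\<^sub>F N in sequentially. ereal (((\<Sum>i\<in>I. S i N) - \<epsilon>/2) * \<tau> (real N)) \<le> (\<Sum>Q\<in>QQ. a Q N)"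
  proof -
    have "\<forall>\<^sub>F N in sequentially. \<forall>i\<in>I. ereal ((S i N - \<delta>) * \<tau> (real N)) \<le> (\<Sum>Q\<in>G i. a Q N)"
      using I(1) group by (intro eventually_ball_finite) auto
    moreover have "\<forall>\<^sub>F N in sequentially. \<forall>Q\<in>R. ereal (- \<delta> * \<tau> (real N)) \<le> a Q N"
      using fR resid by (intro eventually_ball_finite) auto
    ultimately show ?thesis using \<tau>_pos_sequentially
    proof eventually_elim
      case (elim N)
      have "(\<Sum>Q\<in>QQ. a Q N) = (\<Sum>Q\<in>(\<Union>i\<in>I. G i). a Q N) + (\<Sum>Q\<in>R. a Q N)"
      proof -
        have "(\<Union>i\<in>I. G i) \<union> R = QQ" using I(3) by (auto simp: R_def)
        then show ?thesis using sum.union_disjoint[of "\<Union>i\<in>I. G i" R "\<lambda>Q. a Q N"] fR I(1) finG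
          by (auto simp: R_def)
      qed
      also have "(\<Sum>Q\<in>(\<Union>i\<in>I. G i). a Q N) = (\<Sum>i\<in>I. \<Sum>Q\<in>G i. a Q N)"
        using I finG by (intro sum.UNION_disjoint) (auto simp: disjoint_family_on_def)
      finally have eq: "(\<Sum>Q\<in>QQ. a Q N) = (\<Sum>i\<in>I. \<Sum>Q\<in>G i. a Q N) + (\<Sum>Q\<in>R. a Q N)" .
      have "(\<Sum>i\<in>I. ereal ((S i N - \<delta>) * \<tau> (real N))) + (\<Sum>Q\<in>R. ereal (- \<delta> * \<tau> (real N))) \<le> (\<Sum>Q\<in>QQ. a Q N)"
        unfolding eq using elim by (intro add_mono sum_mono) auto
      also have "(\<Sum>i\<in>I. ereal ((S i N - \<delta>) * \<tau> (real N))) + (\<Sum>Q\<in>R. ereal (- \<delta> * \<tau> (real N))) =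
          ereal ((\<Sum>i\<in>I. (S i N - \<delta>) * \<tau> (real N)) + (\<Sum>Q\<in>R. - \<delta> * \<tau> (real N)))"
        by simp
      also have "(\<Sum>i\<in>I. (S i N - \<delta>) * \<tau> (real N)) + (\<Sum>Q\<in>R. - \<delta> * \<tau> (real N)) =
          ((\<Sum>i\<in>I. S i N) - (real (card I) + real (card R)) * \<delta>) * \<tau> (real N)"
        by (simp add: sum_distrib_right[symmetric] sum_subtractf algebra_simps)
      finally have *: "ereal (((\<Sum>i\<in>I. S i N) - (real (card I) + real (card R)) * \<delta>) * \<tau> (real N)) \<le> (\<Sum>Q\<in>QQ. a Q N)" .
      have "card R \<le> card QQ" using QQ by (auto simp: R_def intro!: card_mono)
      then have "(real (card I) + real (card R)) * \<delta> \<le> (real (card I) + real (card QQ) + 1) * \<delta>"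
        using \<delta> by (intro mult_right_mono) auto
      also have "\<dots> = \<epsilon> / 2" by (simp add: \<delta>_def field_simps add_nonneg_eq_0_iff)
      finally have "((\<Sum>i\<in>I. S i N) - \<epsilon>/2) * \<tau> (real N) \<le> ((\<Sum>i\<in>I. S i N) - (real (card I) + real (card R)) * \<delta>) * \<tau> (real N)"
        using elim by (intro mult_right_mono) auto
      with * show ?case by (meson ereal_less_eq(3) order_trans)
    qed
  qed
  have "A \<inter> \<Union>QQ = A" using QQ by auto
  have QQne: "QQ \<noteq> {}" "0 < measure lborel (A \<inter> \<Union>QQ)"
  proof -
    obtain i where i: "i \<in> I" using I by auto
    have "measure lborel (A \<inter> \<Union>(G i)) \<le> measure lborel A"
      using A compact_Union_cubes[of "G i"] finG[OF i] I(3)[OF i] QQ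
      by (intro measure_mono_compact borel_compact compact_Int) auto
    with pos[OF i] \<open>A \<inter> \<Union>QQ = A\<close> show "0 < measure lborel (A \<inter> \<Union>QQ)" by simp
    then show "QQ \<noteq> {}" by auto
  qed
  \<comment> \<open>The second use, for all cubes together: they cover \<open>A\<close>, so the
    denominator is the energy of the whole minimizer.\<close>
  have "(\<lambda>N. (\<Sum>Q\<in>QQ. a Q N) / energy0 N0 e (filter_mset (\<lambda>x. x \<in> \<Union>QQ) (\<omega> N)) (A \<inter> \<Union>QQ)) \<longlonglongrightarrow> 1"
    unfolding a_def using QQ A QQne by (intro short_range_minimizers) auto
  moreover have "\<forall>\<^sub>F N in sequentially.
      (\<Sum>Q\<in>QQ. a Q N) / energy0 N0 e (filter_mset (\<lambda>x. x \<in> \<Union>QQ) (\<omega> N)) (A \<inter> \<Union>QQ) =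
      (\<Sum>Q\<in>QQ. a Q N) / min_energy e A N"
    using min_ev
  proof eventually_elim
    case (elim N)
    have "filter_mset (\<lambda>x. x \<in> \<Union>QQ) (\<omega> N) = \<omega> N" using elim QQ(5) by (intro filter_mset_eq_conv[THEN iffD2]) auto
    then show ?case using elim \<open>A \<inter> \<Union>QQ = A\<close> by (simp add: energy0_def)
  qed
  ultimately have ratio: "(\<lambda>N. (\<Sum>Q\<in>QQ. a Q N) / min_energy e A N) \<longlonglongrightarrow> 1"
    using tendsto_cong by fast
  obtain B where B: "\<And>i N. i \<in> I \<Longrightarrow> \<bar>S i N\<bar> \<le> B i" using S_bdd by metis
  have "\<bar>(\<Sum>i\<in>I. S i N) - \<epsilon>/2\<bar> \<le> (\<Sum>i\<in>I. B i) + \<epsilon>" for N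
  proof -
    have "\<bar>\<Sum>i\<in>I. S i N\<bar> \<le> (\<Sum>i\<in>I. B i)" using B by (intro order_trans[OF sum_abs] sum_mono) auto
    then show ?thesis using \<open>0 < \<epsilon>\<close> by arith
  qed
  then have "\<forall>\<^sub>F N in sequentially. ereal (((\<Sum>i\<in>I. S i N) - \<epsilon>/2 - \<epsilon>/2) * \<tau> (real N)) \<le> min_energy e A N"
    using \<open>0 < \<epsilon>\<close> \<tau>_pos_sequentially sum_lower by (intro ereal_ratio_lower[where B = "(\<Sum>i\<in>I. B i) + \<epsilon>", OF ratio]) auto
  with n_eq show ?thesis
  proof eventually_elim
    case (elim N)
    then show ?case by (simp add: S_def U_def)
  qed
qed

end

section \<open>Unions of equal cubes\<close>

lemma size_filter_mset_Union_le:
  assumes "finite QQ"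
  shows "size (filter_mset (\<lambda>x. x \<in> \<Union>QQ) \<omega>) \<le> (\<Sum>Q\<in>QQ. size (filter_mset (\<lambda>x. x \<in> Q) \<omega>))"
  using assms
proof (induction QQ)
  case (insert Q QQ)
  have "filter_mset (\<lambda>x. x \<in> \<Union>(insert Q QQ)) \<omega> \<subseteq>#
      filter_mset (\<lambda>x. x \<in> Q) \<omega> + filter_mset (\<lambda>x. x \<in> \<Union>QQ) \<omega>"
    by (auto simp: subseteq_mset_def)
  from size_mset_mono[OF this] insert show ?case by simp
qed simp

lemma size_filter_mset_disjoint_Union:
  assumes "finite QQ" "pairwise disjnt QQ"
  shows "(\<Sum>Q\<in>QQ. size (filter_mset (\<lambda>x. x \<in> Q) \<omega>)) = size (filter_mset (\<lambda>x. x \<in> \<Union>QQ) \<omega>)"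
  using assms
proof (induction QQ)
  case (insert Q QQ)
  then have "Q \<inter> \<Union>QQ = {}" by (force simp: pairwise_insert disjnt_def)
  then have "filter_mset (\<lambda>x. x \<in> \<Union>(insert Q QQ)) \<omega> =
      filter_mset (\<lambda>x. x \<in> Q) \<omega> + filter_mset (\<lambda>x. x \<in> \<Union>QQ) \<omega>"
    by (intro multiset_eqI) auto
  then show ?case using insert by (simp add: pairwise_insert)
qed simp

lemma size_sum_mset_family: "size (\<Sum>i\<in>I. f i :: 'a multiset) = (\<Sum>i\<in>I. size (f i))"
  by (induction I rule: infinite_finite_induct) auto

lemma pairwise_disjnt_interiors:
  "pairwise disjnt QQ \<Longrightarrow> pairwise (\<lambda>P Q. interior P \<inter> interior Q = {}) QQ"
  unfolding pairwise_def disjnt_def using interior_subset by blast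

context short_range_functional
begin

lemma minimizer_sequence:
  assumes "compact A" "A \<subseteq> \<Omega>" "A \<noteq> {}"
  obtains \<omega> where "\<And>N. N0 \<le> N \<Longrightarrow> is_minimizer e A N (\<omega> N)"
  using minimizer_exists[OF _ assms] by metis

text \<open>All tangents are taken at the equal share \<open>1 / M\<close>. Their sum then depends
  on the fractions only through the total \<open>T\<close>, and the deviation from the optimal value
  has the sign of \<open>p * (T - 1)\<close>.\<close>

lemma liminf_equal_cubes:
  assumes QQ: "finite QQ" "QQ \<noteq> {}" "\<And>Q. Q \<in> QQ \<Longrightarrow> is_cube Q" "\<Union>QQ \<subseteq> \<Omega>"
      "pairwise (\<lambda>P Q. interior P \<inter> interior Q = {}) QQ"
    and A: "compact A" "\<And>Q. Q \<in> QQ \<Longrightarrow> 0 < measure lborel (A \<inter> Q)"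
    and l: "0 < l" "\<And>Q. Q \<in> QQ \<Longrightarrow> ereal l \<le> liminf (scaled_energy e \<tau> (A \<inter> Q))"
    and disj: "1 < p \<or> pairwise disjnt QQ"
  shows "ereal (real (card QQ) powr (1 - p) * l) \<le> liminf (scaled_energy e \<tau> (A \<inter> \<Union>QQ))"
proof -
  define A' where "A' = A \<inter> \<Union>QQ"
  have AQ: "A' \<inter> Q = A \<inter> Q" if "Q \<in> QQ" for Q using that by (auto simp: A'_def)
  have A': "compact A'" "A' \<subseteq> \<Omega>" using A QQ compact_Union_cubes[of QQ] by (auto simp: A'_def intro: compact_Int)
  obtain Q0 where Q0: "Q0 \<in> QQ" using QQ by auto
  have "A \<inter> Q0 \<noteq> {}" using A(2)[OF Q0] by auto
  then have "A' \<noteq> {}" using Q0 by (auto simp: A'_def)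
  then obtain \<omega> where \<omega>: "\<And>N. N0 \<le> N \<Longrightarrow> is_minimizer e A' N (\<omega> N)"
    using minimizer_sequence[OF A'] by metis
  have min_ev: "\<forall>\<^sub>F N in sequentially. is_minimizer e A' N (\<omega> N)"
    using eventually_ge_at_top[of N0] by eventually_elim (rule \<omega>)
  define M where "M = real (card QQ)"
  have M: "0 < M" using QQ by (simp add: M_def card_gt_0_iff)
  define n where "n Q N = size (filter_mset (\<lambda>x. x \<in> Q) (\<omega> N))" for Q N
  \<comment> \<open>Each cube forms a group of its own.\<close>
  have lower: "\<forall>\<^sub>F N in sequentially.
    ereal (((\<Sum>Q\<in>QQ. l * powr_tangent p (1 / M) (n Q N / N)) - \<epsilon>) * \<tau> (real N)) \<le> min_energy e A' N"
    if "0 < \<epsilon>" for \<epsilon>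
    using min_energy_lower_bound[OF A' min_ev QQ(1,3,4,5), of QQ "\<lambda>Q. {Q}" "\<lambda>_. l" "\<lambda>_. 1 / M" \<epsilon>]
      that QQ A AQ l M by (simp add: A'_def n_def disjoint_family_on_def)
  show ?thesis unfolding A'_def[symmetric]
  proof (rule liminf_scaled_energyI)
    fix \<epsilon> :: real assume "0 < \<epsilon>"
    show "\<forall>\<^sub>F N in sequentially. ereal ((real (card QQ) powr (1 - p) * l - \<epsilon>) * \<tau> (real N)) \<le> min_energy e A' N"
      using lower[OF \<open>0 < \<epsilon>\<close>] min_ev \<tau>_pos_sequentially eventually_gt_at_top[of 0]
    proof eventually_elim
      case (elim N)
      have \<omega>N: "size (\<omega> N) = N" "set_mset (\<omega> N) \<subseteq> \<Union>QQ" using elim(2) by (auto simp: is_minimizer_def A'_def)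
      then have all: "filter_mset (\<lambda>x. x \<in> \<Union>QQ) (\<omega> N) = \<omega> N" by (intro filter_mset_eq_conv[THEN iffD2]) auto
      define T where "T = (\<Sum>Q\<in>QQ. n Q N / N)"
      have T: "T = real (\<Sum>Q\<in>QQ. n Q N) / N" by (simp add: T_def sum_divide_distrib)
      have "0 \<le> p * (T - 1)"
        using disj
      proof
        assume "1 < p"
        have "N \<le> (\<Sum>Q\<in>QQ. n Q N)"
          using size_filter_mset_Union_le[OF QQ(1), of "\<omega> N"] \<omega>N all by (simp add: n_def)
        then have "real N \<le> real (\<Sum>Q\<in>QQ. n Q N)" by (simp only: of_nat_le_iff)
        then have "1 \<le> T" using elim by (simp add: T field_simps)
        with \<open>1 < p\<close> show ?thesis by simp
      next
        assume "pairwise disjnt QQ"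
        then have "T = 1"
          using size_filter_mset_disjoint_Union[OF QQ(1), of "\<omega> N"] \<omega>N all elim by (simp add: n_def T)
        then show ?thesis by simp
      qed
      have "(\<Sum>Q\<in>QQ. l * powr_tangent p (1 / M) (n Q N / N)) =
          l * (M * (1 / M) powr p + (\<Sum>Q\<in>QQ. p * (1 / M) powr (p - 1) * (n Q N / N - 1 / M)))"
        by (simp add: powr_tangent_def sum_distrib_left[symmetric] sum.distrib M_def)
      also have "(\<Sum>Q\<in>QQ. p * (1 / M) powr (p - 1) * (n Q N / N - 1 / M)) = p * (1 / M) powr (p - 1) * (T - 1)"
        using M by (simp add: sum_distrib_left[symmetric] sum_subtractf T_def M_def)
      also have "M * (1 / M) powr p = M powr (1 - p)"
        using M by (simp add: powr_diff powr_divide)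
      finally have eq: "(\<Sum>Q\<in>QQ. l * powr_tangent p (1 / M) (n Q N / N)) =
          l * (M powr (1 - p) + p * (T - 1) * (1 / M) powr (p - 1))" by (simp add: mult_ac)
      have "0 \<le> l * (p * (T - 1) * (1 / M) powr (p - 1))"
        by (rule mult_nonneg_nonneg[OF less_imp_le[OF l(1)] mult_nonneg_nonneg[OF \<open>0 \<le> p * (T - 1)\<close>]]) simp
      then have "M powr (1 - p) * l - \<epsilon> \<le> (\<Sum>Q\<in>QQ. l * powr_tangent p (1 / M) (n Q N / N)) - \<epsilon>"
        unfolding eq by (simp add: algebra_simps)
      then have "(M powr (1 - p) * l - \<epsilon>) * \<tau> (real N) \<le>
          ((\<Sum>Q\<in>QQ. l * powr_tangent p (1 / M) (n Q N / N)) - \<epsilon>) * \<tau> (real N)"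
        using elim by (intro mult_right_mono) auto
      with elim(1) show ?case unfolding M_def by (meson ereal_less_eq(3) order_trans)
    qed
  qed
qed

text \<open>The quotient limit is available for fixed multiples of \<open>N\<close>, whereas
  \<open>n N\<close> is only asymptotically one. Monotonicity compares \<open>n N\<close> with a
  fixed multiple \<open>y * N\<close> close by.\<close>

lemma \<tau>_ratio_upper:
  assumes lim: "(\<lambda>N. real (n N) / real N) \<longlonglongrightarrow> x" and "0 < x" "0 < \<epsilon>"
  shows "\<forall>\<^sub>F N in sequentially. \<tau> (real (n N)) \<le> (x powr p + \<epsilon>) * \<tau> (real N)"
proof -
  have cont: "isCont (\<lambda>y. y powr p) x" using \<open>0 < x\<close> by (intro continuous_intros) auto
  then have "\<forall>\<^sub>F y in at x. y powr p < x powr p + \<epsilon>/2"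
    using \<open>0 < \<epsilon>\<close> by (intro order_tendstoD(2)[where y = "x powr p"]) (auto simp: isCont_def)
  then obtain d where d: "0 < d" "\<And>y. y \<noteq> x \<Longrightarrow> dist y x < d \<Longrightarrow> y powr p < x powr p + \<epsilon>/2"
    unfolding eventually_at by auto
  define r where "r = min (d/2) (x/2)"
  have r: "0 < r" "r < d" "r < x" using d \<open>0 < x\<close> by (auto simp: r_def)
  \<comment> \<open>A multiple slightly off \<open>x\<close>, on the side where
    \<open>\<tau>\<close> is larger.\<close>
  define y where "y = (if 1 < p then x + r else x - r)"
  have y: "0 < y" "y powr p < x powr p + \<epsilon>/2"
    using r d(2)[of y] by (auto simp: y_def dist_real_def)
  have "\<forall>\<^sub>F N in sequentially. \<tau> (y * real N) / \<tau> (real N) < y powr p + \<epsilon>/2"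
    using eventually_compose_filterlim[OF order_tendstoD(2)[OF \<tau>_lim[OF y(1)], of "y powr p + \<epsilon>/2"] filterlim_real_sequentially]
      \<open>0 < \<epsilon>\<close> by simp
  moreover have "\<forall>\<^sub>F N in sequentially. x - r < real (n N) / real N" "\<forall>\<^sub>F N in sequentially. real (n N) / real N < x + r"
    using lim r by (auto intro!: order_tendstoD)
  ultimately show ?thesis using eventually_gt_at_top[of 0]
  proof eventually_elim
    case (elim N)
    have nb: "(x - r) * real N < real (n N)" "real (n N) < (x + r) * real N" using elim by (auto simp: field_simps)
    have xr: "0 < (x - r) * real N" using elim r by simp
    have "\<tau> (real (n N)) \<le> \<tau> (y * real N)"
    proof (cases "1 < p")
      case True
      then have "mono_on {0<..} \<tau>" using \<tau>_mono by auto
      have "real (n N) \<in> {0<..}" "(x + r) * real N \<in> {0<..}" using nb xr by auto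
      from monotone_onD[OF \<open>mono_on {0<..} \<tau>\<close> this] nb True show ?thesis unfolding y_def by simp
    next
      case False
      then have "antimono_on {0<..} \<tau>" using \<tau>_mono by auto
      have "real (n N) \<in> {0<..}" "(x - r) * real N \<in> {0<..}" using nb xr by auto
      from monotone_onD[OF \<open>antimono_on {0<..} \<tau>\<close> this(2,1)] nb False show ?thesis unfolding y_def by simp
    qed
    also have "\<dots> \<le> (y powr p + \<epsilon>/2) * \<tau> (real N)" using elim \<tau>_pos[of "real N"] by (simp add: field_simps)
    also have "\<dots> \<le> (x powr p + \<epsilon>) * \<tau> (real N)" using y \<tau>_pos[of "real N"] elim by (intro mult_right_mono) auto
    finally show ?case .
  qed
qed

text \<open>The competitor joins minimizers on the individual cubes, each with nearly the same
  number of points; short-range interaction makes its energy the sum of theirs.\<close>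

lemma limsup_equal_cubes:
  assumes QQ: "finite QQ" "QQ \<noteq> {}" "\<And>Q. Q \<in> QQ \<Longrightarrow> is_cube Q" "\<Union>QQ \<subseteq> \<Omega>"
      "pairwise (\<lambda>P Q. interior P \<inter> interior Q = {}) QQ"
    and A: "compact A" "A \<subseteq> \<Omega>" "\<And>Q. Q \<in> QQ \<Longrightarrow> 0 < measure lborel (A \<inter> Q)"
    and u: "0 < u" "\<And>Q. Q \<in> QQ \<Longrightarrow> limsup (scaled_energy e \<tau> (A \<inter> Q)) \<le> ereal u"
    and dist: "0 < \<zeta> \<Longrightarrow> pairwise disjnt QQ"
  shows "limsup (scaled_energy e \<tau> (A \<inter> \<Union>QQ)) \<le> ereal (real (card QQ) powr (1 - p) * u)"
proof -
  define M where "M = card QQ"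
  have M: "0 < M" using QQ by (simp add: M_def card_gt_0_iff)
  obtain Q0 where Q0: "Q0 \<in> QQ" using QQ by auto
  \<comment> \<open>One cube absorbs the remainder of the division, fewer than \<open>M\<close>
    points, so the numbers add up to \<open>N\<close> exactly and every fraction still tends to
    \<open>1 / M\<close>.\<close>
  define n where "n Q N = N div M + (if Q = Q0 then N mod M else 0)" for Q N
  define \<eta> where "\<eta> Q N = (SOME \<omega>. is_minimizer e (A \<inter> Q) (n Q N) \<omega>)" for Q N
  have sum_n: "(\<Sum>Q\<in>QQ. n Q N) = N" for N
    using QQ(1) Q0 by (simp add: n_def sum.distrib M_def)
  have n_lim: "(\<lambda>N. real (n Q N) / real N) \<longlonglongrightarrow> 1 / real M" for Q
  proof (rule real_tendsto_sandwich)
    show "(\<lambda>N. 1 / real M - 1 / real N) \<longlonglongrightarrow> 1 / real M"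
      using tendsto_diff[OF tendsto_const lim_const_over_n[of 1]] by simp
    show "(\<lambda>N. 1 / real M + real M / real N) \<longlonglongrightarrow> 1 / real M"
      using tendsto_add[OF tendsto_const lim_const_over_n[of "real M"]] by simp
    have eq: "real N = real M * real (N div M) + real (N mod M)" for N
      by (metis mult_div_mod_eq of_nat_add of_nat_mult)
    have md: "real (N mod M) < real M" for N using M by simp
    show "\<forall>\<^sub>F N in sequentially. 1 / real M - 1 / real N \<le> real (n Q N) / real N"
      using eventually_gt_at_top[of 0]
    proof eventually_elim
      case (elim N)
      have "1 / real M - 1 / real N = (real N / M - 1) / real N" using elim M by (simp add: field_simps)
      also have "\<dots> \<le> real (n Q N) / real N"
      proof (rule divide_right_mono)
        have "real N \<le> real M * (real (N div M) + 1)" using eq[of N] md[of N] by (simp add: algebra_simps)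
        then have "real N / M - 1 \<le> real (N div M)" using M by (simp add: field_simps)
        then show "real N / M - 1 \<le> real (n Q N)" by (simp add: n_def)
      qed simp
      finally show ?case .
    qed
    show "\<forall>\<^sub>F N in sequentially. real (n Q N) / real N \<le> 1 / real M + real M / real N"
      using eventually_gt_at_top[of 0]
    proof eventually_elim
      case (elim N)
      have "real (n Q N) / real N \<le> (real N / M + real M) / real N"
      proof (rule divide_right_mono)
        have "real M * real (N div M) \<le> real N" using eq[of N] by simp
        then have "real (N div M) \<le> real N / M" using M by (simp add: field_simps)
        then show "real (n Q N) \<le> real N / M + real M" using md[of N] by (simp add: n_def)
      qed simp
      also have "\<dots> = 1 / real M + real M / real N" using elim M by (simp add: field_simps)
      finally show ?case .
    qed
  qed
  have n_top: "filterlim (n Q) at_top sequentially" for Q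
  proof -
    have "filterlim (\<lambda>N. real (n Q N)) at_top sequentially"
    proof (rule filterlim_at_top_mono)
      show "filterlim (\<lambda>N. 1 / (2 * real M) * real N) at_top sequentially"
        using M by (intro filterlim_tendsto_pos_mult_at_top[OF tendsto_const] filterlim_real_sequentially) auto
      have "\<forall>\<^sub>F N in sequentially. 1 / (2 * real M) < real (n Q N) / real N"
        using M by (intro order_tendstoD(1)[OF n_lim]) (simp add: field_simps)
      then show "\<forall>\<^sub>F N in sequentially. 1 / (2 * real M) * real N \<le> real (n Q N)"
        using eventually_gt_at_top[of 0] by eventually_elim (simp add: field_simps)
    qed
    then show ?thesis by (simp add: filterlim_sequentially_iff_filterlim_real)
  qed
  have AQ: "compact (A \<inter> Q)" "A \<inter> Q \<subseteq> \<Omega>" "A \<inter> Q \<noteq> {}" if "Q \<in> QQ" for Q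
    using that A(1,2) A(3)[OF that] is_cube_compact[OF QQ(3)[OF that]] by (auto intro: compact_Int)
  have \<eta>: "\<forall>\<^sub>F N in sequentially. \<forall>Q\<in>QQ. is_minimizer e (A \<inter> Q) (n Q N) (\<eta> Q N)"
  proof (rule eventually_ball_finite[OF QQ(1)], rule ballI)
    fix Q assume Q: "Q \<in> QQ"
    have "\<forall>\<^sub>F N in sequentially. N0 \<le> n Q N" using n_top[of Q] by (auto simp: filterlim_at_top)
    then show "\<forall>\<^sub>F N in sequentially. is_minimizer e (A \<inter> Q) (n Q N) (\<eta> Q N)"
    proof eventually_elim
      case (elim N)
      from minimizer_exists[OF elim AQ[OF Q]] show ?case unfolding \<eta>_def by (rule someI_ex)
    qed
  qed
  \<comment> \<open>Disjoint compact sets have positive distance, as short-range interaction demands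
    in this case.\<close>
  have setd: "pairwise (\<lambda>P Q. 0 < setdist P Q) QQ" if "0 < \<zeta>"
    unfolding pairwise_def
  proof (intro ballI impI)
    fix P Q assume PQ: "P \<in> QQ" "Q \<in> QQ" "P \<noteq> Q"
    then have "P \<inter> Q = {}" using dist[OF that] by (auto simp: pairwise_def disjnt_def)
    moreover have "P \<noteq> {}" "Q \<noteq> {}" using AQ PQ by auto
    ultimately show "0 < setdist P Q"
      using PQ QQ(3) is_cube_compact compact_imp_closed by (subst setdist_gt_0_compact_closed) auto
  qed
  have ratio: "(\<lambda>N. (\<Sum>Q\<in>QQ. energy0 N0 e (\<eta> Q N) (A \<inter> Q)) /
                   energy0 N0 e (\<Sum>Q\<in>QQ. \<eta> Q N) (A \<inter> \<Union>QQ)) \<longlonglongrightarrow> 1"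
    using QQ A setd n_top \<eta> sum_n by (intro short_range_unions) auto
  define c where "c = (1 / real M) powr p"
  have c: "0 < c" using M by (simp add: c_def)
  have Mc: "real M * c = real M powr (1 - p)" using M by (simp add: c_def powr_diff powr_divide)
  show ?thesis
  proof (rule limsup_scaled_energyI)
    fix \<epsilon> :: real assume "0 < \<epsilon>"
    \<comment> \<open>For \<open>\<delta> \<le> 1\<close> the product
      \<open>(u + \<delta>) * (c + \<delta>)\<close> exceeds \<open>c * u\<close> by at most
      \<open>\<delta> * (c + u + 1)\<close>, so all \<open>M\<close> cubes together lose at most
      \<open>\<epsilon> / 2\<close>.\<close>
    define \<delta> where "\<delta> = min 1 (\<epsilon> / (2 * real M * (c + u + 1)))"
    have \<delta>: "0 < \<delta>" using \<open>0 < \<epsilon>\<close> M c u by (simp add: \<delta>_def)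
    have \<delta>1: "\<delta> \<le> 1" unfolding \<delta>_def by (rule min.cobounded1)
    have "\<delta> \<le> \<epsilon> / (2 * real M * (c + u + 1))" unfolding \<delta>_def by (rule min.cobounded2)
    moreover have "0 < 2 * real M * (c + u + 1)" using M c u by simp
    ultimately have \<delta>2: "\<delta> * (2 * real M * (c + u + 1)) \<le> \<epsilon>" by (simp only: pos_le_divide_eq)
    have each: "\<forall>\<^sub>F N in sequentially. min_energy e (A \<inter> Q) (n Q N) \<le> ereal ((u + \<delta>) * (c + \<delta>) * \<tau> (real N))"
      if "Q \<in> QQ" for Q
    proof -
      have "\<forall>\<^sub>F N in sequentially. min_energy e (A \<inter> Q) (n Q N) \<le> ereal ((u + \<delta>) * \<tau> (real (n Q N)))"
        using eventually_compose_filterlim[OF limsup_scaled_energyD[OF u(2)[OF that], of "u + \<delta>"] n_top] \<delta> by simp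
      moreover have "\<forall>\<^sub>F N in sequentially. \<tau> (real (n Q N)) \<le> (c + \<delta>) * \<tau> (real N)"
        unfolding c_def using M \<delta> by (intro \<tau>_ratio_upper n_lim) auto
      ultimately show ?thesis
      proof eventually_elim
        case (elim N)
        have "(u + \<delta>) * \<tau> (real (n Q N)) \<le> (u + \<delta>) * ((c + \<delta>) * \<tau> (real N))"
          using elim u \<delta> by (intro mult_left_mono) auto
        with elim(1) show ?case by (simp add: mult.assoc) (meson ereal_less_eq(3) order_trans)
      qed
    qed
    have "\<forall>\<^sub>F N in sequentially. \<forall>Q\<in>QQ. min_energy e (A \<inter> Q) (n Q N) \<le> ereal ((u + \<delta>) * (c + \<delta>) * \<tau> (real N))"
      using QQ(1) each by (intro eventually_ball_finite) auto
    moreover have "\<forall>\<^sub>F N in sequentially. \<forall>Q\<in>QQ. N0 \<le> n Q N"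
      using QQ(1) n_top by (intro eventually_ball_finite ballI) (auto simp: filterlim_at_top)
    ultimately have "\<forall>\<^sub>F N in sequentially. (\<Sum>Q\<in>QQ. energy0 N0 e (\<eta> Q N) (A \<inter> Q)) \<le>
        ereal (real M * ((u + \<delta>) * (c + \<delta>)) * \<tau> (real N))"
      using \<eta>
    proof eventually_elim
      case (elim N)
      have "(\<Sum>Q\<in>QQ. energy0 N0 e (\<eta> Q N) (A \<inter> Q)) \<le> (\<Sum>Q\<in>QQ. ereal ((u + \<delta>) * (c + \<delta>) * \<tau> (real N)))"
      proof (rule sum_mono)
        fix Q assume Q: "Q \<in> QQ"
        then have "is_minimizer e (A \<inter> Q) (n Q N) (\<eta> Q N)" using elim by blast
        then show "energy0 N0 e (\<eta> Q N) (A \<inter> Q) \<le> ereal ((u + \<delta>) * (c + \<delta>) * \<tau> (real N))"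
          using elim Q minimizer_energy[of "A \<inter> Q" "n Q N" "\<eta> Q N"]
          by (auto simp: energy0_def is_minimizer_def)
      qed
      then show ?case by (simp add: M_def mult.assoc)
    qed
    from ereal_ratio_upper[OF ratio this \<tau>_pos_sequentially, of "\<epsilon>/2"]
    have "\<forall>\<^sub>F N in sequentially. energy0 N0 e (\<Sum>Q\<in>QQ. \<eta> Q N) (A \<inter> \<Union>QQ) \<le>
        ereal ((real M * ((u + \<delta>) * (c + \<delta>)) + \<epsilon>/2) * \<tau> (real N))" using \<open>0 < \<epsilon>\<close> by simp
    then show "\<forall>\<^sub>F N in sequentially. min_energy e (A \<inter> \<Union>QQ) N \<le>
        ereal ((real (card QQ) powr (1 - p) * u + \<epsilon>) * \<tau> (real N))"
      using \<eta> \<tau>_pos_sequentially eventually_ge_at_top[of N0]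
    proof eventually_elim
      case (elim N)
      have sz: "size (\<Sum>Q\<in>QQ. \<eta> Q N) = N"
        using elim sum_n[of N] by (simp add: size_sum_mset_family is_minimizer_def)
      have "set_mset (\<Sum>Q\<in>QQ. \<eta> Q N) \<subseteq> A \<inter> \<Union>QQ"
        using elim QQ(1) by (fastforce simp: set_mset_sum is_minimizer_def)
      then have "min_energy e (A \<inter> \<Union>QQ) N \<le> energy0 N0 e (\<Sum>Q\<in>QQ. \<eta> Q N) (A \<inter> \<Union>QQ)"
        using sz elim min_energy_le[OF sz] by (simp add: energy0_def)
      also have "\<dots> \<le> ereal ((real M * ((u + \<delta>) * (c + \<delta>)) + \<epsilon>/2) * \<tau> (real N))" using elim by simp
      also have "\<dots> \<le> ereal ((real M powr (1 - p) * u + \<epsilon>) * \<tau> (real N))"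
      proof -
        have "\<delta> * \<delta> \<le> \<delta> * 1" using \<delta> \<delta>1 by (intro mult_left_mono) auto
        then have "(u + \<delta>) * (c + \<delta>) \<le> c * u + \<delta> * (c + u + 1)" by (simp add: algebra_simps)
        then have "real M * ((u + \<delta>) * (c + \<delta>)) \<le> real M * (c * u + \<delta> * (c + u + 1))"
          using M by (intro mult_left_mono) auto
        also have "\<dots> = real M powr (1 - p) * u + \<delta> * (2 * real M * (c + u + 1)) / 2"
          unfolding Mc[symmetric] by (simp add: algebra_simps)
        also have "\<dots> \<le> real M powr (1 - p) * u + \<epsilon> / 2" using \<delta>2 by simp
        finally show ?thesis using elim by (auto intro!: mult_right_mono)
      qed
      finally show ?case by (simp add: M_def)
    qed
  qed
qed

end

section \<open>Energy of compact sets\<close>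

lemma cube_in_unit_cube:
  assumes "0 < b" "\<And>i. \<bar>x $ i\<bar> + b / 2 \<le> 1 / 2"
  shows "cube x b \<subseteq> unit_cube"
proof
  fix y assume y: "y \<in> cube x b"
  have "\<bar>y $ i\<bar> \<le> 1 / 2" for i
  proof -
    have "\<bar>y $ i - x $ i\<bar> \<le> b / 2" using y assms(1) by (simp add: mem_cube)
    with assms(2)[of i] show ?thesis by arith
  qed
  then show "y \<in> unit_cube" by (simp add: unit_cube_eq mem_cube)
qed

lemma ereal_minus_one_mult: "ereal (- 1) * x = - x"
  by (cases x) auto

context short_range_functional
begin

text \<open>The energy of a cube depends on its side alone, so any centre may be chosen. For sides
  so large that no cube fits into \<open>\<Omega>\<close> the value is unspecified.\<close>

definition cube_energy :: "real \<Rightarrow> real" where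
  "cube_energy a = real_of_ereal (energy_limit e \<tau> (cube (SOME x. cube x a \<subseteq> \<Omega>) a))"

lemma cube_energy:
  assumes "0 < a" "cube x a \<subseteq> \<Omega>"
  shows "scaled_energy e \<tau> (cube x a) \<longlonglongrightarrow> ereal (cube_energy a)" "0 < cube_energy a"
    "energy_limit e \<tau> (cube x a) = ereal (cube_energy a)"
proof -
  define y where "y = (SOME x. cube x a \<subseteq> \<Omega>)"
  have "cube y a \<subseteq> \<Omega>" unfolding y_def using assms(2) by (rule someI)
  then have eq: "energy_limit e \<tau> (cube x a) = energy_limit e \<tau> (cube y a)"
    using assms cube_limit_translate by blast
  have *: "0 < energy_limit e \<tau> (cube x a)" "energy_limit e \<tau> (cube x a) < \<infinity>"
    and conv: "convergent (scaled_energy e \<tau> (cube x a))" using cube_limit assms by blast+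
  then show lim: "energy_limit e \<tau> (cube x a) = ereal (cube_energy a)"
    unfolding cube_energy_def y_def[symmetric] eq[symmetric] by (cases "energy_limit e \<tau> (cube x a)") auto
  show "0 < cube_energy a" using * lim by simp
  show "scaled_energy e \<tau> (cube x a) \<longlonglongrightarrow> ereal (cube_energy a)"
    using conv lim unfolding convergent_LIMSEQ_iff energy_limit_def by simp
qed

lemma cube_energy_Liminf_Limsup:
  assumes "0 < a" "cube x a \<subseteq> \<Omega>"
  shows "liminf (scaled_energy e \<tau> (cube x a)) = ereal (cube_energy a)"
    "limsup (scaled_energy e \<tau> (cube x a)) = ereal (cube_energy a)"
  using cube_energy(1)[OF assms] by (auto intro: lim_imp_Liminf lim_imp_Limsup)

lemma set_mono_pos:
  assumes "0 < \<zeta>" "compact A" "compact B" "A \<noteq> {}" "A \<subseteq> B" "B \<subseteq> \<Omega>"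
  shows "limsup (scaled_energy e \<tau> B) \<le> liminf (scaled_energy e \<tau> A)"
  using set_mono assms unfolding set_monotonic_def by (simp add: one_ereal_def[symmetric])

lemma set_mono_neg:
  assumes "\<zeta> < 0" "compact A" "compact B" "A \<noteq> {}" "A \<subseteq> B" "B \<subseteq> \<Omega>"
  shows "limsup (scaled_energy e \<tau> A) \<le> liminf (scaled_energy e \<tau> B)"
proof -
  have "limsup (\<lambda>N. - scaled_energy e \<tau> B N) \<le> liminf (\<lambda>N. - scaled_energy e \<tau> A N)"
    using set_mono assms unfolding set_monotonic_def by (simp add: ereal_minus_one_mult)
  then show ?thesis by (simp add: ereal_Limsup_uminus ereal_Liminf_uminus)
qed

lemma continuity_cubes:
  assumes "0 < \<epsilon>" "\<epsilon> < 1"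
  obtains \<delta> where "\<delta> > 0" "\<And>Q D. is_cube Q \<Longrightarrow> Q \<subseteq> \<Omega> \<Longrightarrow> compact D \<Longrightarrow> D \<subseteq> Q \<Longrightarrow>
           (1 - \<delta>) * measure lborel Q \<le> measure lborel D \<Longrightarrow>
           limsup (\<lambda>N. ereal (sgn \<zeta> - \<epsilon>) * scaled_energy e \<tau> D N)
             \<le> lim (\<lambda>N. ereal (sgn \<zeta>) * scaled_energy e \<tau> Q N)"
proof -
  note ex = mp[OF mp[OF spec[OF continuity[unfolded continuity_on_cubes_def], of \<epsilon>] assms(1)] assms(2)]
  show thesis
    using ex
  proof (elim exE conjE)
    fix \<delta> :: real
    assume "0 < \<delta>" and *: "\<forall>Q D. is_cube Q \<longrightarrow> Q \<subseteq> \<Omega> \<longrightarrow> compact D \<longrightarrow> D \<subseteq> Q \<longrightarrow>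
           (1 - \<delta>) * measure lborel Q \<le> measure lborel D \<longrightarrow>
           convergent (\<lambda>N. ereal (sgn \<zeta>) * scaled_energy e \<tau> Q N) \<and>
           limsup (\<lambda>N. ereal (sgn \<zeta> - \<epsilon>) * scaled_energy e \<tau> D N)
             \<le> lim (\<lambda>N. ereal (sgn \<zeta>) * scaled_energy e \<tau> Q N)"
    show thesis
      by (rule that[OF \<open>0 < \<delta>\<close>]) (simp add: *)
  qed
qed

lemma continuity_pos:
  assumes "0 < \<zeta>" "0 < \<epsilon>" "\<epsilon> < 1"
  obtains \<delta> where "0 < \<delta>" "\<And>x a D. 0 < a \<Longrightarrow> cube x a \<subseteq> \<Omega> \<Longrightarrow> compact D \<Longrightarrow> D \<subseteq> cube x a \<Longrightarrow>
    (1 - \<delta>) * a ^ CARD('d) \<le> measure lborel D \<Longrightarrow>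
    limsup (scaled_energy e \<tau> D) \<le> ereal (cube_energy a / (1 - \<epsilon>))"
proof -
  obtain \<delta> where \<delta>: "\<delta> > 0" and *: "\<And>Q D. is_cube Q \<Longrightarrow> Q \<subseteq> \<Omega> \<Longrightarrow> compact D \<Longrightarrow> D \<subseteq> Q \<Longrightarrow>
           (1 - \<delta>) * measure lborel Q \<le> measure lborel D \<Longrightarrow>
           limsup (\<lambda>N. ereal (sgn \<zeta> - \<epsilon>) * scaled_energy e \<tau> D N)
             \<le> lim (\<lambda>N. ereal (sgn \<zeta>) * scaled_energy e \<tau> Q N)"
    by (rule continuity_cubes[OF assms(2,3)]) (rule that)
  show thesis
  proof (rule that[OF \<delta>])
    fix x a D assume a: "0 < a" "cube x a \<subseteq> \<Omega>" and D: "compact D" "D \<subseteq> cube x a"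
      "(1 - \<delta>) * a ^ CARD('d) \<le> measure lborel D"
    have "limsup (\<lambda>N. ereal (1 - \<epsilon>) * scaled_energy e \<tau> D N) \<le> lim (scaled_energy e \<tau> (cube x a))"
      using *[of "cube x a" D] a D assms(1) by (simp add: measure_cube one_ereal_def[symmetric])
    also have "\<dots> = ereal (cube_energy a)" using cube_energy(3)[OF a] by (simp add: energy_limit_def)
    also have "limsup (\<lambda>N. ereal (1 - \<epsilon>) * scaled_energy e \<tau> D N) = ereal (1 - \<epsilon>) * limsup (scaled_energy e \<tau> D)"
      using assms by (intro Limsup_ereal_mult_left) auto
    finally have "ereal (1 - \<epsilon>) * limsup (scaled_energy e \<tau> D) \<le> ereal (cube_energy a)" .
    then have "limsup (scaled_energy e \<tau> D) \<le> ereal (cube_energy a) / ereal (1 - \<epsilon>)"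
      using assms by (subst ereal_le_divide_pos) auto
    then show "limsup (scaled_energy e \<tau> D) \<le> ereal (cube_energy a / (1 - \<epsilon>))" using assms by simp
  qed
qed

text \<open>For negative \<open>\<zeta>\<close> the factor is \<open>- (1 + \<epsilon>)\<close>; its
  sign turns the upper limit for \<open>D\<close> into a lower limit, so continuity bounds the
  energy of \<open>D\<close> from below.\<close>

lemma continuity_neg:
  assumes "\<zeta> < 0" "0 < \<epsilon>" "\<epsilon> < 1"
  obtains \<delta> where "0 < \<delta>" "\<And>x a D. 0 < a \<Longrightarrow> cube x a \<subseteq> \<Omega> \<Longrightarrow> compact D \<Longrightarrow> D \<subseteq> cube x a \<Longrightarrow>
    (1 - \<delta>) * a ^ CARD('d) \<le> measure lborel D \<Longrightarrow>
    ereal (cube_energy a / (1 + \<epsilon>)) \<le> liminf (scaled_energy e \<tau> D)"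
proof -
  obtain \<delta> where \<delta>: "\<delta> > 0" and *: "\<And>Q D. is_cube Q \<Longrightarrow> Q \<subseteq> \<Omega> \<Longrightarrow> compact D \<Longrightarrow> D \<subseteq> Q \<Longrightarrow>
           (1 - \<delta>) * measure lborel Q \<le> measure lborel D \<Longrightarrow>
           limsup (\<lambda>N. ereal (sgn \<zeta> - \<epsilon>) * scaled_energy e \<tau> D N)
             \<le> lim (\<lambda>N. ereal (sgn \<zeta>) * scaled_energy e \<tau> Q N)"
    by (rule continuity_cubes[OF assms(2,3)]) (rule that)
  show thesis
  proof (rule that[OF \<delta>])
    fix x a D assume a: "0 < a" "cube x a \<subseteq> \<Omega>" and D: "compact D" "D \<subseteq> cube x a"
      "(1 - \<delta>) * a ^ CARD('d) \<le> measure lborel D"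
    have "(\<lambda>N. - scaled_energy e \<tau> (cube x a) N) \<longlonglongrightarrow> - ereal (cube_energy a)"
      using cube_energy(1)[OF a] by (intro tendsto_uminus_ereal)
    then have lim: "lim (\<lambda>N. - scaled_energy e \<tau> (cube x a) N) = - ereal (cube_energy a)" by (rule limI)
    have "limsup (\<lambda>N. ereal (- 1 - \<epsilon>) * scaled_energy e \<tau> D N) \<le> lim (\<lambda>N. ereal (- 1) * scaled_energy e \<tau> (cube x a) N)"
      using *[of "cube x a" D] a D assms(1) by (simp add: measure_cube)
    also have "(\<lambda>N. ereal (- 1) * scaled_energy e \<tau> (cube x a) N) = (\<lambda>N. - scaled_energy e \<tau> (cube x a) N)"
      by (simp only: ereal_minus_one_mult)
    also note lim
    also have "(\<lambda>N. ereal (- 1 - \<epsilon>) * scaled_energy e \<tau> D N) = (\<lambda>N. - (ereal (1 + \<epsilon>) * scaled_energy e \<tau> D N))"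
    proof
      fix N
      have "ereal (- 1 - \<epsilon>) = - ereal (1 + \<epsilon>)" by simp
      then show "ereal (- 1 - \<epsilon>) * scaled_energy e \<tau> D N = - (ereal (1 + \<epsilon>) * scaled_energy e \<tau> D N)"
        by (simp only: ereal_mult_minus_left)
    qed
    also have "limsup \<dots> = - (ereal (1 + \<epsilon>) * liminf (scaled_energy e \<tau> D))"
      using assms by (simp only: ereal_Limsup_uminus) (subst Liminf_ereal_mult_left, auto)
    finally have "ereal (cube_energy a) \<le> ereal (1 + \<epsilon>) * liminf (scaled_energy e \<tau> D)"
      by (simp only: ereal_minus_le_minus)
    then have "ereal (cube_energy a) / ereal (1 + \<epsilon>) \<le> liminf (scaled_energy e \<tau> D)"
      using assms by (subst ereal_divide_le_pos) auto
    then show "ereal (cube_energy a / (1 + \<epsilon>)) \<le> liminf (scaled_energy e \<tau> D)" using assms by simp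
  qed
qed

text \<open>Two disjoint congruent cubes of energy \<open>l\<close> have joint energy \<open>2 powr (1 - p) * l\<close>,
  which by set monotonicity lies on the correct side of \<open>l\<close> only if \<open>\<zeta>\<close> and
  \<open>\<sigma> = p - 1\<close> have the same sign.\<close>

lemma \<zeta>_pos_iff: "0 < \<zeta> \<longleftrightarrow> 1 < p"
proof -
  \<comment> \<open>Two cubes of side \<open>1/4\<close> on the diagonal, inside the unit cube and
    with a gap between them in every coordinate.\<close>
  define z :: "real \<Rightarrow> real ^ 'd" where "z t = (\<chi> i. t)" for t
  define Q where "Q t = cube (z t) (1/4)" for t
  have sub: "Q t \<subseteq> \<Omega>" if "\<bar>t\<bar> = 1/4" for t
    using cube_in_unit_cube[of "1/4" "z t"] that unit_cube_dom by (auto simp: Q_def z_def)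
  have disj: "Q (1/4) \<inter> Q (- 1/4) = {}"
  proof (rule ccontr)
    assume "\<not> ?thesis"
    then obtain u where "u \<in> Q (1/4)" "u \<in> Q (- 1/4)" by blast
    then have "\<forall>i. \<bar>u $ i - 1/4\<bar> \<le> 1/8" "\<forall>i. \<bar>u $ i + 1/4\<bar> \<le> 1/8" by (simp_all add: Q_def mem_cube z_def)
    then have "\<bar>u $ i - 1/4\<bar> \<le> 1/8" "\<bar>u $ i + 1/4\<bar> \<le> 1/8" for i by blast+
    from this[of undefined] show False by arith
  qed
  define l where "l = cube_energy (1/4)"
  have l: "0 < l" "liminf (scaled_energy e \<tau> (Q t)) = ereal l" "limsup (scaled_energy e \<tau> (Q t)) = ereal l"
    if "\<bar>t\<bar> = 1/4" for t
    using cube_energy_Liminf_Limsup[of "1/4" "z t"] cube_energy(2)[of "1/4" "z t"] sub[OF that]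
    by (auto simp: l_def Q_def)
  have Qm: "measure lborel (Q t) > 0" "compact (Q t)" "is_cube (Q t)" "Q t \<noteq> {}" for t
    using center_in_cube[of "1/4" "z t"] by (auto simp: Q_def measure_cube)
  define QQ where "QQ = {Q (1/4), Q (- 1/4)}"
  have ne: "Q (1/4) \<noteq> Q (- 1/4)" using disj Qm(4) by blast
  have QQ: "finite QQ" "QQ \<noteq> {}" "card QQ = 2" "\<And>P. P \<in> QQ \<Longrightarrow> is_cube P" "\<Union>QQ \<subseteq> \<Omega>" "pairwise disjnt QQ"
    using ne Qm sub disj by (auto simp: QQ_def pairwise_insert disjnt_def)
  have Un: "\<Union>QQ \<inter> P = P" if "P \<in> QQ" for P using that by blast
  have comp: "compact (\<Union>QQ)" using QQ by (intro compact_Union_cubes)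
  have QQm: "0 < measure lborel P" "ereal l \<le> liminf (scaled_energy e \<tau> P)" "limsup (scaled_energy e \<tau> P) \<le> ereal l"
    if "P \<in> QQ" for P using that Qm l by (auto simp: QQ_def)
  have lower: "ereal (2 powr (1 - p) * l) \<le> liminf (scaled_energy e \<tau> (\<Union>QQ))"
    using liminf_equal_cubes[of QQ "\<Union>QQ" l] QQ Un comp QQm pairwise_disjnt_interiors[OF QQ(6)] l(1)[of "1/4"] by simp
  have upper: "limsup (scaled_energy e \<tau> (\<Union>QQ)) \<le> ereal (2 powr (1 - p) * l)"
    using limsup_equal_cubes[of QQ "\<Union>QQ" l] QQ Un comp QQm pairwise_disjnt_interiors[OF QQ(6)] l(1)[of "1/4"] by simp
  have subQ: "Q (1/4) \<subseteq> \<Union>QQ" by (auto simp: QQ_def)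
  have le: "liminf (scaled_energy e \<tau> (\<Union>QQ)) \<le> limsup (scaled_energy e \<tau> (\<Union>QQ))"
    by (rule Liminf_le_Limsup) simp
  have "\<not> p < 0" if "0 < \<zeta>"
  proof
    assume "p < 0"
    have "ereal (2 powr (1 - p) * l) \<le> ereal l"
      using order_trans[OF lower order_trans[OF le set_mono_pos[OF that Qm(2) comp Qm(4) subQ QQ(5)]]] l(2)[of "1/4"] by simp
    then have "2 powr (1 - p) \<le> 1" using l(1)[of "1/4"] by simp
    moreover have "2 powr 0 < 2 powr (1 - p)" using \<open>p < 0\<close> by (intro powr_less_mono) auto
    ultimately show False by simp
  qed
  moreover have "\<not> 1 < p" if "\<zeta> < 0"
  proof
    assume "1 < p"
    have "ereal l \<le> ereal (2 powr (1 - p) * l)"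
      using order_trans[OF set_mono_neg[OF that Qm(2) comp Qm(4) subQ QQ(5)] order_trans[OF le upper]] l(3)[of "1/4"] by simp
    then have "1 \<le> 2 powr (1 - p)" using l(1)[of "1/4"] by simp
    moreover have "2 powr (1 - p) < 2 powr 0" using \<open>1 < p\<close> by (intro powr_less_mono) auto
    ultimately show False by simp
  qed
  ultimately show ?thesis using p_cases \<zeta>_nonzero by linarith
qed

text \<open>If the energy of a cube is a constant times the power \<open>1 - p\<close> of its
  volume, as the theorem claims, this is that constant. Dependence on the side is allowed until the
  unit cube itself is covered and packed by small cubes.\<close>

definition cube_density :: "real \<Rightarrow> real" where
  "cube_density h = cube_energy h * (h ^ CARD('d)) powr (p - 1)"

lemma cube_density_powr:
  assumes "0 < h"
  shows "real M powr (1 - p) * cube_energy h = (real M * h ^ CARD('d)) powr (1 - p) * cube_density h"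
proof -
  have "(h ^ CARD('d)) powr (1 - p) * (h ^ CARD('d)) powr (p - 1) = 1"
    using assms by (simp add: powr_add[symmetric])
  then show ?thesis using assms by (simp add: cube_density_def powr_mult mult_ac)
qed

text \<open>Monotonicity bounds \<open>A\<close> by its cover from below if \<open>p > 1\<close> and
  from above if \<open>p < 0\<close>. Cells of a cover touch, and these are just the bounds that
  tolerate it: shared points do not spoil the lower bound for \<open>p > 1\<close>, and the upper
  bound asks for separated cubes only if \<open>\<zeta> > 0\<close>. Null sets are included.
  Positivity of the density is recorded here because it needs a cube of that side inside
  \<open>\<Omega>\<close>.\<close>

lemma cover_bound:
  assumes A: "compact A" "A \<subseteq> \<Omega>" "A \<noteq> {}" and "0 < \<eta>"
  shows "\<forall>\<^sub>F h in at_right 0. 0 < cube_density h \<and>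
    (1 < p \<longrightarrow> ereal ((measure lborel A + \<eta>) powr (1 - p) * cube_density h) \<le> liminf (scaled_energy e \<tau> A)) \<and>
    (p < 0 \<longrightarrow> limsup (scaled_energy e \<tau> A) \<le> ereal ((measure lborel A + \<eta>) powr (1 - p) * cube_density h))"
proof -
  obtain V where V: "open V" "bounded V" "A \<subseteq> V" "V \<subseteq> \<Omega>" "measure lborel V \<le> measure lborel A + \<eta>"
    using open_superset_measure_le[OF A(1,2) open_dom bounded_dom \<open>0 < \<eta>\<close>] by metis
  obtain h0 where h0: "0 < h0" "\<And>h. 0 < h \<Longrightarrow> h < h0 \<Longrightarrow> \<exists>Z. finite Z \<and> separated_by h Z \<and>
       (\<forall>z\<in>Z. cube z h \<inter> A \<noteq> {} \<and> cube z h \<subseteq> V) \<and> A \<subseteq> (\<Union>z\<in>Z. cube z h)"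
    using grid_cover[OF A(1) V(1) V(3)] by metis
  show ?thesis unfolding eventually_at_right_field
  proof (intro exI[of _ h0] conjI h0(1) allI impI)
    fix h assume h: "0 < h" "h < h0"
    obtain Z where Z: "finite Z" "separated_by h Z" "\<And>z. z \<in> Z \<Longrightarrow> cube z h \<subseteq> V" "A \<subseteq> (\<Union>z\<in>Z. cube z h)"
      using h0(2)[OF h] by blast
    define QQ where "QQ = (\<lambda>z. cube z h) ` Z"
    have Zne: "Z \<noteq> {}" using A(3) Z(4) by auto
    then obtain z where z: "z \<in> Z" by auto
    have sub: "cube z h \<subseteq> \<Omega>" if "z \<in> Z" for z using Z(3)[OF that] V by blast
    have "\<Union>QQ \<subseteq> \<Omega>" unfolding QQ_def using sub by blast
    then have QQ: "finite QQ" "QQ \<noteq> {}" "\<And>P. P \<in> QQ \<Longrightarrow> is_cube P" "\<Union>QQ \<subseteq> \<Omega>"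
      "pairwise (\<lambda>P Q. interior P \<inter> interior Q = {}) QQ" "A \<subseteq> \<Union>QQ"
      using Z Zne h separated_interiors_disjoint[OF Z(2) h(1)] by (auto simp: QQ_def)
    have card: "card QQ = card Z" using inj_on_cube[OF h(1), of Z] by (simp add: QQ_def card_image)
    have comp: "compact (\<Union>QQ)" using QQ by (intro compact_Union_cubes)
    have Un: "\<Union>QQ \<inter> P = P" if "P \<in> QQ" for P using that by blast
    define l where "l = cube_energy h"
    have l: "0 < l" using cube_energy(2)[OF h(1) sub[OF z]] by (simp add: l_def)
    then show "0 < cube_density h" using h by (simp add: cube_density_def l_def)
    have QQm: "0 < measure lborel P" "ereal l \<le> liminf (scaled_energy e \<tau> P)" "limsup (scaled_energy e \<tau> P) \<le> ereal l"
      if "P \<in> QQ" for P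
      using that h cube_energy_Liminf_Limsup[OF h(1) sub] by (auto simp: QQ_def l_def measure_cube)
    have meas: "0 < real (card Z) * h ^ CARD('d)" "real (card Z) * h ^ CARD('d) \<le> measure lborel A + \<eta>"
    proof -
      show "0 < real (card Z) * h ^ CARD('d)" using Z Zne h by (simp add: card_gt_0_iff)
      have "measure lborel (\<Union>z\<in>Z. cube z h) \<le> measure lborel V"
        using V Z h emeasure_bounded_finite[OF V(2)]
        by (intro measure_mono_fmeasurable fmeasurableI borel_compact compact_UN UN_least) auto
      then show "real (card Z) * h ^ CARD('d) \<le> measure lborel A + \<eta>"
        using measure_separated_cubes[OF Z(1,2) h(1)] V(5) by simp
    qed
    have le: "liminf (scaled_energy e \<tau> (\<Union>QQ)) \<le> limsup (scaled_energy e \<tau> (\<Union>QQ))"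
      by (rule Liminf_le_Limsup) simp
    { assume p: "1 < p"
      have "(measure lborel A + \<eta>) powr (1 - p) * cube_density h \<le> (real (card Z) * h ^ CARD('d)) powr (1 - p) * cube_density h"
        using meas p \<open>0 < cube_density h\<close> by (intro mult_right_mono powr_mono2') auto
      then have "ereal ((measure lborel A + \<eta>) powr (1 - p) * cube_density h) \<le> ereal (real (card QQ) powr (1 - p) * l)"
        using cube_density_powr[OF h(1), of "card Z"] by (simp add: l_def card)
      also have "\<dots> \<le> liminf (scaled_energy e \<tau> (\<Union>QQ))"
        using liminf_equal_cubes[of QQ "\<Union>QQ" l] QQ Un comp QQm l p by simp
      also note le
      also have "limsup (scaled_energy e \<tau> (\<Union>QQ)) \<le> liminf (scaled_energy e \<tau> A)"
        using p \<zeta>_pos_iff A QQ comp by (intro set_mono_pos) auto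
      finally show "ereal ((measure lborel A + \<eta>) powr (1 - p) * cube_density h) \<le> liminf (scaled_energy e \<tau> A)" . }
    { assume p: "p < 0"
      then have \<zeta>: "\<zeta> < 0" using \<zeta>_pos_iff \<zeta>_nonzero by linarith
      have "limsup (scaled_energy e \<tau> A) \<le> liminf (scaled_energy e \<tau> (\<Union>QQ))"
        using \<zeta> A QQ comp by (intro set_mono_neg) auto
      also note le
      also have "limsup (scaled_energy e \<tau> (\<Union>QQ)) \<le> ereal (real (card QQ) powr (1 - p) * l)"
        using limsup_equal_cubes[of QQ "\<Union>QQ" l] QQ Un comp QQm l \<zeta> by simp
      also have "\<dots> \<le> ereal ((measure lborel A + \<eta>) powr (1 - p) * cube_density h)"
      proof -
        have "(real (card Z) * h ^ CARD('d)) powr (1 - p) * cube_density h \<le> (measure lborel A + \<eta>) powr (1 - p) * cube_density h"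
          using meas p \<open>0 < cube_density h\<close> by (intro mult_right_mono powr_mono2) auto
        then show ?thesis using cube_density_powr[OF h(1), of "card Z"] by (simp add: l_def card)
      qed
      finally show "limsup (scaled_energy e \<tau> A) \<le> ereal ((measure lborel A + \<eta>) powr (1 - p) * cube_density h)" . }
  qed
qed

text \<open>For positive measure the additive excess of volume becomes a factor \<open>r\<close>, by
  continuity of the power away from \<open>0\<close>.\<close>

lemma cover_bound_ratio:
  assumes A: "compact A" "A \<subseteq> \<Omega>" "0 < measure lborel A" and "1 < r"
  shows "\<forall>\<^sub>F h in at_right 0. 0 < cube_density h \<and>
    (1 < p \<longrightarrow> ereal (measure lborel A powr (1 - p) * cube_density h / r) \<le> liminf (scaled_energy e \<tau> A)) \<and>
    (p < 0 \<longrightarrow> limsup (scaled_energy e \<tau> A) \<le> ereal (r * (measure lborel A powr (1 - p) * cube_density h)))"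
proof -
  define V where "V = measure lborel A"
  have V: "0 < V" using A by (simp add: V_def)
  have "((\<lambda>\<eta>. (V + \<eta>) powr (1 - p)) \<longlongrightarrow> (V + 0) powr (1 - p)) (at_right 0)"
    using V by (intro tendsto_intros) auto
  then have lim: "((\<lambda>\<eta>. (V + \<eta>) powr (1 - p)) \<longlongrightarrow> V powr (1 - p)) (at_right 0)" by simp
  have "V powr (1 - p) / r < V powr (1 - p)" "V powr (1 - p) < r * V powr (1 - p)"
    using V \<open>1 < r\<close> by (auto simp: field_simps)
  then have "\<forall>\<^sub>F \<eta> in at_right 0. V powr (1 - p) / r < (V + \<eta>) powr (1 - p)"
    "\<forall>\<^sub>F \<eta> in at_right 0. (V + \<eta>) powr (1 - p) < r * V powr (1 - p)"
    using lim by (auto intro: order_tendstoD)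
  moreover have "\<forall>\<^sub>F \<eta> in at_right 0. (0::real) < \<eta>" by (simp add: eventually_at_right_less)
  ultimately have "\<forall>\<^sub>F \<eta> in at_right 0. 0 < \<eta> \<and> V powr (1 - p) / r < (V + \<eta>) powr (1 - p) \<and>
      (V + \<eta>) powr (1 - p) < r * V powr (1 - p)" by eventually_elim simp
  then obtain \<eta> where \<eta>: "0 < \<eta>" "V powr (1 - p) / r < (V + \<eta>) powr (1 - p)" "(V + \<eta>) powr (1 - p) < r * V powr (1 - p)"
    using eventually_happens by force
  have "A \<noteq> {}" using A(3) by auto
  from cover_bound[OF A(1,2) this \<eta>(1)] show ?thesis
  proof eventually_elim
    case (elim h)
    have f: "0 \<le> cube_density h" using elim by simp
    have "V powr (1 - p) / r * cube_density h \<le> (V + \<eta>) powr (1 - p) * cube_density h"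
      "(V + \<eta>) powr (1 - p) * cube_density h \<le> r * V powr (1 - p) * cube_density h"
      by (rule mult_right_mono[OF less_imp_le[OF \<eta>(2)] f], rule mult_right_mono[OF less_imp_le[OF \<eta>(3)] f])
    then have "ereal (V powr (1 - p) * cube_density h / r) \<le> ereal ((V + \<eta>) powr (1 - p) * cube_density h)"
      "ereal ((V + \<eta>) powr (1 - p) * cube_density h) \<le> ereal (r * (V powr (1 - p) * cube_density h))"
      by (simp_all add: mult_ac)
    then show ?case using elim unfolding V_def by (meson order_trans)
  qed
qed

text \<open>The two inequalities opposite to those from covers. A packing lies inside
  \<open>A\<close>, which reverses monotonicity, and its shrunk cells are disjoint, as these
  directions require. Each cell contains only most of its share of \<open>A\<close>, and continuity
  on cubes compares this part with the full cell.\<close>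

lemma pack_bound:
  assumes A: "compact A" "A \<subseteq> \<Omega>" "0 < measure lborel A" and "1 < r"
  shows "\<forall>\<^sub>F h in at_right 0.
    (1 < p \<longrightarrow> limsup (scaled_energy e \<tau> A) \<le> ereal (r * (measure lborel A powr (1 - p) * cube_density h))) \<and>
    (p < 0 \<longrightarrow> ereal (measure lborel A powr (1 - p) * cube_density h / r) \<le> liminf (scaled_energy e \<tau> A))"
proof -
  define V where "V = measure lborel A"
  have V: "0 < V" using A by (simp add: V_def)
  \<comment> \<open>Shrinking the cells by the factor \<open>1 - \<kappa>\<close> costs the power
    \<open>CARD('d)\<close> of it in volume; leaving a proportion \<open>\<kappa>\<close> of
    \<open>A\<close> unpacked costs one factor more.\<close>
  define k where "k = CARD('d) + 1"
  have "((\<lambda>\<kappa>. ((1 - \<kappa>) ^ k) powr (1 - p) / (1 - \<kappa>)) \<longlongrightarrow> ((1 - 0) ^ k) powr (1 - p) / (1 - 0)) (at_right 0)"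
    by (intro tendsto_intros) auto
  then have "\<forall>\<^sub>F \<kappa> in at_right 0. ((1 - \<kappa>) ^ k) powr (1 - p) / (1 - \<kappa>) < r"
    using \<open>1 < r\<close> by (intro order_tendstoD(2)) auto
  moreover have "((\<lambda>\<kappa>. ((1 - \<kappa>) ^ k) powr (1 - p) / (1 + \<kappa>)) \<longlongrightarrow> ((1 - 0) ^ k) powr (1 - p) / (1 + 0)) (at_right 0)"
    by (intro tendsto_intros) auto
  then have "\<forall>\<^sub>F \<kappa> in at_right 0. 1 / r < ((1 - \<kappa>) ^ k) powr (1 - p) / (1 + \<kappa>)"
    using \<open>1 < r\<close> by (intro order_tendstoD(1)) auto
  moreover have "\<forall>\<^sub>F \<kappa> in at_right 0. (0::real) < \<kappa>" by (simp add: eventually_at_right_less)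
  moreover have "\<forall>\<^sub>F \<kappa> in at_right 0. \<kappa> < (1::real)" by (rule order_tendstoD(2)[OF tendsto_ident_at]) simp
  ultimately have "\<forall>\<^sub>F \<kappa> in at_right 0. 0 < \<kappa> \<and> \<kappa> < 1 \<and> ((1 - \<kappa>) ^ k) powr (1 - p) / (1 - \<kappa>) < r \<and>
     1 / r < ((1 - \<kappa>) ^ k) powr (1 - p) / (1 + \<kappa>)" by eventually_elim simp
  then obtain \<kappa> where \<kappa>: "0 < \<kappa>" "\<kappa> < 1" "((1 - \<kappa>) ^ k) powr (1 - p) / (1 - \<kappa>) < r"
     "1 / r < ((1 - \<kappa>) ^ k) powr (1 - p) / (1 + \<kappa>)"
    using eventually_happens by force
  have "\<exists>\<delta>>0. \<forall>x a D. 0 < a \<longrightarrow> cube x a \<subseteq> \<Omega> \<longrightarrow> compact D \<longrightarrow> D \<subseteq> cube x a \<longrightarrow>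
    (1 - \<delta>) * a ^ CARD('d) \<le> measure lborel D \<longrightarrow>
    (1 < p \<longrightarrow> limsup (scaled_energy e \<tau> D) \<le> ereal (cube_energy a / (1 - \<kappa>))) \<and>
    (p < 0 \<longrightarrow> ereal (cube_energy a / (1 + \<kappa>)) \<le> liminf (scaled_energy e \<tau> D))"
  proof (cases "0 < \<zeta>")
    case True
    obtain \<delta> where "0 < \<delta>" "\<And>x a D. 0 < a \<Longrightarrow> cube x a \<subseteq> \<Omega> \<Longrightarrow> compact D \<Longrightarrow> D \<subseteq> cube x a \<Longrightarrow>
      (1 - \<delta>) * a ^ CARD('d) \<le> measure lborel D \<Longrightarrow>
      limsup (scaled_energy e \<tau> D) \<le> ereal (cube_energy a / (1 - \<kappa>))"
      using continuity_pos[OF True \<kappa>(1,2)] by metis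
    then show ?thesis using True \<zeta>_pos_iff by (intro exI[of _ \<delta>]) auto
  next
    case False
    then have "\<zeta> < 0" using \<zeta>_nonzero by linarith
    obtain \<delta> where "0 < \<delta>" "\<And>x a D. 0 < a \<Longrightarrow> cube x a \<subseteq> \<Omega> \<Longrightarrow> compact D \<Longrightarrow> D \<subseteq> cube x a \<Longrightarrow>
      (1 - \<delta>) * a ^ CARD('d) \<le> measure lborel D \<Longrightarrow>
      ereal (cube_energy a / (1 + \<kappa>)) \<le> liminf (scaled_energy e \<tau> D)"
      using continuity_neg[OF \<open>\<zeta> < 0\<close> \<kappa>(1,2)] by metis
    then show ?thesis using False \<zeta>_pos_iff by (intro exI[of _ \<delta>]) auto
  qed
  then obtain \<delta>1 where \<delta>1: "0 < \<delta>1" and cont: "\<And>x a D. 0 < a \<Longrightarrow> cube x a \<subseteq> \<Omega> \<Longrightarrow> compact D \<Longrightarrow> D \<subseteq> cube x a \<Longrightarrow>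
    (1 - \<delta>1) * a ^ CARD('d) \<le> measure lborel D \<Longrightarrow>
    (1 < p \<longrightarrow> limsup (scaled_energy e \<tau> D) \<le> ereal (cube_energy a / (1 - \<kappa>))) \<and>
    (p < 0 \<longrightarrow> ereal (cube_energy a / (1 + \<kappa>)) \<le> liminf (scaled_energy e \<tau> D))" by blast
  \<comment> \<open>The tolerance is kept below \<open>1\<close> so that every selected cube meets
    \<open>A\<close> in positive measure.\<close>
  define \<delta> where "\<delta> = min \<delta>1 (1/2)"
  have \<delta>: "0 < \<delta>" "\<delta> \<le> \<delta>1" "\<delta> < 1" using \<delta>1 by (auto simp: \<delta>_def)
  define c where "c = 1 - \<kappa>"
  have c: "0 < c" "c < 1" using \<kappa> by (auto simp: c_def)
  have "0 < \<kappa> * V" using \<kappa> V by simp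
  then obtain h0 where h0: "0 < h0" and pack: "\<And>h. 0 < h \<Longrightarrow> h < h0 \<Longrightarrow> \<exists>Z. finite Z \<and> separated_by h Z \<and>
       (\<forall>z\<in>Z. cube z h \<subseteq> \<Omega> \<and> (1 - \<delta>) * (c * h) ^ CARD('d) \<le> measure lborel (A \<inter> cube z (c * h))) \<and>
       measure lborel A - \<kappa> * V \<le> real (card Z) * h ^ CARD('d)"
    using grid_pack[OF A(1,2) open_dom bounded_dom _ \<delta>(1) c] by metis
  show ?thesis unfolding eventually_at_right_field
  proof (intro exI[of _ "c * h0"] conjI allI impI)
    show "0 < c * h0" using c h0 by simp
    fix g assume g: "0 < g" "g < c * h0"
    \<comment> \<open>The bound is stated in the side \<open>g\<close> of the shrunk cubes, because
      it is their density that has to match the one in the covering bound; the grid itself has the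
      larger spacing \<open>h\<close>.\<close>
    define h where "h = g / c"
    have h: "0 < h" "h < h0" "c * h = g" "g < h" using g c by (auto simp: h_def field_simps)
    obtain Z where Z: "finite Z" "separated_by h Z" "\<And>z. z \<in> Z \<Longrightarrow> cube z h \<subseteq> \<Omega>"
       "\<And>z. z \<in> Z \<Longrightarrow> (1 - \<delta>) * g ^ CARD('d) \<le> measure lborel (A \<inter> cube z g)"
       "V - \<kappa> * V \<le> real (card Z) * h ^ CARD('d)"
      using pack[OF h(1,2)] h(3) by (auto simp: V_def)
    define QQ where "QQ = (\<lambda>z. cube z g) ` Z"
    have "0 < V - \<kappa> * V" using V \<kappa> by (simp add: algebra_simps)
    then have Zne: "Z \<noteq> {}" using Z(5) by auto
    then obtain z where z: "z \<in> Z" by auto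
    have sub: "cube z g \<subseteq> \<Omega>" if "z \<in> Z" for z
      using Z(3)[OF that] cube_subset_cube[OF g(1) less_imp_le[OF h(4)]] by blast
    have "\<Union>QQ \<subseteq> \<Omega>" unfolding QQ_def using sub by blast
    then have QQ: "finite QQ" "QQ \<noteq> {}" "\<And>P. P \<in> QQ \<Longrightarrow> is_cube P" "\<Union>QQ \<subseteq> \<Omega>" "pairwise disjnt QQ"
      using Z Zne g separated_shrunk_disjoint[OF Z(2) g(1) h(4)] by (auto simp: QQ_def)
    have QQi: "pairwise (\<lambda>P Q. interior P \<inter> interior Q = {}) QQ" by (rule pairwise_disjnt_interiors[OF QQ(5)])
    have card: "card QQ = card Z" using inj_on_cube[OF g(1), of Z] by (simp add: QQ_def card_image)
    have comp: "compact (A \<inter> \<Union>QQ)" using QQ A by (intro compact_Int compact_Union_cubes)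
    define l where "l = cube_energy g"
    have l: "0 < l" using cube_energy(2)[OF g(1) sub[OF z]] by (simp add: l_def)
    then have f: "0 < cube_density g" using g by (simp add: cube_density_def l_def)
    have QQm: "0 < measure lborel (A \<inter> P)" 
        "1 < p \<Longrightarrow> limsup (scaled_energy e \<tau> (A \<inter> P)) \<le> ereal (l / (1 - \<kappa>))" 
        "p < 0 \<Longrightarrow> ereal (l / (1 + \<kappa>)) \<le> liminf (scaled_energy e \<tau> (A \<inter> P))"
      if P: "P \<in> QQ" for P
    proof -
      obtain y where y: "y \<in> Z" "P = cube y g" using P by (auto simp: QQ_def)
      have "0 < (1 - \<delta>) * g ^ CARD('d)" using g \<delta> by simp
      then show "0 < measure lborel (A \<inter> P)" using Z(4)[OF y(1)] y by simp
      have "(1 - \<delta>1) * g ^ CARD('d) \<le> (1 - \<delta>) * g ^ CARD('d)" using \<delta> g by (intro mult_right_mono) auto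
      with Z(4)[OF y(1)] have "(1 - \<delta>1) * g ^ CARD('d) \<le> measure lborel (A \<inter> P)" using y by simp
      moreover have "compact (A \<inter> P)" using A g y by (auto intro: compact_Int)
      ultimately show "1 < p \<Longrightarrow> limsup (scaled_energy e \<tau> (A \<inter> P)) \<le> ereal (l / (1 - \<kappa>))" 
        "p < 0 \<Longrightarrow> ereal (l / (1 + \<kappa>)) \<le> liminf (scaled_energy e \<tau> (A \<inter> P))"
        using cont[OF g(1) sub[OF y(1)], of "A \<inter> P"] y by (auto simp: l_def)
    qed
    have "A \<inter> cube z g \<noteq> {}" using QQm(1)[of "cube z g"] z by (auto simp: QQ_def)
    then have Ane: "A \<inter> \<Union>QQ \<noteq> {}" using z by (auto simp: QQ_def)
    define W where "W = real (card Z) * g ^ CARD('d)"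
    have W: "(1 - \<kappa>) ^ k * V \<le> W" "0 < (1 - \<kappa>) ^ k * V"
    proof -
      have "c ^ CARD('d) * (V - \<kappa> * V) \<le> c ^ CARD('d) * (real (card Z) * h ^ CARD('d))"
        using Z(5) c by (intro mult_left_mono) auto
      also have "\<dots> = W" unfolding W_def h(3)[symmetric] by (simp add: power_mult_distrib)
      also have "c ^ CARD('d) * (V - \<kappa> * V) = (1 - \<kappa>) ^ k * V" by (simp add: c_def k_def algebra_simps)
      finally show "(1 - \<kappa>) ^ k * V \<le> W" .
      show "0 < (1 - \<kappa>) ^ k * V" using \<kappa> V by simp
    qed
    have cd: "real (card QQ) powr (1 - p) * l = W powr (1 - p) * cube_density g"
      using cube_density_powr[OF g(1), of "card Z"] by (simp add: l_def card W_def)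
    have le: "liminf (scaled_energy e \<tau> (A \<inter> \<Union>QQ)) \<le> limsup (scaled_energy e \<tau> (A \<inter> \<Union>QQ))"
      by (rule Liminf_le_Limsup) simp
    { assume p: "1 < p"
      have "limsup (scaled_energy e \<tau> A) \<le> liminf (scaled_energy e \<tau> (A \<inter> \<Union>QQ))"
        using p \<zeta>_pos_iff A comp Ane by (intro set_mono_pos) auto
      also note le
      also have "limsup (scaled_energy e \<tau> (A \<inter> \<Union>QQ)) \<le> ereal (real (card QQ) powr (1 - p) * (l / (1 - \<kappa>)))"
        using QQ QQi A QQm l \<kappa> p by (intro limsup_equal_cubes) auto
      also have "\<dots> = ereal (W powr (1 - p) * cube_density g / (1 - \<kappa>))" using cd by simp
      also have "\<dots> \<le> ereal (((1 - \<kappa>) ^ k * V) powr (1 - p) * cube_density g / (1 - \<kappa>))"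
        using W p f \<kappa> by (auto intro!: divide_right_mono mult_right_mono powr_mono2')
      also have "((1 - \<kappa>) ^ k * V) powr (1 - p) * cube_density g / (1 - \<kappa>) =
          ((1 - \<kappa>) ^ k) powr (1 - p) / (1 - \<kappa>) * (V powr (1 - p) * cube_density g)"
        using \<kappa> V by (simp add: powr_mult)
      also have "ereal \<dots> \<le> ereal (r * (V powr (1 - p) * cube_density g))"
        unfolding ereal_less_eq using \<kappa>(3) V f by (intro mult_right_mono) auto
      finally show "limsup (scaled_energy e \<tau> A) \<le> ereal (r * (measure lborel A powr (1 - p) * cube_density g))"
        by (simp add: V_def) }
    { assume p: "p < 0"
      then have \<zeta>: "\<zeta> < 0" using \<zeta>_pos_iff \<zeta>_nonzero by linarith
      have "V powr (1 - p) * cube_density g / r = 1 / r * (V powr (1 - p) * cube_density g)" by simp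
      also have "\<dots> \<le> ((1 - \<kappa>) ^ k) powr (1 - p) / (1 + \<kappa>) * (V powr (1 - p) * cube_density g)"
        using \<kappa> V f by (intro mult_right_mono) auto
      also have "\<dots> = ((1 - \<kappa>) ^ k * V) powr (1 - p) * cube_density g / (1 + \<kappa>)"
        using \<kappa> V by (simp add: powr_mult)
      also have "\<dots> \<le> W powr (1 - p) * cube_density g / (1 + \<kappa>)"
        using W p f \<kappa> by (intro divide_right_mono mult_right_mono powr_mono2) auto
      also have "\<dots> = real (card QQ) powr (1 - p) * (l / (1 + \<kappa>))" using cd by simp
      finally have "ereal (V powr (1 - p) * cube_density g / r) \<le> ereal (real (card QQ) powr (1 - p) * (l / (1 + \<kappa>)))" by simp
      also have "\<dots> \<le> liminf (scaled_energy e \<tau> (A \<inter> \<Union>QQ))"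
        using QQ QQi A QQm l \<kappa> p by (intro liminf_equal_cubes) auto
      also note le
      also have "limsup (scaled_energy e \<tau> (A \<inter> \<Union>QQ)) \<le> liminf (scaled_energy e \<tau> A)"
        using \<zeta> A comp Ane by (intro set_mono_neg) auto
      finally show "ereal (measure lborel A powr (1 - p) * cube_density g / r) \<le> liminf (scaled_energy e \<tau> A)"
        by (simp add: V_def) }
  qed
qed

text \<open>For either sign of \<open>p\<close>, covering supplies one of the inequalities and
  packing the other.\<close>

lemma scaled_energy_bounds:
  assumes A: "compact A" "A \<subseteq> \<Omega>" "0 < measure lborel A" and "1 < r"
  shows "\<forall>\<^sub>F h in at_right 0. 0 < cube_density h \<and>
    ereal (measure lborel A powr (1 - p) * cube_density h / r) \<le> liminf (scaled_energy e \<tau> A) \<and>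
    limsup (scaled_energy e \<tau> A) \<le> ereal (r * (measure lborel A powr (1 - p) * cube_density h))"
  using cover_bound_ratio[OF assms] pack_bound[OF assms]
  by eventually_elim (use p_cases in auto)

section \<open>Identification of the density and the limit for every compact set\<close>

lemma unit_cube_energy: 
  "scaled_energy e \<tau> unit_cube \<longlonglongrightarrow> ereal (cube_energy 1)" "0 < cube_energy 1"
  "energy_limit e \<tau> unit_cube = ereal (cube_energy 1)"
  using cube_energy[of 1 0] unit_cube_dom by (auto simp: unit_cube_eq)

lemma cube_density_bounds:
  assumes "1 < r"
  shows "\<forall>\<^sub>F h in at_right 0. cube_density h \<le> r * cube_energy 1 \<and> cube_energy 1 \<le> r * cube_density h"
proof -
  have m: "measure lborel (unit_cube :: (real ^ 'd) set) = 1" by (simp add: unit_cube_eq measure_cube)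
  have c: "compact (unit_cube :: (real ^ 'd) set)" by (simp add: unit_cube_eq)
  have "liminf (scaled_energy e \<tau> unit_cube) = ereal (cube_energy 1)"
    "limsup (scaled_energy e \<tau> unit_cube) = ereal (cube_energy 1)"
    using unit_cube_energy(1) by (auto intro: lim_imp_Liminf lim_imp_Limsup)
  with scaled_energy_bounds[OF c unit_cube_dom _ assms] m
  have "\<forall>\<^sub>F h in at_right 0. 0 < cube_density h \<and> cube_density h / r \<le> cube_energy 1 \<and>
      cube_energy 1 \<le> r * cube_density h" by simp
  then show ?thesis by eventually_elim (use assms in \<open>auto simp: field_simps\<close>)
qed

text \<open>The density at one small side links \<open>A\<close> to the unit cube and then drops
  out. Both comparisons cost a factor \<open>r\<close>, hence \<open>r * r\<close>, and
  \<open>r\<close> tends to \<open>1\<close>.\<close>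

lemma energy_limit_positive_measure:
  assumes A: "compact A" "A \<subseteq> \<Omega>" "0 < measure lborel A"
  shows "scaled_energy e \<tau> A \<longlonglongrightarrow> ereal (cube_energy 1 * measure lborel A powr (1 - p))"
proof -
  define V where "V = measure lborel A powr (1 - p)"
  have V: "0 < V" using A by (simp add: V_def)
  have bounds: "ereal (V * cube_energy 1 / (r * r)) \<le> liminf (scaled_energy e \<tau> A) \<and>
      limsup (scaled_energy e \<tau> A) \<le> ereal (r * r * (V * cube_energy 1))" if r: "1 < r" for r
  proof -
    have "\<forall>\<^sub>F h in at_right (0::real). ereal (V * cube_energy 1 / (r * r)) \<le> liminf (scaled_energy e \<tau> A) \<and>
      limsup (scaled_energy e \<tau> A) \<le> ereal (r * r * (V * cube_energy 1))"
      using scaled_energy_bounds[OF A r] cube_density_bounds[OF r]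
    proof eventually_elim
      case (elim h)
      have "V * cube_energy 1 / (r * r) \<le> V * (r * cube_density h) / (r * r)"
        using V r elim by (intro divide_right_mono mult_left_mono) auto
      also have "\<dots> = V * cube_density h / r" using r by simp
      finally have 1: "ereal (V * cube_energy 1 / (r * r)) \<le> ereal (V * cube_density h / r)" by simp
      have "r * (V * cube_density h) \<le> r * (V * (r * cube_energy 1))"
        using V r elim by (intro mult_left_mono) auto
      then have 2: "ereal (r * (V * cube_density h)) \<le> ereal (r * r * (V * cube_energy 1))" by (simp add: mult_ac)
      show ?case using elim 1 2 unfolding V_def by (meson order_trans)
    qed
    then show ?thesis using eventually_happens by force
  qed
  have "\<forall>\<^sub>F r in at_right (1::real). 1 < r" by (simp add: eventually_at_right_less)
  then have ev: "\<forall>\<^sub>F r in at_right 1. ereal (V * cube_energy 1 / (r * r)) \<le> liminf (scaled_energy e \<tau> A)"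
    "\<forall>\<^sub>F r in at_right 1. limsup (scaled_energy e \<tau> A) \<le> ereal (r * r * (V * cube_energy 1))"
    using bounds by (auto elim: eventually_mono)
  have "((\<lambda>r. V * cube_energy 1 / (r * r)) \<longlongrightarrow> V * cube_energy 1 / (1 * 1)) (at_right 1)"
    "((\<lambda>r. r * r * (V * cube_energy 1)) \<longlongrightarrow> 1 * 1 * (V * cube_energy 1)) (at_right 1)"
    by (intro tendsto_intros; simp)+
  then have lims: "((\<lambda>r. ereal (V * cube_energy 1 / (r * r))) \<longlongrightarrow> ereal (V * cube_energy 1)) (at_right 1)"
    "((\<lambda>r. ereal (r * r * (V * cube_energy 1))) \<longlongrightarrow> ereal (V * cube_energy 1)) (at_right 1)"
    by simp_all
  have 1: "ereal (V * cube_energy 1) \<le> liminf (scaled_energy e \<tau> A)"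
    using lims(1) ev(1) by (rule tendsto_upperbound) simp
  have 2: "limsup (scaled_energy e \<tau> A) \<le> ereal (V * cube_energy 1)"
    using lims(2) ev(2) by (rule tendsto_lowerbound) simp
  have "scaled_energy e \<tau> A \<longlonglongrightarrow> ereal (V * cube_energy 1)"
    using 1 2 Liminf_le_Limsup[of sequentially "scaled_energy e \<tau> A"]
    by (intro Liminf_eq_Limsup) (auto intro: antisym order_trans)
  then show ?thesis by (simp add: V_def mult.commute)
qed

text \<open>If \<open>E0\<close> were nonzero, the functional would not depend on the set, so smaller sets would
  have larger energy, which is impossible for \<open>p < 0\<close>.\<close>

lemma E0_eq_0:
  assumes "p < 0"
  shows "E0 = 0"
proof (rule ccontr)
  assume "E0 \<noteq> 0"
  then have indep: "e \<omega> A = e \<omega> B"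
    if "N0 \<le> size \<omega>" "set_mset \<omega> \<subseteq> \<Omega>" "compact A" "A \<subseteq> \<Omega>" "compact B" "B \<subseteq> \<Omega>" for \<omega> A B
    using functional that unfolding interaction_functional_def by blast
  have sub: "cube 0 (1/2) \<subseteq> (unit_cube :: (real ^ 'd) set)" by (rule cube_in_unit_cube) auto
  then have sub': "cube 0 (1/2) \<subseteq> \<Omega>" using unit_cube_dom by blast
  have c: "compact (unit_cube :: (real ^ 'd) set)" by (simp add: unit_cube_eq)
  have "\<forall>\<^sub>F N in sequentially. scaled_energy e \<tau> unit_cube N \<le> scaled_energy e \<tau> (cube 0 (1/2)) N"
    using eventually_ge_at_top[of N0] \<tau>_pos_sequentially
  proof eventually_elim
    case (elim N)
    have "min_energy e unit_cube N \<le> min_energy e (cube 0 (1/2)) N"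
      unfolding min_energy_def[of e "cube 0 (1/2)"]
    proof (rule INF_greatest)
      fix \<omega> :: "(real ^ 'd) multiset" assume "\<omega> \<in> {\<omega>. size \<omega> = N \<and> set_mset \<omega> \<subseteq> cube 0 (1/2)}"
      then have \<omega>: "size \<omega> = N" "set_mset \<omega> \<subseteq> cube 0 (1/2)" by auto
      have "min_energy e unit_cube N \<le> e \<omega> unit_cube" using \<omega> sub by (intro min_energy_le) auto
      also have "\<dots> = e \<omega> (cube 0 (1/2))" using \<omega> elim sub sub' unit_cube_dom c by (intro indep) auto
      finally show "min_energy e unit_cube N \<le> e \<omega> (cube 0 (1/2))" .
    qed
    then show ?case unfolding scaled_energy_def using elim by (intro ereal_divide_right_mono) auto
  qed
  moreover have "scaled_energy e \<tau> (cube 0 (1/2)) \<longlonglongrightarrow> ereal (cube_energy 1 * ((1/2) ^ CARD('d)) powr (1 - p))"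
    using energy_limit_positive_measure[of "cube 0 (1/2)"] sub' by (simp add: measure_cube)
  ultimately have le: "ereal (cube_energy 1) \<le> ereal (cube_energy 1 * ((1/2) ^ CARD('d)) powr (1 - p))"
    using tendsto_le[OF _ _ unit_cube_energy(1)] by (metis trivial_limit_sequentially)
  have "((1/2) ^ CARD('d)) powr (1 - p) < (1::real) powr (1 - p)"
    using assms by (intro powr_less_mono2) (auto simp: power_less_one_iff)
  with le unit_cube_energy(2) show False by simp
qed

text \<open>Null sets cannot be packed, but a cover of volume \<open>\<eta>\<close> is available for
  every positive \<open>\<eta>\<close>. A comparison of densities up to the factor \<open>2\<close>
  is enough, since the power of \<open>\<eta>\<close> tends to infinity or to
  \<open>0\<close>.\<close>

lemma cube_energy_from_cover:
  assumes A: "compact A" "A \<subseteq> \<Omega>" "A \<noteq> {}" "measure lborel A = 0" and "0 < \<eta>"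
  shows "1 < p \<Longrightarrow> ereal (\<eta> powr (1 - p) * (cube_energy 1 / 2)) \<le> liminf (scaled_energy e \<tau> A)"
    "p < 0 \<Longrightarrow> limsup (scaled_energy e \<tau> A) \<le> ereal (\<eta> powr (1 - p) * (2 * cube_energy 1))"
proof -
  have "\<forall>\<^sub>F h in at_right (0::real).
    (1 < p \<longrightarrow> ereal (\<eta> powr (1 - p) * (cube_energy 1 / 2)) \<le> liminf (scaled_energy e \<tau> A)) \<and>
    (p < 0 \<longrightarrow> limsup (scaled_energy e \<tau> A) \<le> ereal (\<eta> powr (1 - p) * (2 * cube_energy 1)))"
    using cover_bound[OF A(1-3) \<open>0 < \<eta>\<close>] cube_density_bounds[of 2, simplified]
  proof eventually_elim
    case (elim h)
    have "cube_energy 1 / 2 \<le> cube_density h" "cube_density h \<le> 2 * cube_energy 1" using elim by auto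
    then have "\<eta> powr (1 - p) * (cube_energy 1 / 2) \<le> \<eta> powr (1 - p) * cube_density h"
      "\<eta> powr (1 - p) * cube_density h \<le> \<eta> powr (1 - p) * (2 * cube_energy 1)"
      by (auto simp del: times_divide_eq_right intro!: mult_left_mono)
    then have "ereal (\<eta> powr (1 - p) * (cube_energy 1 / 2)) \<le> ereal (\<eta> powr (1 - p) * cube_density h)"
      "ereal (\<eta> powr (1 - p) * cube_density h) \<le> ereal (\<eta> powr (1 - p) * (2 * cube_energy 1))"
      unfolding ereal_less_eq .
    moreover have "1 < p \<Longrightarrow> ereal (\<eta> powr (1 - p) * cube_density h) \<le> liminf (scaled_energy e \<tau> A)"
      "p < 0 \<Longrightarrow> limsup (scaled_energy e \<tau> A) \<le> ereal (\<eta> powr (1 - p) * cube_density h)"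
      using elim A(4) by auto
    ultimately show ?case by (blast intro: order_trans)
  qed
  then have "(1 < p \<longrightarrow> ereal (\<eta> powr (1 - p) * (cube_energy 1 / 2)) \<le> liminf (scaled_energy e \<tau> A)) \<and>
    (p < 0 \<longrightarrow> limsup (scaled_energy e \<tau> A) \<le> ereal (\<eta> powr (1 - p) * (2 * cube_energy 1)))"
    using eventually_happens by force
  then show "1 < p \<Longrightarrow> ereal (\<eta> powr (1 - p) * (cube_energy 1 / 2)) \<le> liminf (scaled_energy e \<tau> A)"
    "p < 0 \<Longrightarrow> limsup (scaled_energy e \<tau> A) \<le> ereal (\<eta> powr (1 - p) * (2 * cube_energy 1))" by auto
qed

lemma energy_limit_compact:
  assumes A: "compact A" "A \<subseteq> \<Omega>" "A \<noteq> {}"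
  shows "scaled_energy e \<tau> A \<longlonglongrightarrow> energy_limit e \<tau> unit_cube * neg_powr (measure lborel A) (p - 1)"
proof (cases "measure lborel A = 0")
  case False
  then have "0 < measure lborel A" by (simp add: zero_less_measure_iff)
  from energy_limit_positive_measure[OF A(1,2) this] False show ?thesis
    by (simp add: unit_cube_energy(3) neg_powr_def)
next
  case True
  note bound = cube_energy_from_cover[OF A True]
  show ?thesis
  proof (cases "1 < p")
    case p: True
    have "scaled_energy e \<tau> A \<longlonglongrightarrow> \<infinity>" unfolding tendsto_PInfty
    proof
      fix C :: real
      define D where "D = \<bar>C\<bar> + 1"
      \<comment> \<open>Solves \<open>\<eta> powr (1 - p) * (cube_energy 1 / 2) = D\<close>.\<close>
      define \<eta> where "\<eta> = (D * (2 / cube_energy 1)) powr (1 / (1 - p))"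
      have D: "0 < D" "C < D" by (auto simp: D_def)
      have pos: "0 < D * (2 / cube_energy 1)" using D unit_cube_energy(2) by simp
      have "\<eta> powr (1 - p) = (D * (2 / cube_energy 1)) powr 1" using p by (simp only: \<eta>_def powr_powr) simp
      then have "\<eta> powr (1 - p) * (cube_energy 1 / 2) = D" using D(1) unit_cube_energy(2) by simp
      moreover have "D * (2 / cube_energy 1) \<noteq> 0" using pos by linarith
      then have "0 < \<eta>" unfolding \<eta>_def by (rule iffD2[OF powr_gt_zero])
      ultimately have "ereal D \<le> liminf (scaled_energy e \<tau> A)" using bound(1)[of \<eta>] p by simp
      then show "\<forall>\<^sub>F N in sequentially. ereal C < scaled_energy e \<tau> A N"
        using D(2) unfolding le_Liminf_iff by simp
    qed
    then show ?thesis using True p unit_cube_energy by (simp add: neg_powr_def)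
  next
    case False
    then have p: "p < 0" using p_cases by auto
    have "((\<lambda>\<eta>. \<eta> powr (1 - p) * (2 * cube_energy 1)) \<longlongrightarrow> 0 powr (1 - p) * (2 * cube_energy 1)) (at_right 0)"
      using p by (intro tendsto_intros tendsto_powr') (auto simp: eventually_at_right_less intro: eventually_mono[OF eventually_at_right_less])
    then have "((\<lambda>\<eta>. ereal (\<eta> powr (1 - p) * (2 * cube_energy 1))) \<longlongrightarrow> ereal 0) (at_right 0)" by simp
    moreover have "\<forall>\<^sub>F \<eta> in at_right 0. limsup (scaled_energy e \<tau> A) \<le> ereal (\<eta> powr (1 - p) * (2 * cube_energy 1))"
      using eventually_at_right_less[of 0] by eventually_elim (rule bound(2)[OF _ p])
    ultimately have upper: "limsup (scaled_energy e \<tau> A) \<le> ereal 0"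
      by (rule tendsto_lowerbound) simp
    have "\<forall>\<^sub>F N in sequentially. 0 \<le> scaled_energy e \<tau> A N"
      using eventually_ge_at_top[of N0] \<tau>_pos_sequentially
    proof eventually_elim
      case (elim N)
      \<comment> \<open>Covers bound the energy only from above for \<open>p < 0\<close>; the
        matching lower bound \<open>0\<close> comes from \<open>E0 = 0\<close>.\<close>
      have "0 \<le> min_energy e A N" unfolding min_energy_def
      proof (rule INF_greatest)
        fix \<omega> assume "\<omega> \<in> {\<omega>. size \<omega> = N \<and> set_mset \<omega> \<subseteq> A}"
        then show "0 \<le> e \<omega> A" using energy_lower_bound[of \<omega> A] elim A E0_eq_0[OF p]
          by (auto simp: zero_ereal_def)
      qed
      then show ?case using elim unfolding scaled_energy_def by (subst ereal_le_divide_pos) auto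
    qed
    then have "0 \<le> liminf (scaled_energy e \<tau> A)" by (rule Liminf_bounded)
    then have "scaled_energy e \<tau> A \<longlonglongrightarrow> 0"
      using upper Liminf_le_Limsup[of sequentially "scaled_energy e \<tau> A"]
      by (intro Liminf_eq_Limsup) (auto simp: zero_ereal_def intro: antisym order_trans)
    then show ?thesis using True p by (simp add: neg_powr_def)
  qed
qed

end

section \<open>Distribution of minimizers\<close>

text \<open>Strictness is obtained from two non-strict tangent bounds, one at \<open>1\<close>
  evaluated at the midpoint \<open>m\<close> and one at \<open>m\<close> evaluated at
  \<open>c\<close>; the slopes at \<open>1\<close> and at \<open>m\<close> differ.\<close>

lemma powr_above_tangent_strict:
  fixes p c :: real
  assumes p: "p < 0 \<or> 1 < p" and c: "0 < c" "c < 1"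
  shows "1 + p * (c - 1) < c powr p"
proof -
  define m where "m = (1 + c) / 2"
  have m: "0 < m" "m < 1" "c - m = m - 1" "m - 1 < 0" using c by (auto simp: m_def field_simps)
  have "powr_tangent p m c \<le> c powr p" "powr_tangent p 1 m \<le> m powr p"
    using p c m by (auto intro!: powr_tangent_le)
  then have "1 + p * (m - 1) + p * m powr (p - 1) * (m - 1) \<le> c powr p"
    using m by (simp add: powr_tangent_def)
  moreover have "p * (m - 1) < p * m powr (p - 1) * (m - 1)"
  proof -
    have "p * m powr (p - 1) < p * m powr 0"
      using p
    proof
      assume "p < 0"
      have "m powr 0 < m powr (p - 1)" using m \<open>p < 0\<close> by (intro powr_less_mono') auto
      then show ?thesis using \<open>p < 0\<close> by (simp add: mult_less_cancel_left)
    next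
      assume "1 < p"
      have "m powr (p - 1) < m powr 0" using m \<open>1 < p\<close> by (intro powr_less_mono') auto
      then show ?thesis using \<open>1 < p\<close> by (simp add: mult_less_cancel_left)
    qed
    then have "p * m powr (p - 1) < p" using m by simp
    from mult_strict_right_mono_neg[OF this m(4)] show ?thesis .
  qed
  moreover have "1 + p * (c - 1) = 1 + p * (m - 1) + p * (m - 1)" using m(3) by (simp add: algebra_simps m_def)
  ultimately show ?thesis by linarith
qed

text \<open>Some small open cube meets \<open>K\<close> in positive measure, and removing it takes
  away a little, but not nothing.\<close>

lemma compact_smaller_measure:
  fixes K :: "(real ^ 'd) set"
  assumes K: "compact K" "0 < measure lborel K" and "0 < \<epsilon>"
  obtains L where "compact L" "L \<subseteq> K" "measure lborel L < measure lborel K" "measure lborel K - \<epsilon> \<le> measure lborel L"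
proof -
  define s where "s = min 1 \<epsilon>"
  have s: "0 < s" "s \<le> 1" "s \<le> \<epsilon>" using \<open>0 < \<epsilon>\<close> by (auto simp: s_def)
  have "s ^ CARD('d) \<le> s ^ 1" using s by (intro power_decreasing) auto
  then have sd: "s ^ CARD('d) \<le> \<epsilon>" using s by simp
  have "K \<subseteq> (\<Union>x\<in>K. interior (cube x s))" using s by (auto simp: mem_interior_cube)
  then obtain D where D: "D \<subseteq> K" "finite D" "K \<subseteq> (\<Union>x\<in>D. interior (cube x s))"
    using compactE_image[OF K(1), of K "\<lambda>x. interior (cube x s)"] by (metis open_interior)
  have fm: "K \<in> fmeasurable lborel" using K by (intro fmeasurable_compact)
  have Ks: "K \<in> sets borel" using K(1) by (rule borel_compact)
  have Ki: "K \<inter> interior (cube x s) \<in> fmeasurable lborel" for x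
    using fm by (rule fmeasurable_Int_fmeasurable) simp
  have "\<exists>x\<in>D. 0 < measure lborel (K \<inter> interior (cube x s))"
  proof (rule ccontr)
    assume "\<not> ?thesis"
    then have z: "measure lborel (K \<inter> interior (cube x s)) = 0" if "x \<in> D" for x
      using that by (metis measure_nonneg order_le_less)
    have "measure lborel K \<le> measure lborel (\<Union>x\<in>D. K \<inter> interior (cube x s))"
      using D Ks Ki by (intro measure_mono_fmeasurable fmeasurable.finite_UN) auto
    also have "\<dots> \<le> (\<Sum>x\<in>D. measure lborel (K \<inter> interior (cube x s)))"
      using D(2) fmeasurableD[OF Ki] by (intro measure_UNION_le)
    also have "\<dots> = 0" using z by simp
    finally show False using K by simp
  qed
  then obtain x where x: "0 < measure lborel (K \<inter> interior (cube x s))" by blast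
  define L where "L = K - interior (cube x s)"
  have "measure lborel (K - K \<inter> interior (cube x s)) = measure lborel K - measure lborel (K \<inter> interior (cube x s))"
    using fm Ks by (intro measurable_measure_Diff) auto
  moreover have "K - K \<inter> interior (cube x s) = L" by (auto simp: L_def)
  moreover have "measure lborel (K \<inter> interior (cube x s)) \<le> measure lborel (cube x s)"
    using s Ks interior_subset[of "cube x s"] by (intro measure_mono_compact) auto
  moreover have "compact L" unfolding L_def using K by (intro compact_diff) auto
  ultimately show thesis using x s sd by (intro that[of L]) (auto simp: L_def measure_cube)
qed

context short_range_functional
begin

text \<open>In units of the energy of \<open>A\<close>, let \<open>\<alpha>1\<close>,
  \<open>\<alpha>2\<close> be the measure shares of a piece around \<open>K\<close> and of the rest.
  With tangents at \<open>c * \<alpha>1\<close> and \<open>\<alpha>2\<close>, too small a fraction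
  in the first piece would give energy at least \<open>1 + \<alpha>1 * g\<close> up to the error in
  \<open>\<alpha>1 + \<alpha>2 = 1\<close>, whereas a minimizer has energy \<open>1\<close>
  asymptotically.\<close>

lemma minimizer_mass_lower_aux:
  assumes A: "compact A" "A \<subseteq> \<Omega>" "\<forall>\<^sub>F N in sequentially. is_minimizer e A N (\<omega> N)"
    and K: "compact K" "K \<subseteq> A" "0 < measure lborel K" "measure lborel K < measure lborel A"
    and V: "open V" "K \<subseteq> V" and c: "0 < c" "c < 1"
  shows "\<forall>\<^sub>F N in sequentially.
    c * (measure lborel K / measure lborel A) \<le> size (filter_mset (\<lambda>x. x \<in> V) (\<omega> N)) / N"
proof -
  define v where "v = measure lborel A"
  have v: "0 < v" using K by (simp add: v_def)
  define \<alpha>0 where "\<alpha>0 = measure lborel K / v"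
  have \<alpha>0: "0 < \<alpha>0" using K v by (simp add: \<alpha>0_def)
  define g where "g = c powr p - 1 - p * (c - 1)"
  have g: "0 < g" using powr_above_tangent_strict[OF p_cases c] by (simp add: g_def)
  \<comment> \<open>The first bound leaves positive measure for the second piece; the second keeps
    the error in the total measure smaller than the gap \<open>\<alpha>0 * g\<close>.\<close>
  define \<epsilon>0 where "\<epsilon>0 = min ((v - measure lborel K) / 2) (v * \<alpha>0 * g / (2 * (\<bar>1 - p\<bar> + 1)))"
  have "0 < v * \<alpha>0 * g / (2 * (\<bar>1 - p\<bar> + 1))" using v \<alpha>0 g by (intro divide_pos_pos mult_pos_pos) auto
  moreover have "0 < (v - measure lborel K) / 2" using K by (simp add: v_def)
  ultimately have \<epsilon>0: "0 < \<epsilon>0" unfolding \<epsilon>0_def by (simp only: min_less_iff_conj)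
  have \<epsilon>01: "measure lborel K + \<epsilon>0 < v"
  proof -
    have "\<epsilon>0 \<le> (v - measure lborel K) / 2" unfolding \<epsilon>0_def by (rule min.cobounded1)
    then show ?thesis using K by (simp add: v_def)
  qed
  have \<epsilon>02: "\<epsilon>0 / v * \<bar>1 - p\<bar> < \<alpha>0 * g"
  proof -
    have pos: "0 < 2 * (\<bar>1 - p\<bar> + 1)" by (intro mult_pos_pos add_nonneg_pos) auto
    have "\<epsilon>0 \<le> v * \<alpha>0 * g / (2 * (\<bar>1 - p\<bar> + 1))" unfolding \<epsilon>0_def by (rule min.cobounded2)
    then have "\<epsilon>0 * (2 * (\<bar>1 - p\<bar> + 1)) \<le> v * \<alpha>0 * g" using pos by (simp only: pos_le_divide_eq)
    moreover have "\<epsilon>0 * \<bar>1 - p\<bar> < \<epsilon>0 * (2 * (\<bar>1 - p\<bar> + 1))" using \<epsilon>0 by (intro mult_strict_left_mono) auto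
    ultimately have "\<epsilon>0 * \<bar>1 - p\<bar> < v * (\<alpha>0 * g)" by (simp add: mult.assoc)
    then show ?thesis using v by (simp add: field_simps)
  qed
  have "open (V \<inter> \<Omega>)" "bounded (V \<inter> \<Omega>)" "K \<subseteq> V \<inter> \<Omega>"
    using V K A open_dom bounded_dom by (auto intro: bounded_subset)
  then obtain W where W: "open W" "bounded W" "K \<subseteq> W" "W \<subseteq> V \<inter> \<Omega>" "measure lborel W \<le> measure lborel K + \<epsilon>0"
    using open_superset_measure_le[OF K(1) _ _ _ \<epsilon>0, of "V \<inter> \<Omega>"] by metis
  obtain r0 where r0: "0 < r0" "(\<Union>x\<in>K. ball x r0) \<subseteq> W"
    using compact_subset_open_imp_ball_epsilon_subset[OF K(1) W(1,3)] by blast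
  obtain h0 where h0: "0 < h0" "\<And>h. 0 < h \<Longrightarrow> h < h0 \<Longrightarrow> \<exists>Z. finite Z \<and> separated_by h Z \<and>
       (\<forall>z\<in>Z. cube z h \<inter> A \<noteq> {} \<and> cube z h \<subseteq> \<Omega>) \<and> A \<subseteq> (\<Union>z\<in>Z. cube z h)"
    using grid_cover[OF A(1) open_dom A(2)] by metis
  \<comment> \<open>A cell that touches a cell meeting \<open>K\<close> stays within two cell
    diameters of \<open>K\<close>; this side makes that distance smaller than
    \<open>r0\<close>.\<close>
  define h where "h = min (h0 / 2) (r0 / (4 * CARD('d)))"
  have h: "0 < h" "h < h0" using h0 r0 by (auto simp: h_def)
  have hr: "2 * (h * CARD('d)) < r0"
  proof -
    have "h \<le> r0 / (4 * CARD('d))" unfolding h_def by (rule min.cobounded2)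
    then have "h * (4 * CARD('d)) \<le> r0" by (subst (asm) pos_le_divide_eq) auto
    then show ?thesis using r0 by simp
  qed
  obtain Z where Z: "finite Z" "separated_by h Z" "\<And>z. z \<in> Z \<Longrightarrow> cube z h \<subseteq> \<Omega>" "A \<subseteq> (\<Union>z\<in>Z. cube z h)"
    using h0(2)[OF h] by blast
  define QQ where "QQ = (\<lambda>z. cube z h) ` Z"
  have "\<Union>QQ \<subseteq> \<Omega>" unfolding QQ_def using Z(3) by blast
  then have QQ: "finite QQ" "\<And>P. P \<in> QQ \<Longrightarrow> is_cube P" "\<Union>QQ \<subseteq> \<Omega>"
    "pairwise (\<lambda>P Q. interior P \<inter> interior Q = {}) QQ" "A \<subseteq> \<Union>QQ"
    using Z h separated_interiors_disjoint[OF Z(2) h(1)] by (auto simp: QQ_def)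
  have diam: "dist y z \<le> h * CARD('d)" if "Q \<in> QQ" "y \<in> Q" "z \<in> Q" for Q y z
    using that dist_cube_le[OF h(1)] by (auto simp: QQ_def)
  define G1 where "G1 = {Q\<in>QQ. Q \<inter> K \<noteq> {}}"
  \<comment> \<open>For \<open>p > 1\<close> the two pieces must exhaust \<open>A\<close>, so that
    the fractions add up to at least \<open>1\<close>. For \<open>p < 0\<close> they must be
    disjoint, so that the sum is at most \<open>1\<close>; the cells next to the first piece are
    then left out, and their energy is bounded below by means of \<open>E0 = 0\<close>.\<close>
  define G2 where "G2 = (if 1 < p then QQ - G1 else {Q\<in>QQ. Q \<inter> \<Union>G1 = {}})"
  define U1 where "U1 = \<Union>G1"
  define U2 where "U2 = \<Union>G2"
  have G: "G1 \<subseteq> QQ" "G2 \<subseteq> QQ" by (auto simp: G1_def G2_def)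
  have dis: "G1 \<inter> G2 = {}" by (auto simp: G1_def G2_def)
  have near: "y \<in> W" if "Q \<in> QQ" "y \<in> Q" "P \<in> G1" "u \<in> P" "u \<in> Q" for Q y P u
  proof -
    obtain k where k: "k \<in> P" "k \<in> K" "P \<in> QQ" using \<open>P \<in> G1\<close> by (auto simp: G1_def)
    have "dist k y \<le> dist k u + dist u y" by (rule dist_triangle)
    also have "\<dots> < r0" using diam[OF k(3) k(1) that(4)] diam[OF that(1) that(5) that(2)] hr by linarith
    finally have "y \<in> ball k r0" by simp
    then show ?thesis using r0(2) k(2) by blast
  qed
  have U1W: "U1 \<subseteq> W" using near G(1) by (fastforce simp: U1_def)
  have KU1: "K \<subseteq> U1" using K(2) QQ(5) by (fastforce simp: U1_def G1_def)
  have AWU2: "A - W \<subseteq> U2"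
  proof
    fix y assume y: "y \<in> A - W"
    then obtain Q where Q: "Q \<in> QQ" "y \<in> Q" using QQ(5) by blast
    have "Q \<inter> U1 = {}" using near[OF Q] y by (fastforce simp: U1_def)
    then have "Q \<in> G2" using Q KU1 by (auto simp: G2_def G1_def U1_def)
    then show "y \<in> U2" using Q by (auto simp: U2_def)
  qed
  have KU2: "U2 \<inter> K = {}" 
  proof -
    have "Q \<inter> K = {}" if "Q \<in> G2" for Q
    proof -
      have "Q \<notin> G1" "Q \<in> QQ" using that dis G(2) by auto
      then show ?thesis by (simp add: G1_def)
    qed
    then show ?thesis by (auto simp: U2_def)
  qed
  have fin: "finite G1" "finite G2" using G QQ(1) finite_subset by blast+
  have compU: "compact U1" "compact U2"
    unfolding U1_def U2_def using fin G QQ by (auto intro!: compact_Union_cubes)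
  define a1 where "a1 = measure lborel (A \<inter> U1)"
  define a2 where "a2 = measure lborel (A \<inter> U2)"
  have As: "A \<in> sets borel" "K \<in> sets borel" "W \<in> sets borel"
    using A K W by (auto intro: borel_compact)
  have fA: "A \<in> fmeasurable lborel" using A by (intro fmeasurable_compact)
  have a1K: "measure lborel K \<le> a1" unfolding a1_def
    using KU1 K A compU As by (intro measure_mono_compact compact_Int) auto
  have a1W: "a1 \<le> measure lborel K + \<epsilon>0"
  proof -
    have "W \<in> fmeasurable lborel" using W emeasure_bounded_finite[OF W(2)] As by (intro fmeasurableI) auto
    then have "a1 \<le> measure lborel W" unfolding a1_def
      using U1W A compU by (intro measure_mono_fmeasurable) (auto intro!: borel_compact compact_Int)
    with W(5) show ?thesis by simp
  qed
  have a2W: "v - (measure lborel K + \<epsilon>0) \<le> a2"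
  proof -
    have AW: "A \<inter> W \<in> fmeasurable lborel" using fA As by (intro fmeasurable_Int_fmeasurable) auto
    have "W \<in> fmeasurable lborel" using W emeasure_bounded_finite[OF W(2)] As by (intro fmeasurableI) auto
    then have "measure lborel (A \<inter> W) \<le> measure lborel W" using As by (intro measure_mono_fmeasurable) auto
    moreover have "measure lborel (A - A \<inter> W) = v - measure lborel (A \<inter> W)"
      unfolding v_def using fA AW by (intro measurable_measure_Diff) auto
    moreover have "measure lborel (A - A \<inter> W) \<le> a2" unfolding a2_def
      using AWU2 A compU As by (intro measure_mono_compact compact_Int) auto
    ultimately show ?thesis using W(5) by linarith
  qed
  have a2K: "a2 \<le> v - measure lborel K"
  proof -
    have "measure lborel (A - K) = v - measure lborel K"
      unfolding v_def using fA As K by (intro measurable_measure_Diff) auto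
    moreover have "A - K \<in> fmeasurable lborel" using fA As by (intro fmeasurable_Diff) auto
    then have "a2 \<le> measure lborel (A - K)" unfolding a2_def
      using KU2 A compU by (intro measure_mono_fmeasurable) (auto intro!: borel_compact compact_Int)
    ultimately show ?thesis by simp
  qed
  have a: "0 < a1" "0 < a2" using a1K K a2W \<epsilon>01 by auto
  define \<alpha>1 where "\<alpha>1 = a1 / v"
  define \<alpha>2 where "\<alpha>2 = a2 / v"
  have \<alpha>: "0 < \<alpha>1" "0 < \<alpha>2" "\<alpha>0 \<le> \<alpha>1" using a v a1K by (auto simp: \<alpha>1_def \<alpha>2_def \<alpha>0_def divide_right_mono)
  \<comment> \<open>The first piece contains \<open>K\<close> and lies in \<open>W\<close>, the
    second misses \<open>K\<close> and contains \<open>A - W\<close>, and \<open>W\<close> has at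
    most \<open>\<epsilon>0\<close> more measure than \<open>K\<close>. Overlaps and omitted cells
    thus hardly matter.\<close>
  have sum\<alpha>: "\<bar>\<alpha>1 + \<alpha>2 - 1\<bar> \<le> \<epsilon>0 / v"
  proof -
    have "\<bar>a1 + a2 - v\<bar> \<le> \<epsilon>0" using a1K a1W a2W a2K by linarith
    then have "\<bar>a1 + a2 - v\<bar> / v \<le> \<epsilon>0 / v" using v by (intro divide_right_mono) auto
    moreover have "\<alpha>1 + \<alpha>2 - 1 = (a1 + a2 - v) / v" using v by (simp add: \<alpha>1_def \<alpha>2_def field_simps)
    ultimately show ?thesis using v by simp
  qed
  define C where "C = cube_energy 1 * v powr (1 - p)"
  have C: "0 < C" using unit_cube_energy v by (simp add: C_def)
  have lim: "liminf (scaled_energy e \<tau> (A \<inter> U1)) = ereal (C * \<alpha>1 powr (1 - p))"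
      "liminf (scaled_energy e \<tau> (A \<inter> U2)) = ereal (C * \<alpha>2 powr (1 - p))"
  proof -
    have "C * \<alpha>1 powr (1 - p) = cube_energy 1 * a1 powr (1 - p)" "C * \<alpha>2 powr (1 - p) = cube_energy 1 * a2 powr (1 - p)"
      using v a by (simp_all add: C_def \<alpha>1_def \<alpha>2_def powr_divide)
    moreover have "compact (A \<inter> U1)" "compact (A \<inter> U2)" "A \<inter> U1 \<subseteq> \<Omega>" "A \<inter> U2 \<subseteq> \<Omega>"
      using A compU by (auto intro: compact_Int)
    ultimately show "liminf (scaled_energy e \<tau> (A \<inter> U1)) = ereal (C * \<alpha>1 powr (1 - p))"
      "liminf (scaled_energy e \<tau> (A \<inter> U2)) = ereal (C * \<alpha>2 powr (1 - p))"
      using energy_limit_positive_measure[of "A \<inter> U1"] energy_limit_positive_measure[of "A \<inter> U2"] a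
      by (auto intro!: lim_imp_Liminf simp: a1_def a2_def)
  qed
  \<comment> \<open>One \<open>\<epsilon>\<close> is lost in the lower and one in the upper energy
    bound; together they use up half of the available gap.\<close>
  define \<epsilon> where "\<epsilon> = C * (\<alpha>0 * g - \<epsilon>0 / v * \<bar>1 - p\<bar>) / 4"
  have \<epsilon>: "0 < \<epsilon>" using C \<epsilon>02 by (simp add: \<epsilon>_def)
  define n where "n U N = size (filter_mset (\<lambda>x. x \<in> U) (\<omega> N))" for U N
  define G where "G b = (if b then G1 else G2)" for b
  define l where "l b = C * (if b then \<alpha>1 else \<alpha>2) powr (1 - p)" for b
  \<comment> \<open>Only the tangent for the piece around \<open>K\<close> is moved below the
    expected fraction.\<close>
  define x where "x b = (if b then c * \<alpha>1 else \<alpha>2)" for b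
  have "\<forall>\<^sub>F N in sequentially.
    ereal (((\<Sum>b\<in>UNIV. l b * powr_tangent p (x b) (size (filter_mset (\<lambda>x. x \<in> \<Union>(G b)) (\<omega> N)) / N)) - \<epsilon>) * \<tau> (real N))
      \<le> min_energy e A N"
  proof (rule min_energy_lower_bound[OF A QQ])
    show "G b \<subseteq> QQ" for b using \<open>G1 \<subseteq> QQ\<close> \<open>G2 \<subseteq> QQ\<close> by (simp add: G_def)
    show "disjoint_family_on G UNIV" using dis by (auto simp: disjoint_family_on_def G_def)
    show "0 < measure lborel (A \<inter> \<Union>(G b))" for b
      using a by (simp add: G_def U1_def[symmetric] U2_def[symmetric] a1_def a2_def)
    show "0 < l b" for b using C \<alpha> by (simp add: l_def)
    show "ereal (l b) \<le> liminf (scaled_energy e \<tau> (A \<inter> \<Union>(G b)))" for b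
      using lim by (cases b) (simp_all add: G_def l_def U1_def[symmetric] U2_def[symmetric])
    show "0 < x b" for b using c \<alpha> by (simp add: x_def)
    show "(\<Union>b\<in>UNIV. G b) = QQ \<or> 1 < p \<or> E0 = 0" using p_cases E0_eq_0 by blast
  qed (use \<epsilon> in auto)
  then have lower: "\<forall>\<^sub>F N in sequentially.
    ereal ((C * \<alpha>1 powr (1 - p) * powr_tangent p (c * \<alpha>1) (n U1 N / N) +
      C * \<alpha>2 powr (1 - p) * powr_tangent p \<alpha>2 (n U2 N / N) - \<epsilon>) * \<tau> (real N)) \<le> min_energy e A N"
    by (simp add: UNIV_bool G_def l_def x_def n_def U1_def U2_def add.commute)
  have "limsup (scaled_energy e \<tau> A) = ereal C"
    using energy_limit_positive_measure[OF A(1,2)] v by (auto intro!: lim_imp_Limsup simp: v_def C_def)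
  then have upper: "\<forall>\<^sub>F N in sequentially. min_energy e A N \<le> ereal ((C + \<epsilon>) * \<tau> (real N))"
    using \<epsilon> by (intro limsup_scaled_energyD[of A C]) auto
  show ?thesis using lower upper A(3) \<tau>_pos_sequentially eventually_gt_at_top[of 0]
  proof eventually_elim
    case (elim N)
    define \<beta>1 where "\<beta>1 = n U1 N / N"
    define \<beta>2 where "\<beta>2 = n U2 N / N"
    have sz: "size (\<omega> N) = N" "set_mset (\<omega> N) \<subseteq> A" using elim by (auto simp: is_minimizer_def)
    have p\<beta>: "0 \<le> p * (\<beta>1 + \<beta>2 - 1)"
      using p_cases
    proof
      assume p: "1 < p"
      have "A \<subseteq> U1 \<union> U2" using QQ(5) p by (auto simp: U1_def U2_def G2_def)
      then have "\<omega> N \<subseteq># filter_mset (\<lambda>x. x \<in> U1) (\<omega> N) + filter_mset (\<lambda>x. x \<in> U2) (\<omega> N)"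
        using sz(2) by (auto simp: subseteq_mset_def) (metis UnE count_eq_zero_iff le0 subsetD)
      from size_mset_mono[OF this] have "real N \<le> n U1 N + n U2 N" using sz by (simp add: n_def)
      then have "1 \<le> \<beta>1 + \<beta>2" using elim by (simp add: \<beta>1_def \<beta>2_def field_simps)
      with p show ?thesis by simp
    next
      assume p: "p < 0"
      have "U1 \<inter> U2 = {}" using p by (auto simp: U1_def U2_def G2_def)
      then have "filter_mset (\<lambda>x. x \<in> U1) (\<omega> N) + filter_mset (\<lambda>x. x \<in> U2) (\<omega> N) \<subseteq># \<omega> N"
        by (auto simp: subseteq_mset_def)
      from size_mset_mono[OF this] have "n U1 N + n U2 N \<le> real N" using sz by (simp add: n_def)
      then have "\<beta>1 + \<beta>2 \<le> 1" using elim by (simp add: \<beta>1_def \<beta>2_def field_simps)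
      with p show ?thesis by (simp add: mult_nonpos_nonpos)
    qed
    have t1: "\<alpha>1 powr (1 - p) * powr_tangent p (c * \<alpha>1) \<beta>1 =
        \<alpha>1 * c powr p + p * c powr (p - 1) * (\<beta>1 - c * \<alpha>1)"
    proof -
      have "\<alpha>1 powr (1 - p) * \<alpha>1 powr p = \<alpha>1" "\<alpha>1 powr (1 - p) * \<alpha>1 powr (p - 1) = 1"
        using \<alpha>(1) by (simp_all add: powr_add[symmetric])
      then show ?thesis using \<alpha> c unfolding powr_tangent_def
        by (simp add: powr_mult algebra_simps) (simp add: mult.assoc[symmetric])
    qed
    have t2: "\<alpha>2 powr (1 - p) * powr_tangent p \<alpha>2 \<beta>2 = \<alpha>2 + p * (\<beta>2 - \<alpha>2)"
    proof -
      have "\<alpha>2 powr (1 - p) * \<alpha>2 powr p = \<alpha>2" "\<alpha>2 powr (1 - p) * \<alpha>2 powr (p - 1) = 1"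
        using \<alpha>(2) by (simp_all add: powr_add[symmetric])
      then show ?thesis unfolding powr_tangent_def
        by (simp add: distrib_left mult.assoc[symmetric])
    qed
    define X where "X = \<alpha>1 * c powr p + p * c powr (p - 1) * (\<beta>1 - c * \<alpha>1) + (\<alpha>2 + p * (\<beta>2 - \<alpha>2))"
    have "C * \<alpha>1 powr (1 - p) * powr_tangent p (c * \<alpha>1) \<beta>1 + C * \<alpha>2 powr (1 - p) * powr_tangent p \<alpha>2 \<beta>2 = C * X"
      unfolding X_def t1[symmetric] t2[symmetric] by (simp add: algebra_simps)
    then have "ereal ((C * X - \<epsilon>) * \<tau> (real N)) \<le> ereal ((C + \<epsilon>) * \<tau> (real N))"
      using elim(1,2) by (simp only: \<beta>1_def[symmetric] \<beta>2_def[symmetric])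
    then have "C * X - \<epsilon> \<le> C + \<epsilon>" using elim by (simp add: mult_le_cancel_right)
    moreover have "2 * \<epsilon> = C * ((\<alpha>0 * g - \<epsilon>0 / v * \<bar>1 - p\<bar>) / 2)" unfolding \<epsilon>_def by simp
    ultimately have "C * X \<le> C * 1 + C * ((\<alpha>0 * g - \<epsilon>0 / v * \<bar>1 - p\<bar>) / 2)" by linarith
    then have "C * X \<le> C * (1 + (\<alpha>0 * g - \<epsilon>0 / v * \<bar>1 - p\<bar>) / 2)" by (simp only: distrib_left)
    then have X_le: "X \<le> 1 + (\<alpha>0 * g - \<epsilon>0 / v * \<bar>1 - p\<bar>) / 2" using C by (simp only: mult_le_cancel_left_pos)
    have "c * \<alpha>0 \<le> \<beta>1"
    proof (rule ccontr)
      assume "\<not> c * \<alpha>0 \<le> \<beta>1"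
      moreover have "c * \<alpha>0 \<le> c * \<alpha>1" using c \<alpha> by (intro mult_left_mono) auto
      ultimately have \<beta>1: "\<beta>1 - c * \<alpha>1 \<le> 0" by linarith
      \<comment> \<open>The slopes at the two points of tangency differ. As \<open>\<beta>1\<close>
        is assumed below the point of tangency, replacing the first slope by \<open>p\<close> only
        decreases the bound, and then only the total \<open>\<beta>1 + \<beta>2\<close>
        matters.\<close>
      have "p * c powr (p - 1) \<le> p * 1"
        using p_cases
      proof
        assume "1 < p"
        moreover have "c powr (p - 1) \<le> c powr 0" using \<open>1 < p\<close> c by (intro powr_mono') auto
        ultimately show ?thesis using c by simp
      next
        assume "p < 0"
        moreover have "c powr 0 \<le> c powr (p - 1)" using \<open>p < 0\<close> c by (intro powr_mono') auto
        ultimately show ?thesis using c by simp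
      qed
      from mult_right_mono_neg[OF this \<beta>1]
      have "p * (\<beta>1 - c * \<alpha>1) \<le> p * c powr (p - 1) * (\<beta>1 - c * \<alpha>1)" by simp
      then have "\<alpha>1 * c powr p + \<alpha>2 + p * (\<beta>1 + \<beta>2 - 1) + p * (1 - c * \<alpha>1 - \<alpha>2) \<le> X"
        unfolding X_def by (simp add: algebra_simps)
      then have "\<alpha>1 * c powr p + \<alpha>2 + p * (1 - c * \<alpha>1 - \<alpha>2) \<le> X" using p\<beta> by linarith
      moreover have "\<alpha>1 * c powr p + \<alpha>2 + p * (1 - c * \<alpha>1 - \<alpha>2) = 1 + \<alpha>1 * g + (\<alpha>1 + \<alpha>2 - 1) * (1 - p)"
        by (simp add: g_def algebra_simps)
      moreover have "\<alpha>0 * g \<le> \<alpha>1 * g" using \<alpha> g by (intro mult_right_mono) auto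
      moreover have "\<bar>(\<alpha>1 + \<alpha>2 - 1) * (1 - p)\<bar> \<le> \<epsilon>0 / v * \<bar>1 - p\<bar>"
        unfolding abs_mult using sum\<alpha> by (intro mult_right_mono) auto
      ultimately have "1 + (\<alpha>0 * g - \<epsilon>0 / v * \<bar>1 - p\<bar>) \<le> X" by linarith
      moreover define D where "D = \<alpha>0 * g - \<epsilon>0 / v * \<bar>1 - p\<bar>"
      ultimately have "1 + D \<le> 1 + D / 2" using X_le by (metis order_trans)
      moreover have "0 < D" using \<epsilon>02 by (simp add: D_def)
      ultimately show False by simp
    qed
    moreover have "n U1 N \<le> n V N" unfolding n_def
      using U1W W(4) by (intro size_mset_mono) (auto simp: subseteq_mset_def)
    then have "\<beta>1 \<le> n V N / N" unfolding \<beta>1_def by (intro divide_right_mono) auto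
    ultimately show ?case unfolding n_def \<alpha>0_def v_def by linarith
  qed
qed

text \<open>Removes the restriction to sets of smaller measure than \<open>A\<close>, which had left
  room for a second piece: \<open>K\<close> is first replaced by a compact subset of slightly
  smaller measure.\<close>

lemma minimizer_mass_lower:
  assumes A: "compact A" "A \<subseteq> \<Omega>" "\<forall>\<^sub>F N in sequentially. is_minimizer e A N (\<omega> N)" "0 < measure lborel A"
    and K: "compact K" "K \<subseteq> A" and V: "open V" "K \<subseteq> V" and c: "0 < c" "c < 1"
  shows "\<forall>\<^sub>F N in sequentially.
    c * (measure lborel K / measure lborel A) \<le> size (filter_mset (\<lambda>x. x \<in> V) (\<omega> N)) / N"
proof (cases "measure lborel K = 0")
  case True
  then show ?thesis by simp
next
  case False
  then have K0: "0 < measure lborel K" by (simp add: zero_less_measure_iff)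
  \<comment> \<open>One factor \<open>d\<close> is spent on the smaller set and one on its mass
    bound; \<open>d * d\<close> is at least \<open>c\<close> because the difference is a
    square.\<close>
  define d where "d = (1 + c) / 2"
  have d: "0 < d" "d < 1" using c by (auto simp: d_def)
  have dd: "c \<le> d * d"
  proof -
    have "d * d - c = ((1 - c) / 2) * ((1 - c) / 2)" by (simp add: d_def field_simps)
    then show ?thesis using zero_le_square[of "(1 - c) / 2"] by linarith
  qed
  have "0 < (1 - d) * measure lborel K" using d K0 by simp
  then obtain L where L: "compact L" "L \<subseteq> K" "measure lborel L < measure lborel K"
    "measure lborel K - (1 - d) * measure lborel K \<le> measure lborel L"
    using compact_smaller_measure[OF K(1) K0] by metis
  have L1: "d * measure lborel K \<le> measure lborel L" using L(4) by (simp add: algebra_simps)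
  have L0: "0 < measure lborel L" using L1 d K0 by (meson less_le_trans mult_pos_pos)
  have "measure lborel K \<le> measure lborel A" using A K by (intro measure_mono_compact borel_compact) auto
  then have "\<forall>\<^sub>F N in sequentially.
    d * (measure lborel L / measure lborel A) \<le> size (filter_mset (\<lambda>x. x \<in> V) (\<omega> N)) / N"
    using L K V d L0 by (intro minimizer_mass_lower_aux[OF A(1-3)]) auto
  moreover have "c * (measure lborel K / measure lborel A) \<le> d * (measure lborel L / measure lborel A)"
  proof -
    have "c * measure lborel K \<le> d * (d * measure lborel K)"
      using dd K0 unfolding mult.assoc[symmetric] by (intro mult_right_mono) auto
    also have "\<dots> \<le> d * measure lborel L" using L1 d by (intro mult_left_mono) auto
    finally show ?thesis using A(4) by (simp add: divide_right_mono)
  qed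
  ultimately show ?thesis by (auto elim!: eventually_mono)
qed

end

section \<open>Weak* convergence of minimizers\<close>

text \<open>Half of a discrete layer cake formula. Strict levels \<open>k - 1\<close> are used here
  and closed levels \<open>k\<close> in the other half, so that the layers of the one are
  neighbourhoods of the layers of the other.\<close>

lemma layer_sum_upper:
  fixes y \<delta> :: real
  assumes "0 \<le> y" "0 < \<delta>"
  shows "\<delta> * (\<Sum>k=1..n. of_bool ((real k - 1) * \<delta> < y)) \<le> y + \<delta>"
proof (induction n)
  case (Suc n)
  show ?case
  proof (cases "real n * \<delta> < y")
    case True
    have "(\<Sum>k=1..Suc n. of_bool ((real k - 1) * \<delta> < y) :: real) \<le> (\<Sum>k=1..Suc n. 1)"
      by (intro sum_mono) auto
    then have "\<delta> * (\<Sum>k=1..Suc n. of_bool ((real k - 1) * \<delta> < y)) \<le> \<delta> * (real n + 1)"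
      using assms by (intro mult_left_mono) auto
    then show ?thesis using True by (simp add: algebra_simps)
  qed (use Suc in simp)
qed (use assms in simp)

lemma layer_sum_lower:
  fixes y \<delta> :: real
  assumes "0 < \<delta>" "y \<le> (real n + 1) * \<delta>"
  shows "y \<le> \<delta> * (\<Sum>k=1..n. of_bool (real k * \<delta> \<le> y)) + \<delta>"
  using assms(2)
proof (induction n)
  case (Suc n)
  show ?case
  proof (cases "real (Suc n) * \<delta> \<le> y")
    case True
    have "real k * \<delta> \<le> y" if "k \<in> {1..Suc n}" for k
    proof -
      have "real k * \<delta> \<le> real (Suc n) * \<delta>" using that assms(1) by (intro mult_right_mono) auto
      with True show ?thesis by linarith
    qed
    then have "(\<Sum>k=1..Suc n. of_bool (real k * \<delta> \<le> y) :: real) = (\<Sum>k=1..Suc n. 1)"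
      by (intro sum.cong) auto
    then show ?thesis using Suc.prems by (simp add: algebra_simps)
  next
    case False
    then have "y \<le> (real n + 1) * \<delta>" by (simp add: algebra_simps)
    from Suc.IH[OF this] False show ?thesis by simp
  qed
qed simp

context prob_space
begin

text \<open>Integrated layer sums: masses of superlevel sets determine the integral up to
  \<open>\<delta>\<close>, open ones from below and closed ones from above.\<close>

lemma layer_integral:
  fixes f :: "'a \<Rightarrow> real"
  assumes A: "A \<in> events" and f: "(\<lambda>x. indicator A x * f x) \<in> borel_measurable M"
    and bnd: "\<And>x. x \<in> A \<Longrightarrow> 0 \<le> f x" "\<And>x. x \<in> A \<Longrightarrow> f x \<le> (real n + 1) * \<delta>" and "0 < \<delta>"
    and L: "\<And>k. k \<in> {1..n} \<Longrightarrow> {x\<in>A. (real k - 1) * \<delta> < f x} \<in> events"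
    and K: "\<And>k. k \<in> {1..n} \<Longrightarrow> {x\<in>A. real k * \<delta> \<le> f x} \<in> events"
  shows "\<delta> * (\<Sum>k=1..n. prob {x\<in>A. (real k - 1) * \<delta> < f x}) \<le> set_lebesgue_integral M A f + \<delta>"
    "set_lebesgue_integral M A f \<le> \<delta> * (\<Sum>k=1..n. prob {x\<in>A. real k * \<delta> \<le> f x}) + \<delta>"
proof -
  define F where "F x = indicator A x * f x" for x
  have int: "integrable M F"
  proof (rule integrable_const_bound)
    show "AE x in M. norm (F x) \<le> (real n + 1) * \<delta>"
      using bnd \<open>0 < \<delta>\<close> by (intro AE_I2) (auto simp: F_def indicator_def)
  qed (use f in \<open>simp add: F_def[abs_def]\<close>)
  have eq: "set_lebesgue_integral M A f = (\<integral>x. F x \<partial>M)"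
    by (simp add: set_lebesgue_integral_def F_def[abs_def])
  have sums: "integrable M (\<lambda>x. \<delta> * (\<Sum>k=1..n. indicator (E k) x))"
    "(\<integral>x. \<delta> * (\<Sum>k=1..n. indicator (E k) x) \<partial>M) = \<delta> * (\<Sum>k=1..n. prob (E k))"
    if E: "\<And>k. k \<in> {1..n} \<Longrightarrow> E k \<in> events" for E :: "nat \<Rightarrow> 'a set"
  proof -
    have i: "integrable M (indicator (E k) :: 'a \<Rightarrow> real)" if "k \<in> {1..n}" for k
      using E[OF that] by (simp add: emeasure_eq_measure)
    show "integrable M (\<lambda>x. \<delta> * (\<Sum>k=1..n. indicator (E k) x))" using i by auto
    have "(\<integral>x. \<delta> * (\<Sum>k=1..n. indicator (E k) x) \<partial>M) = \<delta> * (\<Sum>k=1..n. \<integral>x. indicator (E k) x \<partial>M)"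
      using i by (subst integral_mult_right_zero, subst Bochner_Integration.integral_sum) auto
    also have "(\<Sum>k=1..n. \<integral>x. indicator (E k) x \<partial>M) = (\<Sum>k=1..n. prob (E k))"
      using E by (intro sum.cong) auto
    finally show "(\<integral>x. \<delta> * (\<Sum>k=1..n. indicator (E k) x) \<partial>M) = \<delta> * (\<Sum>k=1..n. prob (E k))" .
  qed
  have "\<delta> * (\<Sum>k=1..n. prob {x\<in>A. (real k - 1) * \<delta> < f x}) =
      (\<integral>x. \<delta> * (\<Sum>k=1..n. indicator {x\<in>A. (real k - 1) * \<delta> < f x} x) \<partial>M)"
    using L by (intro sums(2)[symmetric])
  also have "\<dots> \<le> (\<integral>x. F x + \<delta> \<partial>M)"
  proof (rule integral_mono)
    show "\<delta> * (\<Sum>k=1..n. indicator {x\<in>A. (real k - 1) * \<delta> < f x} x) \<le> F x + \<delta>" for x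
    proof (cases "x \<in> A")
      case True
      then show ?thesis using layer_sum_upper[OF bnd(1)[OF True] \<open>0 < \<delta>\<close>, of n]
        by (simp add: F_def indicator_def of_bool_def)
    qed (use \<open>0 < \<delta>\<close> in \<open>simp add: F_def\<close>)
  qed (use int sums(1) L in auto)
  also have "\<dots> = (\<integral>x. F x \<partial>M) + \<delta>" using int by (simp add: prob_space)
  finally show "\<delta> * (\<Sum>k=1..n. prob {x\<in>A. (real k - 1) * \<delta> < f x}) \<le> set_lebesgue_integral M A f + \<delta>"
    by (simp add: eq)
  have "(\<integral>x. F x \<partial>M) \<le> (\<integral>x. \<delta> * (\<Sum>k=1..n. indicator {x\<in>A. real k * \<delta> \<le> f x} x) + \<delta> \<partial>M)"
  proof (rule integral_mono)
    show "F x \<le> \<delta> * (\<Sum>k=1..n. indicator {x\<in>A. real k * \<delta> \<le> f x} x) + \<delta>" for x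
    proof (cases "x \<in> A")
      case True
      then show ?thesis using layer_sum_lower[OF \<open>0 < \<delta>\<close> bnd(2)[OF True]]
        by (simp add: F_def indicator_def of_bool_def)
    qed (use \<open>0 < \<delta>\<close> in \<open>simp add: F_def\<close>)
  qed (use int sums(1) K in auto)
  also have "\<dots> = \<delta> * (\<Sum>k=1..n. prob {x\<in>A. real k * \<delta> \<le> f x}) + \<delta>"
    using sums K by (subst Bochner_Integration.integral_add) (auto simp: prob_space)
  finally show "set_lebesgue_integral M A f \<le> \<delta> * (\<Sum>k=1..n. prob {x\<in>A. real k * \<delta> \<le> f x}) + \<delta>"
    by (simp add: eq)
qed

end

lemma measure_pmf_of_multiset:
  assumes "\<omega> \<noteq> {#}"
  shows "measure (measure_pmf (pmf_of_multiset \<omega>)) V = size (filter_mset (\<lambda>x. x \<in> V) \<omega>) / size \<omega>"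
proof -
  have "measure (measure_pmf (pmf_of_multiset \<omega>)) V = measure (measure_pmf (pmf_of_multiset \<omega>)) (V \<inter> set_mset \<omega>)"
    using measure_Int_set_pmf[of "pmf_of_multiset \<omega>" V] assms by simp
  also have "\<dots> = (\<Sum>x\<in>V \<inter> set_mset \<omega>. count \<omega> x / size \<omega>)"
    using assms by (subst measure_measure_pmf_finite) auto
  also have "\<dots> = (\<Sum>x\<in>V \<inter> set_mset \<omega>. count \<omega> x) / size \<omega>" by (simp add: sum_divide_distrib)
  also have "(\<Sum>x\<in>V \<inter> set_mset \<omega>. count \<omega> x) = size (filter_mset (\<lambda>x. x \<in> V) \<omega>)"
    unfolding size_multiset_overloaded_eq by (intro sum.cong) auto
  finally show ?thesis .
qed

text \<open>The integrals are compared level by level: \<open>{x\<in>A. (k - 1) * \<delta> < f x}\<close> is a relatively open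
  neighbourhood of the compact set \<open>{x\<in>A. k * \<delta> \<le> f x}\<close>.\<close>

lemma weak_star_convI:
  fixes M :: "nat \<Rightarrow> 'a::heine_borel measure" and \<mu> :: "'a measure"
  assumes A: "compact A"
    and M: "\<And>N. prob_space (M N)" "\<And>N. sets borel \<subseteq> sets (M N)" "\<And>N. space (M N) = UNIV"
      "\<forall>\<^sub>F N in sequentially. measure (M N) A = 1"
    and \<mu>: "prob_space \<mu>" "sets \<mu> = sets borel" "measure \<mu> A = 1"
    and lower: "\<And>K V c. compact K \<Longrightarrow> K \<subseteq> A \<Longrightarrow> open V \<Longrightarrow> K \<subseteq> V \<Longrightarrow> 0 < c \<Longrightarrow> c < 1 \<Longrightarrow>
      \<forall>\<^sub>F N in sequentially. c * measure \<mu> K \<le> measure (M N) V"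
  shows "weak_star_conv_on A M \<mu>"
proof -
  have AM: "A \<in> sets (M N)" "A \<in> sets \<mu>" for N using A M(2) \<mu>(2) borel_compact by auto
  have meas: "g \<in> borel_measurable (M N)" if "g \<in> borel_measurable borel" for g :: "'a \<Rightarrow> real" and N
    using that M(2)[of N] M(3)[of N] unfolding measurable_def by auto
  have meas\<mu>: "g \<in> borel_measurable \<mu>" if "g \<in> borel_measurable borel" for g :: "'a \<Rightarrow> real"
    using that \<mu>(2) by (simp cong: measurable_cong_sets)
  have ind: "(\<lambda>x. indicator A x * f x) \<in> borel_measurable borel" if "continuous_on A f" for f :: "'a \<Rightarrow> real"
    using borel_measurable_continuous_on_indicator[OF _ that] borel_compact[OF A] by simp
  \<comment> \<open>Lower bounds for masses of open sets give one inequality, and only for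
    nonnegative functions. It is applied to both \<open>b + f\<close> and \<open>b - f\<close> for a
    bound \<open>b\<close> of \<open>f\<close>; the total mass \<open>1\<close> lets the constant
    cancel.\<close>
  have nonneg: "\<forall>\<^sub>F N in sequentially. set_lebesgue_integral \<mu> A f - \<epsilon> \<le> set_lebesgue_integral (M N) A f"
    if f: "continuous_on A f" "\<And>x. x \<in> A \<Longrightarrow> 0 \<le> f x" and \<epsilon>: "0 < \<epsilon>" for f :: "'a \<Rightarrow> real" and \<epsilon>
  proof -
    have "bounded (f ` A)" using A f(1) compact_continuous_image compact_imp_bounded by blast
    then obtain b0 where "\<And>x. x \<in> A \<Longrightarrow> norm (f x) \<le> b0" by (auto simp: bounded_iff)
    define b where "b = \<bar>b0\<bar> + 1"
    have b: "0 < b" "f x \<le> b" if "x \<in> A" for x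
      using \<open>\<And>x. x \<in> A \<Longrightarrow> norm (f x) \<le> b0\<close>[OF that] by (auto simp: b_def)
    have b0: "0 < b" by (simp add: b_def)
    \<comment> \<open>The layer errors of the two integrals sum to at most
      \<open>\<epsilon> / 2\<close>; the rest pays for the factor \<open>c\<close>.\<close>
    define \<delta> where "\<delta> = \<epsilon> / 4"
    have \<delta>: "0 < \<delta>" using \<epsilon> by (simp add: \<delta>_def)
    obtain n :: nat where "b / \<delta> \<le> real n" using real_arch_simple by blast
    then have n: "f x \<le> (real n + 1) * \<delta>" if "x \<in> A" for x
      using b(2)[OF that] \<delta> by (simp add: field_simps)
    \<comment> \<open>Close enough to \<open>1\<close> that the factor costs at most
      \<open>\<epsilon> / 2\<close> on an integral bounded by \<open>b\<close>; the maximum with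
      \<open>1/2\<close> keeps it positive.\<close>
    define c where "c = max (1/2) (1 - \<epsilon> / (2 * b))"
    have c: "0 < c" "c < 1" "(1 - c) * b \<le> \<epsilon> / 2"
    proof -
      show "0 < c" "c < 1" using \<epsilon> b0 by (auto simp: c_def)
      have "1 - c \<le> \<epsilon> / (2 * b)" by (simp add: c_def max_def)
      then have "(1 - c) * b \<le> \<epsilon> / (2 * b) * b" using b0 by (intro mult_right_mono) auto
      then show "(1 - c) * b \<le> \<epsilon> / 2" using b0 by simp
    qed
    define K where "K k = {x\<in>A. real k * \<delta> \<le> f x}" for k :: nat
    define L where "L k = {x\<in>A. (real k - 1) * \<delta> < f x}" for k :: nat
    have K: "compact (K k)" "K k \<subseteq> A" "K k \<in> sets \<mu>" "K k \<in> sets (M N)" for k N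
    proof -
      have "closedin (top_of_set A) (A \<inter> f -` {real k * \<delta>..})"
        by (rule continuous_closedin_preimage[OF f(1)]) simp
      moreover have "A \<inter> f -` {real k * \<delta>..} = K k" by (auto simp: K_def)
      ultimately show c: "compact (K k)" using A closedin_compact by metis
      show "K k \<subseteq> A" by (auto simp: K_def)
      show "K k \<in> sets \<mu>" "K k \<in> sets (M N)" using borel_compact[OF c] M(2) \<mu>(2) by auto
    qed
    have "\<exists>V. open V \<and> L k = A \<inter> V" for k
    proof -
      have "openin (top_of_set A) (A \<inter> f -` {(real k - 1) * \<delta><..})"
        by (rule continuous_openin_preimage_gen[OF f(1)]) simp
      moreover have "A \<inter> f -` {(real k - 1) * \<delta><..} = L k" by (auto simp: L_def)
      ultimately show ?thesis by (simp add: openin_open)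
    qed
    then obtain V where V: "\<And>k. open (V k)" "\<And>k. L k = A \<inter> V k" by metis
    have L: "L k \<in> sets \<mu>" "L k \<in> sets (M N)" for k N
      using V(1)[of k] AM \<mu>(2) M(2)[of N] unfolding V(2) by (auto intro!: sets.Int)
    have KL: "K k \<subseteq> V k" for k
    proof -
      have "K k \<subseteq> L k" using \<delta> by (auto simp: K_def L_def algebra_simps)
      then show ?thesis using V(2) by blast
    qed
    have "\<forall>\<^sub>F N in sequentially. \<forall>k\<in>{1..n}. c * measure \<mu> (K k) \<le> measure (M N) (V k)"
      using K V KL c by (intro eventually_ball_finite ballI lower) auto
    with M(4) show ?thesis
    proof eventually_elim
      case (elim N)
      interpret MN: prob_space "M N" by (rule M(1))
      interpret \<mu>: prob_space \<mu> by (rule \<mu>(1))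
      \<comment> \<open>The measure lives on \<open>A\<close>, so the open set and its trace on
        \<open>A\<close> have the same mass.\<close>
      have VL: "measure (M N) (V k) = measure (M N) (L k)" for k
      proof -
        have Vs: "V k \<in> sets (M N)" by (rule subsetD[OF M(2) borel_open[OF V(1)]])
        have "AE x in M N. x \<in> A" using elim(1) MN.prob_eq_1[OF AM(1)] by simp
        then have "AE x in M N. x \<in> V k \<longleftrightarrow> x \<in> A \<inter> V k" by eventually_elim simp
        then show ?thesis unfolding V(2)
          by (rule MN.finite_measure_eq_AE) (rule Vs, rule sets.Int[OF AM(1) Vs])
      qed
      have "set_lebesgue_integral \<mu> A f \<le> \<delta> * (\<Sum>k=1..n. measure \<mu> (K k)) + \<delta>"
        unfolding K_def
        by (rule \<mu>.layer_integral(2)[OF AM(2) meas\<mu>[OF ind[OF f(1)]] f(2) n \<delta>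
              L(1)[unfolded L_def] K(3)[unfolded K_def]])
      then have "c * set_lebesgue_integral \<mu> A f \<le> c * (\<delta> * (\<Sum>k=1..n. measure \<mu> (K k)) + \<delta>)"
        using c by (intro mult_left_mono) auto
      also have "\<dots> = \<delta> * (\<Sum>k=1..n. c * measure \<mu> (K k)) + c * \<delta>"
        by (simp add: algebra_simps sum_distrib_left)
      also have "\<dots> \<le> \<delta> * (\<Sum>k=1..n. measure (M N) (L k)) + \<delta>"
        using c \<delta> elim(2) by (intro add_mono mult_left_mono sum_mono) (auto simp: VL[symmetric])
      also have "\<delta> * (\<Sum>k=1..n. measure (M N) (L k)) \<le> set_lebesgue_integral (M N) A f + \<delta>"
        unfolding L_def
        by (rule MN.layer_integral(1)[OF AM(1) meas[OF ind[OF f(1)]] f(2) n \<delta>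
              L(2)[unfolded L_def] K(4)[unfolded K_def]])
      finally have main: "c * set_lebesgue_integral \<mu> A f \<le> set_lebesgue_integral (M N) A f + \<epsilon> / 2"
        by (simp add: \<delta>_def)
      have "set_lebesgue_integral \<mu> A f \<le> b"
      proof -
        have "set_lebesgue_integral \<mu> A f \<le> (\<integral>x. b \<partial>\<mu>)" unfolding set_lebesgue_integral_def
        proof (rule integral_mono)
          show "integrable \<mu> (\<lambda>x. indicator A x *\<^sub>R f x)"
            using meas\<mu>[OF ind[OF f(1)]] f(2) b b0
            by (intro \<mu>.integrable_const_bound[where B = b] AE_I2) (auto simp: indicator_def)
          show "indicator A x *\<^sub>R f x \<le> b" for x using b b0 by (auto simp: indicator_def)
        qed auto
        then show ?thesis by (simp add: \<mu>.prob_space)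
      qed
      then have "(1 - c) * set_lebesgue_integral \<mu> A f \<le> (1 - c) * b" using c by (intro mult_left_mono) auto
      with c(3) main show ?case by (simp add: algebra_simps)
    qed
  qed
  show ?thesis unfolding weak_star_conv_on_def
  proof (intro allI impI)
    fix f :: "'a \<Rightarrow> real" assume f: "continuous_on A f"
    have "bounded (f ` A)" using A f compact_continuous_image compact_imp_bounded by blast
    then obtain b where b: "\<And>x. x \<in> A \<Longrightarrow> \<bar>f x\<bar> \<le> b" by (auto simp: bounded_iff)
    have shift: "set_lebesgue_integral P A (\<lambda>x. s * f x + b) = s * set_lebesgue_integral P A f + b"
      if P: "prob_space P" "A \<in> sets P" "(\<lambda>x. indicator A x * f x) \<in> borel_measurable P" "measure P A = 1"
      for P :: "'a measure" and s
    proof -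
      interpret P: prob_space P by (rule P(1))
      have 1: "set_integrable P A f" unfolding set_integrable_def
      proof (rule P.integrable_const_bound[where B = "\<bar>b\<bar>"])
        show "AE x in P. norm (indicat_real A x *\<^sub>R f x) \<le> \<bar>b\<bar>"
        proof (rule AE_I2)
          fix x show "norm (indicat_real A x *\<^sub>R f x) \<le> \<bar>b\<bar>" using b[of x] by (cases "x \<in> A") auto
        qed
      qed (use P(3) in simp)
      have 2: "set_integrable P A (\<lambda>_. b)" unfolding set_integrable_def
        using P(2) by (auto simp: P.emeasure_eq_measure)
      have "set_lebesgue_integral P A (\<lambda>x. s * f x + b) =
          set_lebesgue_integral P A (\<lambda>x. s * f x) + set_lebesgue_integral P A (\<lambda>_. b)"
        using 1 2 by (intro set_integral_add) auto
      also have "set_lebesgue_integral P A (\<lambda>_. b) = b"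
        using P(2,4) by (simp add: set_lebesgue_integral_def)
      finally show ?thesis by simp
    qed
    show "(\<lambda>N. set_lebesgue_integral (M N) A f) \<longlonglongrightarrow> set_lebesgue_integral \<mu> A f"
    proof (rule tendstoI)
      fix \<epsilon> :: real assume \<epsilon>: "0 < \<epsilon>"
      have "\<forall>\<^sub>F N in sequentially. set_lebesgue_integral \<mu> A (\<lambda>x. s * f x + b) - \<epsilon> / 2 \<le>
          set_lebesgue_integral (M N) A (\<lambda>x. s * f x + b)" if "s = 1 \<or> s = - 1" for s
      proof (rule nonneg)
        show "continuous_on A (\<lambda>x. s * f x + b)" by (intro continuous_intros f)
        show "0 \<le> s * f x + b" if "x \<in> A" for x using b[OF that] \<open>s = 1 \<or> s = - 1\<close> by auto
      qed (use \<epsilon> in simp)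
      from this[OF disjI1[OF refl]] this[OF disjI2[OF refl]] M(4)
      show "\<forall>\<^sub>F N in sequentially. dist (set_lebesgue_integral (M N) A f) (set_lebesgue_integral \<mu> A f) < \<epsilon>"
      proof eventually_elim
        case (elim N)
        have s: "set_lebesgue_integral \<mu> A (\<lambda>x. s * f x + b) = s * set_lebesgue_integral \<mu> A f + b"
          "set_lebesgue_integral (M N) A (\<lambda>x. s * f x + b) = s * set_lebesgue_integral (M N) A f + b" for s
          using M(1)[of N] AM elim(3) \<mu> meas[OF ind[OF f]] meas\<mu>[OF ind[OF f]] by (auto intro!: shift)
        show ?case using elim(1,2) \<epsilon> unfolding s dist_real_def by linarith
      qed
    qed
  qed
qed

context short_range_functional
begin

lemma minimizers_weak_star_conv:
  assumes A: "compact A" "A \<subseteq> \<Omega>" "0 < measure lborel A"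
    and \<omega>: "\<forall>\<^sub>F N in sequentially. is_minimizer e A N (\<omega> N)"
  shows "weak_star_conv_on A (\<lambda>N. measure_pmf (pmf_of_multiset (\<omega> N))) (uniform_measure lborel A)"
proof (rule weak_star_convI[OF A(1)])
  have As: "A \<in> sets lborel" using borel_compact[OF A(1)] by simp
  have em: "emeasure lborel A \<noteq> 0" "emeasure lborel A \<noteq> \<infinity>"
    using A(3) emeasure_bounded_finite[OF compact_imp_bounded[OF A(1)]] by (auto simp: measure_def)
  \<comment> \<open>The pmf of a multiset is meaningful only if the multiset is nonempty, which
    holds from \<open>N = 1\<close> on among minimizers.\<close>
  have nonempty: "\<forall>\<^sub>F N in sequentially. \<omega> N \<noteq> {#} \<and> size (\<omega> N) = N \<and> set_mset (\<omega> N) \<subseteq> A"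
    using \<omega> eventually_gt_at_top[of 0] by eventually_elim (auto simp: is_minimizer_def)
  then show "\<forall>\<^sub>F N in sequentially. measure (measure_pmf (pmf_of_multiset (\<omega> N))) A = 1"
  proof eventually_elim
    case (elim N)
    then have "filter_mset (\<lambda>x. x \<in> A) (\<omega> N) = \<omega> N" by (intro filter_mset_eq_conv[THEN iffD2]) auto
    then show ?case using elim nonempty_has_size[of "\<omega> N"] by (auto simp: measure_pmf_of_multiset)
  qed
  show "prob_space (uniform_measure lborel A)" using em by (intro prob_space_uniform_measure) auto
  show "sets (uniform_measure lborel A) = sets borel" by simp
  show "measure (uniform_measure lborel A) A = 1" using em As A(3) by simp
  fix K V :: "(real ^ 'd) set" and c :: real
  assume K: "compact K" "K \<subseteq> A" and V: "open V" "K \<subseteq> V" and c: "0 < c" "c < 1"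
  have "A \<inter> K = K" using K by auto
  then have \<mu>K: "measure (uniform_measure lborel A) K = measure lborel K / measure lborel A"
    using em borel_compact[OF K(1)] by simp
  show "\<forall>\<^sub>F N in sequentially. c * measure (uniform_measure lborel A) K \<le> measure (measure_pmf (pmf_of_multiset (\<omega> N))) V"
    using minimizer_mass_lower[OF A(1,2) \<omega> A(3) K V c] nonempty
    by eventually_elim (simp add: \<mu>K measure_pmf_of_multiset)
qed (auto simp: measure_pmf.prob_space_axioms)

end

theorem theorem1p1:
  fixes \<Omega> :: "(real ^ 'd) set" and e :: "'d functional"
    and \<tau> :: "real \<Rightarrow> real" and \<zeta> E0 :: real and N0 :: nat and S :: "real set"
  assumes "open \<Omega>" and "bounded \<Omega>" and "unit_cube \<subseteq> \<Omega>"
    and "interaction_functional \<Omega> N0 E0 e"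
    and "lower_semicontinuous_functional \<Omega> N0 e"
    and "\<zeta> \<noteq> 0"
    and "set_monotonic \<Omega> \<tau> \<zeta> e"
    and "rate \<tau>"
    and "mono_on {0<..} \<tau> \<or> antimono_on {0<..} \<tau>"
    and "S \<subseteq> {0<..}" and "S \<in> sets lebesgue" and "0 < emeasure lebesgue S"
    and "\<And>s. s \<in> S \<Longrightarrow> \<exists>l. ((\<lambda>u. \<tau> (s * u) / \<tau> u) \<longlongrightarrow> l) at_top"
    and "strictly_convex_on {0<..} (rate_limit \<tau>)"
    and "\<And>x a. 0 < a \<Longrightarrow> cube x a \<subseteq> \<Omega> \<Longrightarrow> convergent (scaled_energy e \<tau> (cube x a)) \<and>
           0 < energy_limit e \<tau> (cube x a) \<and> energy_limit e \<tau> (cube x a) < \<infinity>"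
    and "\<And>x y a. 0 < a \<Longrightarrow> cube x a \<subseteq> \<Omega> \<Longrightarrow> cube y a \<subseteq> \<Omega> \<Longrightarrow>
           energy_limit e \<tau> (cube x a) = energy_limit e \<tau> (cube y a)"
    and "short_range \<Omega> N0 \<zeta> e"
    and "continuity_on_cubes \<Omega> \<tau> \<zeta> e"
  shows "\<exists>\<sigma>. (\<sigma> < -1 \<or> 0 < \<sigma>) \<and>
    (\<forall>s>0. ((\<lambda>u. \<tau> (s * u) / \<tau> u) \<longlongrightarrow> rate_limit \<tau> s) at_top \<and>
           rate_limit \<tau> s = s powr (1 + \<sigma>)) \<and>
    mono_on {0<..} (\<lambda>u. sgn \<sigma> * \<tau> u) \<and>
    (\<forall>A. compact A \<longrightarrow> A \<subseteq> \<Omega> \<longrightarrow> A \<noteq> {} \<longrightarrow>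
       scaled_energy e \<tau> A \<longlonglongrightarrow> energy_limit e \<tau> unit_cube * neg_powr (measure lborel A) \<sigma>) \<and>
    (\<forall>A \<omega>. compact A \<longrightarrow> A \<subseteq> \<Omega> \<longrightarrow> 0 < measure lborel A \<longrightarrow>
       (\<forall>\<^sub>F N in sequentially. is_minimizer e A N (\<omega> N)) \<longrightarrow>
       weak_star_conv_on A (\<lambda>N. measure_pmf (pmf_of_multiset (\<omega> N))) (uniform_measure lborel A))"
proof -
  have \<tau>_pos: "0 < \<tau> u" if "0 < u" for u using \<open>rate \<tau>\<close> that by (simp add: rate_def)
  obtain p where p: "(p < 0 \<and> antimono_on {0<..} \<tau>) \<or> (1 < p \<and> mono_on {0<..} \<tau>)"
    and w: "\<And>s. 0 < s \<Longrightarrow> rate_limit \<tau> s = s powr p"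
    and lim: "\<And>s. 0 < s \<Longrightarrow> ((\<lambda>u. \<tau> (s * u) / \<tau> u) \<longlongrightarrow> s powr p) at_top"
    by (rule regularly_varying_rate[OF _ assms(9,14)]) (erule \<tau>_pos, rule that)
  interpret short_range_functional \<Omega> e \<tau> \<zeta> E0 N0 p
    by unfold_locales (fact assms \<tau>_pos lim p)+
  show ?thesis
  proof (intro exI[of _ "p - 1"] conjI allI impI)
    show "p - 1 < - 1 \<or> 0 < p - 1" using p by auto
    show "mono_on {0<..} (\<lambda>u. sgn (p - 1) * \<tau> u)"
      using p by (auto simp: monotone_on_def)
    fix s :: real assume "0 < s"
    then show "((\<lambda>u. \<tau> (s * u) / \<tau> u) \<longlongrightarrow> rate_limit \<tau> s) at_top"
      "rate_limit \<tau> s = s powr (1 + (p - 1))"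
      using w lim by simp_all
  qed (rule energy_limit_compact minimizers_weak_star_conv; assumption)+
qed

end
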